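(* Let $M^n$ be an $n$-dimensional Lagrangian submanifold of a complex space form $\tilde M^n(4c)$ of complex dimension $n$ and constant holomorphic sectional curvature $4c$. Let $k\geq 1$ and let $n_1,\ldots,n_k$ be integers satisfying $2\leq n_1\leq\ldots\leq n_k\leq n-1$ and $n_1+\ldots+n_k<n$. Then, at any point of $M^n$, $$\delta(n_1,\ldots,n_k)\leq \frac{n^2\left(n-\sum_{i=1}^k n_i+3k-1-6\sum_{i=1}^k\frac{1}{2+n_i}\right)}{2\left(n-\sum_{i=1}^k n_i+3k+2-6\sum_{i=1}^k\frac{1}{2+n_i}\right)}\|H\|^2+\frac12\left(n(n-1)-\sum_{i=1}^k n_i(n_i-1)\right)c.$$ Assume moreover that equality holds at a point $p\in M^n$. Let $L_1,\ldots,L_k$ be mutually orthogonal subspaces of $T_pM^n$ with $\dim L_i=n_i$ minimizing $\tau(L_1)+\ldots+\tau(L_k)$ among all such $k$-tuples, let $\{e_1,\ldots,e_n\}$ be an orthonormal basis of $T_pM^n$ adapted to $L_1,\ldots,L_k$ (i.e. $e_A\in L_i$ for all $A\in\Delta_i$, $i=1,\ldots,k$), and let $h^C_{AB}=\langle h(e_A,e_B),Je_C\rangle$. Then: <br> (1) $h^A_{BC}=0$ whenever $A,B,C\in\{1,\ldots,n\}$ are mutually different and not all in the same $\Delta_i$ for some $i\in\{1,\ldots,k\}$; <br> (2) for every $i\in\{1,\ldots,k\}$ and $\alpha_i\in\Delta_i$: $h^{\alpha_i}_{\alpha_j\alpha_j}=0$ for all $j\in\{1,\ldots,k\}$ with $j\neq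 i$ and all $\alpha_j\in\Delta_j$; $h^{\alpha_i}_{rr}=0$ for all $r\in\Delta_{k+1}$; and $\sum_{\beta_i\in\Delta_i}h^{\alpha_i}_{\beta_i\beta_i}=0$; <br> (3) for every $r\in\Delta_{k+1}$: $h^r_{rr}=3h^r_{ss}$ for all $s\in\Delta_{k+1}$ with $s\neq r$, and $h^r_{rr}=(n_i+2)h^r_{\alpha_i\alpha_i}$ for all $i\in\{1,\ldots,k\}$ and $\alpha_i\in\Delta_i$.
   Context: Delta-invariants. Let $p$ be a point of an $n$-dimensional Riemannian manifold $M^n$. For a linear subspace $L\subseteq T_pM^n$ with orthonormal basis $\{e_1,\ldots,e_\ell\}$, put $\tau(L)=\sum_{1\leq i<j\leq \ell}K(e_i\wedge e_j)$, where $K(e_i\wedge e_j)$ is the sectional curvature of the plane spanned by $e_i,e_j$ (this is independent of the chosen orthonormal basis). Put $\tau=\tau(T_pM^n)$. For integers $2\leq n_1\leq\ldots\leq n_k\leq n-1$ with $n_1+\ldots+n_k\leq n$, define $$\delta(n_1,\ldots,n_k)(p)=\tau-\inf\left\{\sum_{i=1}^k\tau(L_i)\right\},$$ where the infimum runs over all $k$-tuples $(L_1,\ldots,L_k)$ of mutually orthogonal subspaces of $T_pM^n$ with $\dim L_i=n_i$; the infimum is attained. Lagrangian submanifolds. A complex space form $\tilde M^n(4c)$ is a Kähler manifold of complex dimension $n$ with constant holomorphic sectional curvature $4c$, $c\in\mathbb{R}$; its complex structure is denoted $J$ and its metric $\langle\cdot,\cdot\rangle$. A submanifold $M^n$ of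 real dimension $n$ (isometrically immersed, with the induced metric) is Lagrangian if $J$ maps its tangent spaces into its normal spaces and vice versa at every point. The second fundamental form $h$ is the normal part of the ambient covariant derivative: $\tilde\nabla_XY=\nabla_XY+h(X,Y)$ with $\nabla$, $\tilde\nabla$ the Levi-Civita connections of $M^n$ and $\tilde M^n(4c)$. The mean curvature vector is $H=\frac1n\,\mathrm{trace}(h)$. For a Lagrangian submanifold the form $\langle h(\cdot,\cdot),J\cdot\rangle$ is totally symmetric, so $h^C_{AB}$ is symmetric in $A,B,C$. Index blocks. $\Delta_1=\{1,\ldots,n_1\}$, $\Delta_2=\{n_1+1,\ldots,n_1+n_2\}$, ..., $\Delta_k=\{n_1+\ldots+n_{k-1}+1,\ldots,n_1+\ldots+n_k\}$, and $\Delta_{k+1}=\{n_1+\ldots+n_k+1,\ldots,n\}$. *)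

theory Defs
  imports "HOL-Analysis.Analysis"
begin

section \<open>Smooth maps between open subsets of Euclidean spaces\<close>

primrec Ck_on :: "nat \<Rightarrow> 'e::euclidean_space set \<Rightarrow> ('e \<Rightarrow> 'f::real_normed_vector) \<Rightarrow> bool" where
  "Ck_on 0 S f \<longleftrightarrow> continuous_on S f"
| "Ck_on (Suc k) S f \<longleftrightarrow>
     (\<forall>x\<in>S. f differentiable (at x)) \<and> (\<forall>v. Ck_on k S (\<lambda>x. frechet_derivative f (at x) v))"

definition smooth_on :: "'e::euclidean_space set \<Rightarrow> ('e \<Rightarrow> 'f::real_normed_vector) \<Rightarrow> bool" where
  "smooth_on S f \<longleftrightarrow> (\<forall>k. Ck_on k S f)"

abbreviation diff_at :: "('e::real_normed_vector \<Rightarrow> 'f::real_normed_vector) \<Rightarrow> 'e \<Rightarrow> 'e \<Rightarrow> 'f" where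
  "diff_at f x \<equiv> frechet_derivative f (at x)"


section \<open>Riemannian geometry in a coordinate domain\<close>

text \<open>
  Here a metric is a function \<open>g\<close> that gives for every coordinate point \<open>x\<close> the inner product
  \<open>g x u v\<close> of two tangent vectors \<open>u\<close>, \<open>v\<close> at \<open>x\<close>; tangent vectors are written in the
  coordinate basis. A vector field is a function from points to tangent vectors.
\<close>

definition inner_product :: "('e::real_vector \<Rightarrow> 'e \<Rightarrow> real) \<Rightarrow> bool" where
  "inner_product b \<longleftrightarrow> (\<forall>v. linear (\<lambda>u. b u v)) \<and> (\<forall>u v. b u v = b v u) \<and> (\<forall>u. u \<noteq> 0 \<longrightarrow> b u u > 0)"

text \<open>
  The Christoffel map \<open>\<Gamma> u v = \<nabla>\<^sub>u v\<close> (coordinate fields \<open>u\<close>, \<open>v\<close>) of the Levi-Civita connection: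
  the connection is the only one that is torsion-free and compatible with the metric.
\<close>

definition christoffel ::
  "('e::euclidean_space \<Rightarrow> 'e \<Rightarrow> 'e \<Rightarrow> real) \<Rightarrow> 'e \<Rightarrow> 'e \<Rightarrow> 'e \<Rightarrow> 'e" where
  "christoffel g x = (THE \<Gamma>. bilinear \<Gamma> \<and> (\<forall>u v. \<Gamma> u v = \<Gamma> v u) \<and>
     (\<forall>w u v. diff_at (\<lambda>y. g y u v) x w = g x (\<Gamma> w u) v + g x u (\<Gamma> w v)))"

definition cov_deriv ::
  "('e::euclidean_space \<Rightarrow> 'e \<Rightarrow> 'e \<Rightarrow> real) \<Rightarrow> ('e \<Rightarrow> 'e) \<Rightarrow> ('e \<Rightarrow> 'e) \<Rightarrow> 'e \<Rightarrow> 'e" where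
  "cov_deriv g X Y = (\<lambda>x. diff_at Y x (X x) + christoffel g x (X x) (Y x))"

definition lie_bracket :: "('e::euclidean_space \<Rightarrow> 'e) \<Rightarrow> ('e \<Rightarrow> 'e) \<Rightarrow> 'e \<Rightarrow> 'e" where
  "lie_bracket X Y = (\<lambda>x. diff_at Y x (X x) - diff_at X x (Y x))"

definition riemann ::
  "('e::euclidean_space \<Rightarrow> 'e \<Rightarrow> 'e \<Rightarrow> real) \<Rightarrow> ('e \<Rightarrow> 'e) \<Rightarrow> ('e \<Rightarrow> 'e) \<Rightarrow> ('e \<Rightarrow> 'e) \<Rightarrow> 'e \<Rightarrow> 'e" where
  "riemann g X Y Z = (\<lambda>x. cov_deriv g X (cov_deriv g Y Z) x - cov_deriv g Y (cov_deriv g X Z) x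
     - cov_deriv g (lie_bracket X Y) Z x)"

text \<open>Tangent vectors at \<open>x\<close> are extended to vector fields with constant coefficients.\<close>

definition sec_curv ::
  "('e::euclidean_space \<Rightarrow> 'e \<Rightarrow> 'e \<Rightarrow> real) \<Rightarrow> 'e \<Rightarrow> 'e \<Rightarrow> 'e \<Rightarrow> real" where
  "sec_curv g x u v =
     g x (riemann g (\<lambda>_. u) (\<lambda>_. v) (\<lambda>_. v) x) u / (g x u u * g x v v - (g x u v)\<^sup>2)"

text \<open>Members of a basis are numbered from 1; values at other indices are irrelevant.\<close>

definition orthonormal_basis ::
  "('e::euclidean_space \<Rightarrow> 'e \<Rightarrow> real) \<Rightarrow> 'e set \<Rightarrow> (nat \<Rightarrow> 'e) \<Rightarrow> bool" where
  "orthonormal_basis b L e \<longleftrightarrow>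
     (\<forall>i\<in>{1..dim L}. \<forall>j\<in>{1..dim L}. b (e i) (e j) = (if i = j then 1 else 0)) \<and>
     span (e ` {1..dim L}) = L"

definition tau :: "('e::euclidean_space \<Rightarrow> 'e \<Rightarrow> 'e \<Rightarrow> real) \<Rightarrow> 'e \<Rightarrow> 'e set \<Rightarrow> real" where
  "tau g x L = (let e = (SOME e. orthonormal_basis (g x) L e)
     in \<Sum>j\<in>{1..dim L}. \<Sum>i\<in>{1..<j}. sec_curv g x (e i) (e j))"

definition orthogonal_tuples ::
  "('e::euclidean_space \<Rightarrow> 'e \<Rightarrow> real) \<Rightarrow> nat \<Rightarrow> (nat \<Rightarrow> nat) \<Rightarrow> (nat \<Rightarrow> 'e set) set" where
  "orthogonal_tuples b k ns = {L.
     (\<forall>i\<in>{1..k}. subspace (L i) \<and> dim (L i) = ns i) \<and>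
     (\<forall>i\<in>{1..k}. \<forall>j\<in>{1..k}. i \<noteq> j \<longrightarrow> (\<forall>u\<in>L i. \<forall>v\<in>L j. b u v = 0))}"

definition delta_invariant ::
  "('e::euclidean_space \<Rightarrow> 'e \<Rightarrow> 'e \<Rightarrow> real) \<Rightarrow> 'e \<Rightarrow> nat \<Rightarrow> (nat \<Rightarrow> nat) \<Rightarrow> real" where
  "delta_invariant g x k ns =
     tau g x UNIV - (INF L\<in>orthogonal_tuples (g x) k ns. \<Sum>i=1..k. tau g x (L i))"


section \<open>The second fundamental form in coordinates\<close>

text \<open>
  \<open>f\<close> is an immersion between coordinate domains with metrics \<open>g\<close> and \<open>g'\<close>. The first function
  is the ambient covariant derivative, at \<open>x\<close> in direction \<open>u\<close>, of a vector field \<open>V\<close> along \<open>f\<close>.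
\<close>

definition cov_deriv_along ::
  "('f::euclidean_space \<Rightarrow> 'f \<Rightarrow> 'f \<Rightarrow> real) \<Rightarrow> ('e::euclidean_space \<Rightarrow> 'f) \<Rightarrow> 'e \<Rightarrow> ('e \<Rightarrow> 'f) \<Rightarrow> 'e \<Rightarrow> 'f" where
  "cov_deriv_along g' f u V x = diff_at V x u + christoffel g' (f x) (diff_at f x u) (V x)"

text \<open>The Gauss formula \<open>h(X,Y) = \<nabla>'\<^sub>X Y - \<nabla>\<^sub>X Y\<close> (ambient minus induced connection), with constant extensions of \<open>u\<close> and \<open>v\<close>.\<close>

definition second_fund_form ::
  "('e::euclidean_space \<Rightarrow> 'e \<Rightarrow> 'e \<Rightarrow> real) \<Rightarrow> ('f::euclidean_space \<Rightarrow> 'f \<Rightarrow> 'f \<Rightarrow> real) \<Rightarrow>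
   ('e \<Rightarrow> 'f) \<Rightarrow> 'e \<Rightarrow> 'e \<Rightarrow> 'e \<Rightarrow> 'f" where
  "second_fund_form g g' f x u v =
     cov_deriv_along g' f u (\<lambda>y. diff_at f y v) x
     - diff_at f x (cov_deriv g (\<lambda>_. u) (\<lambda>_. v) x)"

definition mean_curvature ::
  "('e::euclidean_space \<Rightarrow> 'e \<Rightarrow> 'e \<Rightarrow> real) \<Rightarrow> ('f::euclidean_space \<Rightarrow> 'f \<Rightarrow> 'f \<Rightarrow> real) \<Rightarrow>
   ('e \<Rightarrow> 'f) \<Rightarrow> 'e \<Rightarrow> 'f" where
  "mean_curvature g g' f x = (let e = (SOME e. orthonormal_basis (g x) UNIV e)
     in (1 / real DIM('e)) *\<^sub>R (\<Sum>i=1..DIM('e). second_fund_form g g' f x (e i) (e i)))"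


section \<open>Manifolds\<close>

text \<open>
  A chart is a pair of its domain and its coordinate map; the dimension of the manifold is that
  of the model space \<open>'e\<close>. A tensor field is given by its local expressions in all the charts of
  the atlas, related by the usual transformation rule. The tangent space at a point is \<open>'e\<close>, read
  in a chart around the point.
\<close>

type_synonym ('a, 'e) chart = "'a set \<times> ('a \<Rightarrow> 'e)"

record ('a, 'e) riem_manifold =
  mtop :: "'a topology"
  atlas :: "('a, 'e) chart set"
  metric :: "('a, 'e) chart \<Rightarrow> 'e \<Rightarrow> 'e \<Rightarrow> 'e \<Rightarrow> real"

definition is_chart :: "'a topology \<Rightarrow> ('a, 'e::euclidean_space) chart \<Rightarrow> bool" where
  "is_chart X \<phi> \<longleftrightarrow> openin X (fst \<phi>) \<and> open (snd \<phi> ` fst \<phi>) \<and>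
     homeomorphic_map (subtopology X (fst \<phi>)) (top_of_set (snd \<phi> ` fst \<phi>)) (snd \<phi>)"

text \<open>The expression \<open>\<psi> \<circ> F \<circ> \<phi>\<^sup>-\<^sup>1\<close> of a map \<open>F\<close> and the open set of coordinates where it is meaningful.\<close>

definition local_expr :: "('a, 'e) chart \<Rightarrow> ('b, 'f) chart \<Rightarrow> ('a \<Rightarrow> 'b) \<Rightarrow> 'e \<Rightarrow> 'f" where
  "local_expr \<phi> \<psi> F = snd \<psi> \<circ> F \<circ> inv_into (fst \<phi>) (snd \<phi>)"

definition local_dom :: "('a, 'e) chart \<Rightarrow> ('b, 'f) chart \<Rightarrow> ('a \<Rightarrow> 'b) \<Rightarrow> 'e set" where
  "local_dom \<phi> \<psi> F = snd \<phi> ` (fst \<phi> \<inter> F -` fst \<psi>)"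

definition smooth_manifold :: "('a, 'e::euclidean_space) riem_manifold \<Rightarrow> bool" where
  "smooth_manifold M \<longleftrightarrow>
     Hausdorff_space (mtop M) \<and> second_countable (mtop M) \<and>
     (\<forall>\<phi>\<in>atlas M. is_chart (mtop M) \<phi>) \<and>
     (\<Union>\<phi>\<in>atlas M. fst \<phi>) = topspace (mtop M) \<and>
     (\<forall>\<phi>\<in>atlas M. \<forall>\<psi>\<in>atlas M. smooth_on (local_dom \<phi> \<psi> id) (local_expr \<phi> \<psi> id))"

definition riemannian_manifold :: "('a, 'e::euclidean_space) riem_manifold \<Rightarrow> bool" where
  "riemannian_manifold M \<longleftrightarrow> smooth_manifold M \<and>
     (\<forall>\<phi>\<in>atlas M.
        (\<forall>u v. smooth_on (snd \<phi> ` fst \<phi>) (\<lambda>x. metric M \<phi> x u v)) \<and>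
        (\<forall>x\<in>snd \<phi> ` fst \<phi>. inner_product (metric M \<phi> x))) \<and>
     (\<forall>\<phi>\<in>atlas M. \<forall>\<psi>\<in>atlas M. \<forall>x\<in>local_dom \<phi> \<psi> id. \<forall>u v.
        metric M \<phi> x u v =
          metric M \<psi> (local_expr \<phi> \<psi> id x)
            (diff_at (local_expr \<phi> \<psi> id) x u) (diff_at (local_expr \<phi> \<psi> id) x v))"

definition isometric_immersion ::
  "('a, 'e::euclidean_space) riem_manifold \<Rightarrow> ('b, 'f::euclidean_space) riem_manifold \<Rightarrow> ('a \<Rightarrow> 'b) \<Rightarrow> bool" where
  "isometric_immersion M N F \<longleftrightarrow>
     continuous_map (mtop M) (mtop N) F \<and>
     (\<forall>\<phi>\<in>atlas M. \<forall>\<psi>\<in>atlas N.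
        smooth_on (local_dom \<phi> \<psi> F) (local_expr \<phi> \<psi> F) \<and>
        (\<forall>x\<in>local_dom \<phi> \<psi> F.
           inj (diff_at (local_expr \<phi> \<psi> F) x) \<and>
           (\<forall>u v. metric M \<phi> x u v =
              metric N \<psi> (local_expr \<phi> \<psi> F x)
                (diff_at (local_expr \<phi> \<psi> F) x u) (diff_at (local_expr \<phi> \<psi> F) x v))))"


section \<open>Complex space forms and Lagrangian submanifolds\<close>

text \<open>
  A complex manifold of complex dimension \<open>CARD('n)\<close> has an atlas with values in \<open>complex ^ 'n\<close> and
  holomorphic transition maps, so that its complex structure is multiplication by the imaginary
  unit in every chart.
\<close>

definition cstruct :: "complex ^ 'n \<Rightarrow> complex ^ 'n" where
  "cstruct v = (\<chi> i. \<i> * v $ i)"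

definition complex_manifold :: "('b, complex ^ 'n) riem_manifold \<Rightarrow> bool" where
  "complex_manifold N \<longleftrightarrow> smooth_manifold N \<and>
     (\<forall>\<phi>\<in>atlas N. \<forall>\<psi>\<in>atlas N. \<forall>x\<in>local_dom \<phi> \<psi> id. \<forall>v.
        diff_at (local_expr \<phi> \<psi> id) x (cstruct v) = cstruct (diff_at (local_expr \<phi> \<psi> id) x v))"

text \<open>The Kaehler condition is that the metric is Hermitian and \<open>\<nabla>J = 0\<close>, i.e. \<open>\<nabla>\<^sub>X (JY) = J \<nabla>\<^sub>X Y\<close>.\<close>

definition kaehler_manifold :: "('b, complex ^ 'n) riem_manifold \<Rightarrow> bool" where
  "kaehler_manifold N \<longleftrightarrow> complex_manifold N \<and> riemannian_manifold N \<and>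
     (\<forall>\<phi>\<in>atlas N. \<forall>x\<in>snd \<phi> ` fst \<phi>.
        (\<forall>u v. metric N \<phi> x (cstruct u) (cstruct v) = metric N \<phi> x u v) \<and>
        (\<forall>X Y. Y differentiable (at x) \<longrightarrow>
           cov_deriv (metric N \<phi>) X (\<lambda>y. cstruct (Y y)) x = cstruct (cov_deriv (metric N \<phi>) X Y x)))"

text \<open>\<open>complex_space_form N \<kappa>\<close>: the constant holomorphic sectional curvature is \<open>\<kappa>\<close>.\<close>

definition complex_space_form :: "('b, complex ^ 'n) riem_manifold \<Rightarrow> real \<Rightarrow> bool" where
  "complex_space_form N \<kappa> \<longleftrightarrow> kaehler_manifold N \<and>
     (\<forall>\<phi>\<in>atlas N. \<forall>x\<in>snd \<phi> ` fst \<phi>. \<forall>u. u \<noteq> 0 \<longrightarrow> sec_curv (metric N \<phi>) x u (cstruct u) = \<kappa>)"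

text \<open>The two conditions say that \<open>J\<close> maps tangent vectors to normal ones and normal to tangent ones.\<close>

definition lagrangian_immersion ::
  "('a, real ^ 'n) riem_manifold \<Rightarrow> ('b, complex ^ 'n) riem_manifold \<Rightarrow> ('a \<Rightarrow> 'b) \<Rightarrow> bool" where
  "lagrangian_immersion M N F \<longleftrightarrow> isometric_immersion M N F \<and>
     (\<forall>\<phi>\<in>atlas M. \<forall>\<psi>\<in>atlas N. \<forall>x\<in>local_dom \<phi> \<psi> F.
        let b = metric N \<psi> (local_expr \<phi> \<psi> F x); T = range (diff_at (local_expr \<phi> \<psi> F) x)
        in (\<forall>\<xi>\<in>T. \<forall>\<eta>\<in>T. b (cstruct \<xi>) \<eta> = 0) \<and>
           (\<forall>\<xi>. (\<forall>\<eta>\<in>T. b \<xi> \<eta> = 0) \<longrightarrow> cstruct \<xi> \<in> T))"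


section \<open>Index blocks\<close>

text \<open>The block of index \<open>k + 1\<close> consists of the remaining numbers up to \<open>n\<close>.\<close>

definition block :: "nat \<Rightarrow> nat \<Rightarrow> (nat \<Rightarrow> nat) \<Rightarrow> nat \<Rightarrow> nat set" where
  "block n k ns i = {(\<Sum>j\<in>{1..<i}. ns j) + 1 .. (if i = k + 1 then n else \<Sum>j\<in>{1..i}. ns j)}"

end

theory Submission
  imports Defs
begin

text \<open>
  In a complex space form of holomorphic curvature \<open>4c\<close>, totally real planes have curvature \<open>c\<close>, so by the
  Gauss equation the curvature of the plane of two members \<open>e\<^sub>A\<close>, \<open>e\<^sub>B\<close> of an orthonormal basis is
  \<open>c + \<Sum>\<^sub>C (T A A C * T B B C - (T A B C)\<^sup>2)\<close>, where \<open>T\<close> is the totally symmetric cubic form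
  \<open>T A B C = h\<^sup>C\<^sub>A\<^sub>B\<close>. In \<open>\<tau> - \<Sum>\<tau>(L\<^sub>i)\<close> only pairs of indices that do not lie in a common block
  remain. The terms with three different indices are nonpositive squares, and they must vanish in the equality
  case. The other terms split, for every fixed \<open>C\<close>, into a quadratic form in the numbers \<open>x\<^sub>A = T A A C\<close>;
  it is bounded by a multiple of \<open>(\<Sum>x\<^sub>A)\<^sup>2\<close> by the Cauchy-Schwarz inequality. The constant is sharp if \<open>C\<close>
  lies outside the blocks, and then equality means that \<open>x\<close> is proportional to the optimal vector; if \<open>C\<close> is
  in a block, the optimal constant is strictly smaller, so that equality forces both sides to be zero.
\<close>

section \<open>Calculus on open subsets of Euclidean spaces\<close>

text \<open>The definitions select objects by description: the Christoffel map by
  \<open>THE\<close>, and \<open>tau\<close> and the mean curvature through a basis chosen by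
  \<open>SOME\<close>. So existence, uniqueness and differentiability of the connection, and
  independence of the basis, have to be established before an adapted basis can be used. Since
  \<open>J\<close> maps the normal space isometrically onto the tangent space, inner products of
  values of \<open>h\<close> become sums over the tangent basis, which is how the third index
  \<open>C\<close> arises. The constant is additive. For \<open>C\<close> outside the blocks, a
  block of size \<open>N\<close> contributes \<open>N / (N + 2)\<close>, \<open>C\<close> itself
  contributes 1, and every other index outside the blocks 1/3; the total is
  \<open>(a + 2) / 3\<close>, and one minus its inverse is \<open>(a - 1) / (a + 2)\<close>. For
  \<open>C\<close> in a block of size \<open>N\<close>, the value \<open>N / (N + 2) + 2 / 3\<close>
  is replaced by 1, which is smaller because \<open>N\<close> is at least 2.\<close>

lemma Ck_on_subset: "Ck_on k S f \<Longrightarrow> T \<subseteq> S \<Longrightarrow> Ck_on k T f"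
  by (induction k arbitrary: f) (auto intro: continuous_on_subset)

lemma smooth_on_subset: "smooth_on S f \<Longrightarrow> T \<subseteq> S \<Longrightarrow> smooth_on T f"
  by (auto simp: smooth_on_def intro: Ck_on_subset)

lemma smooth_on_differentiable: "smooth_on S f \<Longrightarrow> x \<in> S \<Longrightarrow> f differentiable (at x)"
  unfolding smooth_on_def using Ck_on.simps(2)[of 0 S f] by blast

lemma smooth_on_diff_at: "smooth_on S f \<Longrightarrow> smooth_on S (\<lambda>x. diff_at f x v)"
  unfolding smooth_on_def using Ck_on.simps(2)[of _ S f] by blast

lemma smooth_on_continuous: "smooth_on S f \<Longrightarrow> continuous_on S f"
  unfolding smooth_on_def using Ck_on.simps(1)[of S f] by blast

lemma has_derivative_compose_at:
  assumes "(f has_derivative f') (at x within s)" "f x = y" "(g has_derivative g') (at y)"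
  shows "((\<lambda>x. g (f x)) has_derivative (\<lambda>h. g' (f' h))) (at x within s)"
  using has_derivative_compose assms by blast

section \<open>Symmetry of second derivatives\<close>

lemma mvt_along:
  fixes f :: "'e::real_normed_vector \<Rightarrow> real"
  assumes t: "t > 0" and d: "\<And>s. 0 \<le> s \<Longrightarrow> s \<le> t \<Longrightarrow> f differentiable (at (y + s *\<^sub>R u))"
  shows "\<exists>s. 0 < s \<and> s < t \<and> f (y + t *\<^sub>R u) - f y = t * diff_at f (y + s *\<^sub>R u) u"
proof -
  have *: "((\<lambda>s. f (y + s *\<^sub>R u)) has_derivative (\<lambda>h. h * diff_at f (y + s *\<^sub>R u) u)) (at s within T)"
    if "0 \<le> s" "s \<le> t" for s T
  proof -
    have a: "(f has_derivative diff_at f (y + s *\<^sub>R u)) (at (y + s *\<^sub>R u))"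
      using d[OF that] frechet_derivative_works by blast
    have "((\<lambda>s. f (y + s *\<^sub>R u)) has_derivative (\<lambda>h. diff_at f (y + s *\<^sub>R u) (h *\<^sub>R u))) (at s within T)"
      by (rule has_derivative_compose_at[OF _ _ a]) (auto intro!: derivative_eq_intros)
    moreover have "diff_at f (y + s *\<^sub>R u) (h *\<^sub>R u) = h * diff_at f (y + s *\<^sub>R u) u" for h
      using linear_frechet_derivative[OF d[OF that]] by (simp add: linear_iff)
    ultimately show ?thesis by simp
  qed
  have "\<exists>s\<in>{0<..<t}. f (y + t *\<^sub>R u) - f (y + 0 *\<^sub>R u) = (t - 0) * diff_at f (y + s *\<^sub>R u) u"
    by (rule mvt_simple[of 0 t "\<lambda>s. f (y + s *\<^sub>R u)"]) (use t * in auto)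
  thus ?thesis by auto
qed

text \<open>The second difference on the left is symmetric in \<open>u\<close> and \<open>v\<close>;
  using the lemma in both orders compares the two mixed derivatives at points near
  \<open>x\<close>.\<close>

lemma mvt_mixed:
  fixes f :: "'e::real_normed_vector \<Rightarrow> real"
  assumes t: "t > 0"
    and d: "\<And>s s'. 0 \<le> s \<Longrightarrow> s \<le> t \<Longrightarrow> 0 \<le> s' \<Longrightarrow> s' \<le> t \<Longrightarrow>
      f differentiable (at (x + s *\<^sub>R u + s' *\<^sub>R v)) \<and>
      (\<lambda>y. diff_at f y u) differentiable (at (x + s *\<^sub>R u + s' *\<^sub>R v))"
  shows "\<exists>s s'. 0 < s \<and> s < t \<and> 0 < s' \<and> s' < t \<and>
    f (x + t *\<^sub>R u + t *\<^sub>R v) - f (x + t *\<^sub>R u) - f (x + t *\<^sub>R v) + f x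
      = t\<^sup>2 * diff_at (\<lambda>y. diff_at f y u) (x + s *\<^sub>R u + s' *\<^sub>R v) v"
proof -
  \<comment> \<open>The mean value theorem is applied along \<open>u\<close> to the increment in
    direction \<open>v\<close>, and then along \<open>v\<close> to the resulting difference of first
    derivatives.\<close>
  let ?q = "\<lambda>y. f (y + t *\<^sub>R v) - f y"
  have q: "(?q has_derivative (\<lambda>h. diff_at f (x + s *\<^sub>R u + t *\<^sub>R v) h - diff_at f (x + s *\<^sub>R u) h)) (at (x + s *\<^sub>R u))"
    if "0 \<le> s" "s \<le> t" for s
  proof -
    have a: "(f has_derivative diff_at f (x + s *\<^sub>R u + t *\<^sub>R v)) (at (x + s *\<^sub>R u + t *\<^sub>R v))"
      using d[of s t] that t frechet_derivative_works by force
    have b: "(f has_derivative diff_at f (x + s *\<^sub>R u)) (at (x + s *\<^sub>R u))"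
      using d[of s 0] that t frechet_derivative_works by force
    show ?thesis
      by (intro has_derivative_diff b has_derivative_compose_at[OF _ _ a]) (auto intro!: derivative_eq_intros)
  qed
  obtain s where s: "0 < s" "s < t" "?q (x + t *\<^sub>R u) - ?q x = t * diff_at ?q (x + s *\<^sub>R u) u"
    using mvt_along[OF t, of ?q x u, OF differentiableI[OF q]] by auto
  have e: "diff_at ?q (x + s *\<^sub>R u) u = diff_at f (x + s *\<^sub>R u + t *\<^sub>R v) u - diff_at f (x + s *\<^sub>R u) u"
    using fun_cong[OF frechet_derivative_at[OF q[OF less_imp_le[OF s(1)] less_imp_le[OF s(2)]]], of u] by simp
  have "\<exists>s'. 0 < s' \<and> s' < t \<and> diff_at f (x + s *\<^sub>R u + t *\<^sub>R v) u - diff_at f (x + s *\<^sub>R u) u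
     = t * diff_at (\<lambda>y. diff_at f y u) (x + s *\<^sub>R u + s' *\<^sub>R v) v"
    by (rule mvt_along[OF t]) (use d[of s] s in auto)
  then obtain s' where s': "0 < s'" "s' < t" "diff_at f (x + s *\<^sub>R u + t *\<^sub>R v) u - diff_at f (x + s *\<^sub>R u) u
     = t * diff_at (\<lambda>y. diff_at f y u) (x + s *\<^sub>R u + s' *\<^sub>R v) v" by blast
  have "f (x + t *\<^sub>R u + t *\<^sub>R v) - f (x + t *\<^sub>R u) - f (x + t *\<^sub>R v) + f x
    = t\<^sup>2 * diff_at (\<lambda>y. diff_at f y u) (x + s *\<^sub>R u + s' *\<^sub>R v) v"
    using s(3) unfolding e s'(3) by (simp add: power2_eq_square)
  thus ?thesis using s s' by blast
qed

lemma symmetric_second_derivative_real: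
  fixes f :: "'e::euclidean_space \<Rightarrow> real"
  assumes S: "open S" "x \<in> S" and f: "smooth_on S f"
  shows "diff_at (\<lambda>y. diff_at f y u) x v = diff_at (\<lambda>y. diff_at f y v) x u"
proof -
  let ?uv = "\<lambda>y. diff_at (\<lambda>y. diff_at f y u) y v" and ?vu = "\<lambda>y. diff_at (\<lambda>y. diff_at f y v) y u"
  obtain r where r: "r > 0" "ball x r \<subseteq> S" using S open_contains_ball by blast
  \<comment> \<open>\<open>K\<close> converts the parameter \<open>t\<close> into a distance. The
    summand 1 keeps it positive even for \<open>u = v = 0\<close>, since it is divided by
    later.\<close>
  define K where "K = norm u + norm v + 1"
  have K: "K > 0" unfolding K_def by (smt (verit) norm_ge_zero)
  have near: "dist x (x + s *\<^sub>R u + s' *\<^sub>R v) \<le> t * K"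
    if "0 \<le> s" "s \<le> t" "0 \<le> s'" "s' \<le> t" for s s' t
  proof -
    have "norm (s *\<^sub>R u + s' *\<^sub>R v) \<le> s * norm u + s' * norm v"
      using norm_triangle_ineq[of "s *\<^sub>R u" "s' *\<^sub>R v"] that by simp
    also have "\<dots> \<le> t * norm u + t * norm v" using that by (intro add_mono mult_right_mono) auto
    also have "\<dots> \<le> t * K" using that by (simp add: K_def algebra_simps)
    finally have "norm (- (s *\<^sub>R u + s' *\<^sub>R v)) \<le> t * K" unfolding norm_minus_cancel .
    moreover have "x - (x + s *\<^sub>R u + s' *\<^sub>R v) = - (s *\<^sub>R u + s' *\<^sub>R v)" by simp
    ultimately show ?thesis unfolding dist_norm by presburger
  qed
  have diffs: "f differentiable (at y)" "(\<lambda>y. diff_at f y w) differentiable (at y)" if "y \<in> S" for y w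
    using that f smooth_on_differentiable smooth_on_diff_at by blast+
  have ex: "\<exists>p q. dist x p \<le> t * K \<and> dist x q \<le> t * K \<and> ?uv p = ?vu q" if t: "0 < t" "t * K < r" for t
  proof -
    have i: "x + s *\<^sub>R u + s' *\<^sub>R v \<in> S" if "0 \<le> s" "s \<le> t" "0 \<le> s'" "s' \<le> t" for s s'
      using near[OF that] t(2) r(2) by (meson mem_ball order_le_less_trans subsetD)
    have sw: "x + s *\<^sub>R v + s' *\<^sub>R u = x + s' *\<^sub>R u + s *\<^sub>R v" for s s' by simp
    obtain s s' where 1: "0 < s" "s < t" "0 < s'" "s' < t"
      "f (x + t *\<^sub>R u + t *\<^sub>R v) - f (x + t *\<^sub>R u) - f (x + t *\<^sub>R v) + f x = t\<^sup>2 * ?uv (x + s *\<^sub>R u + s' *\<^sub>R v)"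
      using mvt_mixed[OF t(1), of f x u v] i diffs by meson
    obtain z z' where 2: "0 < z" "z < t" "0 < z'" "z' < t"
      "f (x + t *\<^sub>R u + t *\<^sub>R v) - f (x + t *\<^sub>R v) - f (x + t *\<^sub>R u) + f x = t\<^sup>2 * ?vu (x + z' *\<^sub>R u + z *\<^sub>R v)"
      using mvt_mixed[OF t(1), of f x v u] i diffs unfolding sw by meson
    have "t\<^sup>2 * ?uv (x + s *\<^sub>R u + s' *\<^sub>R v) = t\<^sup>2 * ?vu (x + z' *\<^sub>R u + z *\<^sub>R v)"
      using 1(5) 2(5) by linarith
    hence "?uv (x + s *\<^sub>R u + s' *\<^sub>R v) = ?vu (x + z' *\<^sub>R u + z *\<^sub>R v)" using t(1) by simp
    moreover have "dist x (x + s *\<^sub>R u + s' *\<^sub>R v) \<le> t * K" "dist x (x + z' *\<^sub>R u + z *\<^sub>R v) \<le> t * K"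
      by (rule near; use 1 2 in simp)+
    ultimately show ?thesis by blast
  qed
  have "continuous_on S ?uv" "continuous_on S ?vu"
    using f by (simp_all add: smooth_on_diff_at smooth_on_continuous)
  hence cont: "isCont ?uv x" "isCont ?vu x"
    using S by (simp_all add: continuous_on_eq_continuous_at)
  have lim: "(\<lambda>n. 1 / real (Suc n)) \<longlonglongrightarrow> 0"
    using LIMSEQ_inverse_real_of_nat by (simp add: inverse_eq_divide)
  \<comment> \<open>The factor 2 keeps \<open>t n * K\<close> at most \<open>r / 2\<close>, strictly
    inside the ball.\<close>
  define t where "t = (\<lambda>n. (r / (2 * K)) * (1 / real (Suc n)))"
  have t0: "t \<longlonglongrightarrow> 0" unfolding t_def using tendsto_mult_right_zero[OF lim] .
  have tr: "0 < t n" "t n * K < r" for n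
  proof -
    show "0 < t n" unfolding t_def using r K by simp
    have "t n * K = (r / 2) * (1 / real (Suc n))" unfolding t_def using K by simp
    also have "\<dots> \<le> (r / 2) * 1" by (intro mult_left_mono) (use r in auto)
    finally show "t n * K < r" using r by simp
  qed
  obtain P Q where PQ: "\<And>n. dist x (P n) \<le> t n * K" "\<And>n. dist x (Q n) \<le> t n * K" "\<And>n. ?uv (P n) = ?vu (Q n)"
    using ex[OF tr] by metis
  have tK: "(\<lambda>n. t n * K) \<longlonglongrightarrow> 0" using tendsto_mult[OF t0 tendsto_const, of K] by simp
  have PQl: "P \<longlonglongrightarrow> x" "Q \<longlonglongrightarrow> x"
    unfolding tendsto_dist_iff[of _ x]
    by (rule tendsto_sandwich[OF _ _ tendsto_const tK]; use PQ(1,2) in \<open>simp add: dist_commute\<close>)+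
  have "(\<lambda>n. ?uv (P n)) \<longlonglongrightarrow> ?uv x" "(\<lambda>n. ?vu (Q n)) \<longlonglongrightarrow> ?vu x"
    using isCont_tendsto_compose[OF cont(1) PQl(1)] isCont_tendsto_compose[OF cont(2) PQl(2)] .
  thus ?thesis using LIMSEQ_unique PQ(3) by simp
qed

text \<open>Holds at points of non-differentiability as well: \<open>frechet_derivative\<close> is a
  choice determined by the predicate \<open>has_derivative\<close>, and this predicate is
  local.\<close>

lemma diff_at_cong:
  assumes "open S" "x \<in> S" "\<And>y. y \<in> S \<Longrightarrow> f y = g y"
  shows "diff_at f x = diff_at g x"
proof -
  have "(f has_derivative D) (at x) \<longleftrightarrow> (g has_derivative D) (at x)" for D
    using assms has_derivative_transform_within_open[of f D x UNIV S g]
      has_derivative_transform_within_open[of g D x UNIV S f] by auto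
  thus ?thesis unfolding frechet_derivative_def by simp
qed

lemma differentiable_cong:
  assumes "open S" "x \<in> S" "\<And>y. y \<in> S \<Longrightarrow> f y = g y" "f differentiable (at x)"
  shows "g differentiable (at x)"
proof -
  obtain D where "(f has_derivative D) (at x)" using assms(4) differentiable_def by blast
  from has_derivative_transform_within_open[OF this assms(1-3)] show ?thesis
    unfolding differentiable_def by blast
qed

lemma diff_at_works: "f differentiable (at x) \<Longrightarrow> (f has_derivative diff_at f x) (at x)"
  using frechet_derivative_works by blast

lemma diff_at_eq: "(f has_derivative D) (at x) \<Longrightarrow> diff_at f x = D"
  by (rule frechet_derivative_at[symmetric])

lemma diff_at_inner:
  assumes "f differentiable (at x)"
  shows "diff_at (\<lambda>y. f y \<bullet> b) x v = diff_at f x v \<bullet> b"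
  using diff_at_eq[OF has_derivative_inner_left[OF diff_at_works[OF assms], of b]] by simp

lemma Ck_on_cong:
  assumes S: "open S"
  shows "Ck_on k S p \<Longrightarrow> (\<And>x. x \<in> S \<Longrightarrow> p x = q x) \<Longrightarrow> Ck_on k S q"
proof (induction k arbitrary: p q)
  case 0 thus ?case using continuous_on_cong[of S S p q] by simp
next
  case (Suc k)
  have d: "diff_at p x = diff_at q x" if "x \<in> S" for x
    by (rule diff_at_cong[OF S that Suc.prems(2)])
  have "Ck_on k S (\<lambda>x. diff_at q x v)" for v
    by (rule Suc.IH[of "\<lambda>x. diff_at p x v"]) (use Suc.prems(1) d in auto)
  moreover have "q differentiable (at x)" if "x \<in> S" for x
    using differentiable_cong[OF S that Suc.prems(2)] Suc.prems(1) that by simp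
  ultimately show ?case by simp
qed

lemma smooth_on_inner:
  fixes f :: "'e::euclidean_space \<Rightarrow> 'f::euclidean_space"
  assumes S: "open S" and f: "smooth_on S f" shows "smooth_on S (\<lambda>y. f y \<bullet> b)"
proof -
  \<comment> \<open>Generalised over \<open>f\<close>, because the induction step passes to the
    directional derivatives of \<open>f\<close>.\<close>
  have *: "Ck_on k S (\<lambda>y. f y \<bullet> b)" if "smooth_on S f" for k and f :: "'e \<Rightarrow> 'f"
    using that
  proof (induction k arbitrary: f)
    case 0 show ?case using continuous_on_inner[OF smooth_on_continuous[OF 0] continuous_on_const] by simp
  next
    case (Suc k)
    have "Ck_on k S (\<lambda>x. diff_at (\<lambda>y. f y \<bullet> b) x v)" for v
      by (rule Ck_on_cong[OF S Suc.IH[OF smooth_on_diff_at[OF Suc.prems, of v]]])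
        (rule diff_at_inner[OF smooth_on_differentiable[OF Suc.prems], symmetric])
    moreover have "(\<lambda>y. f y \<bullet> b) differentiable (at x)" if "x \<in> S" for x
      using has_derivative_inner_left[OF diff_at_works[OF smooth_on_differentiable[OF Suc.prems that]]]
      unfolding differentiable_def by blast
    ultimately show ?case by simp
  qed
  show ?thesis unfolding smooth_on_def by (intro allI *[OF f])
qed

lemma symmetric_second_derivative:
  fixes f :: "'e::euclidean_space \<Rightarrow> 'f::euclidean_space"
  assumes S: "open S" "x \<in> S" and f: "smooth_on S f"
  shows "diff_at (\<lambda>y. diff_at f y u) x v = diff_at (\<lambda>y. diff_at f y v) x u"
proof (rule euclidean_eqI)
  fix b :: 'f assume "b \<in> Basis"
  have *: "diff_at (\<lambda>y. diff_at f y w) x z \<bullet> b = diff_at (\<lambda>y. diff_at (\<lambda>y. f y \<bullet> b) y w) x z" for w z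
  proof -
    have "diff_at (\<lambda>y. diff_at f y w) x z \<bullet> b = diff_at (\<lambda>y. diff_at f y w \<bullet> b) x z"
      by (rule diff_at_inner[symmetric]) (rule smooth_on_differentiable[OF smooth_on_diff_at[OF f] S(2)])
    also have "\<dots> = diff_at (\<lambda>y. diff_at (\<lambda>y. f y \<bullet> b) y w) x z"
      by (rule fun_cong[OF diff_at_cong[OF S]]) (rule diff_at_inner[OF smooth_on_differentiable[OF f], symmetric])
    finally show ?thesis .
  qed
  show "diff_at (\<lambda>y. diff_at f y u) x v \<bullet> b = diff_at (\<lambda>y. diff_at f y v) x u \<bullet> b"
    unfolding * by (rule symmetric_second_derivative_real[OF S smooth_on_inner[OF S(1) f]])
qed

section \<open>Differentiation of families of bilinear maps\<close>

lemma bilinear_expand: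
  fixes B :: "'v::euclidean_space \<Rightarrow> 'w::euclidean_space \<Rightarrow> 'z::real_vector"
  assumes "bilinear B"
  shows "B v w = (\<Sum>i\<in>Basis. \<Sum>j\<in>Basis. ((v \<bullet> i) * (w \<bullet> j)) *\<^sub>R B i j)"
proof -
  have "B v w = B (\<Sum>i\<in>Basis. (v \<bullet> i) *\<^sub>R i) (\<Sum>j\<in>Basis. (w \<bullet> j) *\<^sub>R j)" by (simp add: euclidean_representation)
  also have "\<dots> = (\<Sum>(i,j)\<in>Basis \<times> Basis. B ((v \<bullet> i) *\<^sub>R i) ((w \<bullet> j) *\<^sub>R j))" by (rule bilinear_sum[OF assms])
  also have "\<dots> = (\<Sum>i\<in>Basis. \<Sum>j\<in>Basis. ((v \<bullet> i) * (w \<bullet> j)) *\<^sub>R B i j)"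
    by (simp add: sum.cartesian_product bilinear_lmul[OF assms] bilinear_rmul[OF assms] mult.commute)
  finally show ?thesis .
qed

text \<open>A product rule in which the bilinear map itself varies with the point. Expansion over
  the bases leaves finitely many coefficient functions \<open>B z i j\<close>, so differentiability
  in \<open>z\<close> for fixed arguments suffices.\<close>

lemma has_derivative_bilinear_family:
  fixes B :: "'f::real_normed_vector \<Rightarrow> 'v::euclidean_space \<Rightarrow> 'w::euclidean_space \<Rightarrow> 'z::real_normed_vector"
  assumes U: "open U" "f x \<in> U" and B: "\<And>z. z \<in> U \<Longrightarrow> bilinear (B z)"
    and dB: "\<And>v w. (\<lambda>z. B z v w) differentiable (at (f x))"
    and f: "(f has_derivative f') (at x)" and V: "(V has_derivative V') (at x)" and W: "(W has_derivative W') (at x)"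
  shows "((\<lambda>y. B (f y) (V y) (W y)) has_derivative
     (\<lambda>u. diff_at (\<lambda>z. B z (V x) (W x)) (f x) (f' u) + B (f x) (V' u) (W x) + B (f x) (V x) (W' u))) (at x)"
proof -
  let ?E = "\<lambda>y. \<Sum>i\<in>Basis. \<Sum>j\<in>Basis. ((V y \<bullet> i) * (W y \<bullet> j)) *\<^sub>R B (f y) i j"
  have dBij: "((\<lambda>y. B (f y) i j) has_derivative (\<lambda>u. diff_at (\<lambda>z. B z i j) (f x) (f' u))) (at x)" for i j
    by (rule has_derivative_compose_at[OF f refl diff_at_works[OF dB]])
  have 1: "(?E has_derivative (\<lambda>u. \<Sum>i\<in>Basis. \<Sum>j\<in>Basis.
      ((V x \<bullet> i) * (W x \<bullet> j)) *\<^sub>R diff_at (\<lambda>z. B z i j) (f x) (f' u)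
       + ((V x \<bullet> i) * (W' u \<bullet> j) + (V' u \<bullet> i) * (W x \<bullet> j)) *\<^sub>R B (f x) i j)) (at x)"
  proof (intro has_derivative_sum)
    fix i :: 'v and j :: 'w
    show "((\<lambda>y. ((V y \<bullet> i) * (W y \<bullet> j)) *\<^sub>R B (f y) i j) has_derivative
        (\<lambda>u. ((V x \<bullet> i) * (W x \<bullet> j)) *\<^sub>R diff_at (\<lambda>z. B z i j) (f x) (f' u)
         + ((V x \<bullet> i) * (W' u \<bullet> j) + (V' u \<bullet> i) * (W x \<bullet> j)) *\<^sub>R B (f x) i j)) (at x)"
      by (rule has_derivative_scaleR[OF has_derivative_mult[OF has_derivative_inner_left[OF V] has_derivative_inner_left[OF W]] dBij])
  qed
  have c: "((\<lambda>z. \<Sum>i\<in>Basis. \<Sum>j\<in>Basis. ((v \<bullet> i) * (w \<bullet> j)) *\<^sub>R B z i j) has_derivative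
      (\<lambda>h. \<Sum>i\<in>Basis. \<Sum>j\<in>Basis. ((v \<bullet> i) * (w \<bullet> j)) *\<^sub>R diff_at (\<lambda>z. B z i j) (f x) h)) (at (f x))" for v w
    by (intro has_derivative_sum has_derivative_scaleR_right diff_at_works[OF dB])
  have dBvw: "diff_at (\<lambda>z. B z v w) (f x) h = (\<Sum>i\<in>Basis. \<Sum>j\<in>Basis. ((v \<bullet> i) * (w \<bullet> j)) *\<^sub>R diff_at (\<lambda>z. B z i j) (f x) h)" for v w h
  proof -
    have "diff_at (\<lambda>z. B z v w) (f x) = diff_at (\<lambda>z. \<Sum>i\<in>Basis. \<Sum>j\<in>Basis. ((v \<bullet> i) * (w \<bullet> j)) *\<^sub>R B z i j) (f x)"
      by (rule diff_at_cong[OF U]) (rule bilinear_expand[OF B])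
    thus ?thesis using diff_at_eq[OF c[of v w]] by simp
  qed
  have 2: "(?E has_derivative
     (\<lambda>u. diff_at (\<lambda>z. B z (V x) (W x)) (f x) (f' u) + B (f x) (V' u) (W x) + B (f x) (V x) (W' u))) (at x)"
  proof (rule has_derivative_eq_rhs[OF 1], rule ext)
    fix u
    show "(\<Sum>i\<in>Basis. \<Sum>j\<in>Basis.
      ((V x \<bullet> i) * (W x \<bullet> j)) *\<^sub>R diff_at (\<lambda>z. B z i j) (f x) (f' u)
       + ((V x \<bullet> i) * (W' u \<bullet> j) + (V' u \<bullet> i) * (W x \<bullet> j)) *\<^sub>R B (f x) i j)
      = diff_at (\<lambda>z. B z (V x) (W x)) (f x) (f' u) + B (f x) (V' u) (W x) + B (f x) (V x) (W' u)"
      unfolding dBvw[of "V x" "W x" "f' u"] bilinear_expand[OF B[OF U(2)], of "V' u" "W x"] bilinear_expand[OF B[OF U(2)], of "V x" "W' u"]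
        sum.distrib[symmetric]
      by (intro sum.cong refl) (simp add: scaleR_add_left)
  qed
  \<comment> \<open>The expansion is an identity only where \<open>f y\<close> lies in
    \<open>U\<close>; continuity provides a neighbourhood of \<open>x\<close> where this is
    so.\<close>
  have "isCont f x" by (rule has_derivative_continuous[OF f])
  then obtain S where S: "open S" "x \<in> S" "\<And>y. y \<in> S \<Longrightarrow> f y \<in> U"
    using U continuous_at_open[of x f] by blast
  show ?thesis
    by (rule has_derivative_transform_within_open[OF 2 S(1,2)]) (rule bilinear_expand[OF B[OF S(3)], symmetric])
qed

text \<open>In \<open>f y *\<^sub>R g y = f y *\<^sub>R g x + f y *\<^sub>R (g y - g x)\<close> the
  last term is O(|y - x|) times o(1), hence has derivative 0. This handles a factor \<open>g\<close>
  that is so far known only to be continuous.\<close>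

lemma differentiable_mult_vanishing:
  fixes f :: "'a::real_normed_vector \<Rightarrow> real" and g :: "'a \<Rightarrow> 'b::real_normed_vector"
  assumes f: "f differentiable (at x)" "f x = 0" and g: "isCont g x"
  shows "(\<lambda>y. f y *\<^sub>R g y) differentiable (at x)"
proof -
  obtain D where D: "(f has_derivative D) (at x)" using f differentiable_def by blast
  have 1: "((\<lambda>y. f y *\<^sub>R g x) has_derivative (\<lambda>h. D h *\<^sub>R g x)) (at x)"
    by (rule bounded_linear.has_derivative[OF bounded_linear_scaleR_left D])
  obtain K where K: "\<And>h. norm (D h) \<le> norm h * K" using has_derivative_bounded_linear[OF D] bounded_linear.bounded by blast
  have "((\<lambda>y. f y *\<^sub>R (g y - g x)) has_derivative (\<lambda>h. 0)) (at x)"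
  proof (subst has_derivative_at_alt, intro conjI allI impI)
    show "bounded_linear (\<lambda>h::'a. 0::'b)" by simp
    fix e :: real assume e: "e > 0"
    \<comment> \<open>Near \<open>x\<close>, \<open>norm (f y) \<le> M * norm (y - x)\<close>:
      \<open>K\<close> bounds the derivative, and 1 covers the remainder.\<close>
    define M where "M = \<bar>K\<bar> + 1"
    have M: "M > 0" unfolding M_def by simp
    obtain d1 where d1: "d1 > 0" "\<And>y. norm (y - x) < d1 \<Longrightarrow> norm (f y - f x - D (y - x)) \<le> 1 * norm (y - x)"
      using D[unfolded has_derivative_at_alt] zero_less_one by blast
    obtain d2 where d2: "d2 > 0" "\<And>y. norm (y - x) < d2 \<Longrightarrow> norm (g y - g x) < e / M"
      using g[unfolded continuous_at_eps_delta, rule_format, of "e / M"] e M by (auto simp: dist_norm)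
    have "norm (f y *\<^sub>R (g y - g x)) \<le> e * norm (y - x)" if "norm (y - x) < min d1 d2" for y
    proof -
      have "norm (f y) \<le> norm (y - x) + norm (y - x) * K"
        using d1(2)[of y] K[of "y - x"] that f(2) by simp
      also have "\<dots> \<le> M * norm (y - x)" using mult_right_mono[of K "\<bar>K\<bar>" "norm (y - x)"] unfolding M_def by (simp add: algebra_simps)
      finally have "norm (f y) * norm (g y - g x) \<le> (M * norm (y - x)) * (e / M)"
        using d2(2)[of y] that M by (intro mult_mono) auto
      thus ?thesis using M by (simp add: mult_ac)
    qed
    thus "\<exists>d>0. \<forall>y. norm (y - x) < d \<longrightarrow> norm (f y *\<^sub>R (g y - g x) - f x *\<^sub>R (g x - g x) - 0) \<le> e * norm (y - x)"
      using d1 d2 f(2) by (intro exI[of _ "min d1 d2"]) auto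
  qed
  from has_derivative_add[OF 1 this] show ?thesis
    by (auto simp: differentiable_def scaleR_diff_right)
qed

lemma diff_at_add: "f differentiable (at x) \<Longrightarrow> g differentiable (at x) \<Longrightarrow>
    diff_at (\<lambda>y. f y + g y) x u = diff_at f x u + diff_at g x u"
  using diff_at_eq[OF has_derivative_add[OF diff_at_works diff_at_works]] by metis

lemma diff_at_scaleR: "f differentiable (at x) \<Longrightarrow> diff_at (\<lambda>y. c *\<^sub>R f y) x u = c *\<^sub>R diff_at f x u"
  using diff_at_eq[OF has_derivative_scaleR_right[OF diff_at_works]] by metis

lemma bilinear_diff_at:
  assumes U: "open U" "x \<in> U" and B: "\<And>z. z \<in> U \<Longrightarrow> bilinear (B z)"
    and dB: "\<And>v w. (\<lambda>z. B z v w) differentiable (at x)"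
  shows "bilinear (\<lambda>v w. diff_at (\<lambda>z. B z v w) x h)"
proof -
  note c = fun_cong[OF diff_at_cong[OF U], of _ _ h]
  have "diff_at (\<lambda>z. B z (v + v') w) x h = diff_at (\<lambda>z. B z v w) x h + diff_at (\<lambda>z. B z v' w) x h" for v v' w
    unfolding diff_at_add[OF dB dB, symmetric] by (rule c) (rule bilinear_ladd[OF B])
  moreover have "diff_at (\<lambda>z. B z w (v + v')) x h = diff_at (\<lambda>z. B z w v) x h + diff_at (\<lambda>z. B z w v') x h" for v v' w
    unfolding diff_at_add[OF dB dB, symmetric] by (rule c) (rule bilinear_radd[OF B])
  moreover have "diff_at (\<lambda>z. B z (a *\<^sub>R v) w) x h = a *\<^sub>R diff_at (\<lambda>z. B z v w) x h" for a v w
    unfolding diff_at_scaleR[OF dB, symmetric] by (rule c) (rule bilinear_lmul[OF B])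
  moreover have "diff_at (\<lambda>z. B z w (a *\<^sub>R v)) x h = a *\<^sub>R diff_at (\<lambda>z. B z w v) x h" for a v w
    unfolding diff_at_scaleR[OF dB, symmetric] by (rule c) (rule bilinear_rmul[OF B])
  ultimately show ?thesis unfolding bilinear_def linear_iff by blast
qed

section \<open>The Levi-Civita connection and its curvature tensor\<close>

lemma inner_product_bilinear: "inner_product b \<Longrightarrow> bilinear b"
proof -
  assume b: "inner_product b"
  hence 1: "linear (\<lambda>u. b u v)" for v by (simp add: inner_product_def)
  moreover have "(\<lambda>u. b u v) = b v" for v using b by (intro ext) (simp add: inner_product_def)
  ultimately show "bilinear b" unfolding bilinear_def by metis
qed

lemma inner_product_sym: "inner_product b \<Longrightarrow> b u v = b v u"
  unfolding inner_product_def by blast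

lemma inner_product_pos: "inner_product b \<Longrightarrow> u \<noteq> 0 \<Longrightarrow> b u u > 0"
  unfolding inner_product_def by blast

lemma inner_product_eqI:
  assumes "inner_product b" "\<And>w. b u w = b v w" shows "u = v"
proof (rule ccontr)
  assume "u \<noteq> v"
  hence "b (u - v) (u - v) > 0" using inner_product_pos[OF assms(1)] by simp
  thus False using assms(2)[of "u - v"] by (simp add: bilinear_lsub[OF inner_product_bilinear[OF assms(1)]])
qed

lemma inner_product_eqI_Basis:
  fixes b :: "'e::euclidean_space \<Rightarrow> 'e \<Rightarrow> real"
  assumes "inner_product b" "\<And>i. i \<in> Basis \<Longrightarrow> b u i = b v i" shows "u = v"
proof (rule inner_product_eqI[OF assms(1)])
  fix w
  show "b u w = b v w"
    unfolding bilinear_expand[OF inner_product_bilinear[OF assms(1)], of u w]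
      bilinear_expand[OF inner_product_bilinear[OF assms(1)], of v w]
  proof -
    have l: "linear (b z)" for z using inner_product_bilinear[OF assms(1)] by (simp add: bilinear_def)
    have "b u w = b v w" by (rule linear_eq_stdbasis[OF l l, THEN fun_cong]) (rule assms(2))
    thus "(\<Sum>i\<in>Basis. \<Sum>j\<in>Basis. (u \<bullet> i * (w \<bullet> j)) *\<^sub>R b i j) = (\<Sum>i\<in>Basis. \<Sum>j\<in>Basis. (v \<bullet> i * (w \<bullet> j)) *\<^sub>R b i j)"
      unfolding bilinear_expand[OF inner_product_bilinear[OF assms(1)], of u w]
      bilinear_expand[OF inner_product_bilinear[OF assms(1)], of v w] .
  qed
qed

text \<open>The musical isomorphism from vectors to covectors, with covectors written in Euclidean
  coordinates. A linear left inverse of it plays the part of the inverse metric matrix.\<close>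

definition lower :: "('e::euclidean_space \<Rightarrow> 'e \<Rightarrow> real) \<Rightarrow> 'e \<Rightarrow> 'e" where
  "lower b u = (\<Sum>i\<in>Basis. b u i *\<^sub>R i)"

lemma lower_inner: "i \<in> Basis \<Longrightarrow> lower b u \<bullet> i = b u i"
  unfolding lower_def by simp

lemma
  assumes b: "inner_product b"
  shows linear_lower: "linear (lower b)" and inj_lower: "inj (lower b)"
proof -
  have B: "bilinear b" by (rule inner_product_bilinear[OF b])
  show "linear (lower b)"
    by (rule linearI; rule euclidean_eqI) (simp_all add: lower_inner inner_add_left bilinear_ladd[OF B] bilinear_lmul[OF B])
  show "inj (lower b)"
    by (rule injI, rule inner_product_eqI_Basis[OF b]) (metis lower_inner)
qed

lemma inner_product_riesz:
  fixes b :: "'e::euclidean_space \<Rightarrow> 'e \<Rightarrow> real"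
  assumes b: "inner_product b" and l: "linear l"
  shows "\<exists>z. \<forall>w. b z w = l w"
proof -
  have "surj (lower b)" using linear_injective_imp_surjective[OF linear_lower[OF b] inj_lower[OF b]] by simp
  then obtain z where z: "lower b z = (\<Sum>i\<in>Basis. l i *\<^sub>R i)" by (metis surjD)
  have "b z i = l i" if "i \<in> Basis" for i
    using arg_cong[OF z, of "\<lambda>v. v \<bullet> i"] that by (simp add: lower_inner)
  moreover have "linear (b z)" using inner_product_bilinear[OF b] by (simp add: bilinear_def)
  ultimately show ?thesis using linear_eq_stdbasis[of "b z" l] l by blast
qed

text \<open>
  With \<open>A\<^sub>y\<close> the matrix of \<open>G y\<close>, the solution satisfies \<open>z y = A\<^sub>x\<^sup>-\<^sup>1 (b y - (A\<^sub>y - A\<^sub>x) (z y))\<close>. As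
  \<open>A\<^sub>y - A\<^sub>x\<close> vanishes at \<open>x\<close>, continuity of \<open>z\<close> is enough for the last term to be differentiable.
\<close>

lemma differentiable_inner_product_solution:
  fixes G :: "'d::real_normed_vector \<Rightarrow> 'e::euclidean_space \<Rightarrow> 'e \<Rightarrow> real"
  assumes U: "open U" "x \<in> U" and ip: "\<And>y. y \<in> U \<Longrightarrow> inner_product (G y)"
    and dG: "\<And>u v. (\<lambda>y. G y u v) differentiable (at x)"
    and db: "\<And>w. (\<lambda>y. G y (z y) w) differentiable (at x)"
  shows "z differentiable (at x)"
proof -
  obtain A where A: "linear A" "A \<circ> lower (G x) = id"
    using linear_injective_left_inverse[OF linear_lower inj_lower] ip[OF U(2)] by blast
  define b where "b = (\<lambda>y. lower (G y) (z y))"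
  define r where "r = (\<lambda>y. \<Sum>i\<in>Basis. \<Sum>j\<in>Basis. (G y j i - G x j i) *\<^sub>R ((z y \<bullet> j) *\<^sub>R i))"
  define \<epsilon> where "\<epsilon> = (\<lambda>y. \<Sum>i\<in>Basis. \<Sum>j\<in>Basis. \<bar>G y j i - G x j i\<bar>)"
  have z: "z y = A (b y - r y)" if y: "y \<in> U" for y
  proof -
    have "lower (G x) (z y) = b y - r y"
    proof (rule euclidean_eqI)
      fix i :: 'e assume i: "i \<in> Basis"
      have e: "G y' (z y) i = (\<Sum>j\<in>Basis. (z y \<bullet> j) * G y' j i)" if "y' \<in> U" for y'
      proof -
        have l: "linear (\<lambda>v. G y' v i)" using inner_product_bilinear[OF ip[OF that]] by (simp add: bilinear_def)
        have "G y' (\<Sum>j\<in>Basis. (z y \<bullet> j) *\<^sub>R j) i = (\<Sum>j\<in>Basis. (z y \<bullet> j) * G y' j i)"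
          using linear_sum[OF l, of "\<lambda>j. (z y \<bullet> j) *\<^sub>R j" Basis] linear_scale[OF l] by simp
        thus ?thesis by (simp add: euclidean_representation)
      qed
      have "r y \<bullet> i = (\<Sum>i'\<in>Basis. \<Sum>j\<in>Basis. (G y j i' - G x j i') * ((z y \<bullet> j) * (i' \<bullet> i)))"
        unfolding r_def by (simp add: inner_sum_left mult.assoc)
      also have "\<dots> = (\<Sum>i'\<in>Basis. if i' = i then \<Sum>j\<in>Basis. (G y j i' - G x j i') * (z y \<bullet> j) else 0)"
        by (intro sum.cong refl) (use i in \<open>auto simp: inner_Basis\<close>)
      also have "\<dots> = (\<Sum>j\<in>Basis. (G y j i - G x j i) * (z y \<bullet> j))" using i by simp
      finally show "lower (G x) (z y) \<bullet> i = (b y - r y) \<bullet> i"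
        using i e[OF y] e[OF U(2)] by (simp add: b_def lower_inner inner_diff_left algebra_simps sum_subtractf)
    qed
    thus ?thesis using A(2) by (metis comp_apply id_apply)
  qed
  have db': "b differentiable (at x)"
    unfolding b_def lower_def
    by (intro differentiable_sum finite_Basis ballI differentiable_scaleR db differentiable_const)
  have cG: "isCont (\<lambda>y. G y u v) x" for u v by (rule differentiable_imp_continuous_within[OF dG])
  have c\<epsilon>: "isCont \<epsilon> x" unfolding \<epsilon>_def by (intro continuous_intros cG)
  have \<epsilon>0: "\<epsilon> x = 0" unfolding \<epsilon>_def by simp
  have rb: "norm (r y) \<le> \<epsilon> y * norm (z y)" for y
  proof -
    have "norm (r y) \<le> (\<Sum>i\<in>Basis. \<Sum>j\<in>Basis. \<bar>G y j i - G x j i\<bar> * norm (z y))"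
      unfolding r_def
    proof (intro sum_norm_le)
      fix i j :: 'e assume ij: "i \<in> Basis" "j \<in> Basis"
      have "norm ((G y j i - G x j i) *\<^sub>R ((z y \<bullet> j) *\<^sub>R i)) = \<bar>G y j i - G x j i\<bar> * \<bar>z y \<bullet> j\<bar>"
        using ij by (simp add: abs_mult)
      also have "\<dots> \<le> \<bar>G y j i - G x j i\<bar> * norm (z y)"
        by (intro mult_left_mono Basis_le_norm ij) simp
      finally show "norm ((G y j i - G x j i) *\<^sub>R ((z y \<bullet> j) *\<^sub>R i)) \<le> \<bar>G y j i - G x j i\<bar> * norm (z y)" .
    qed
    thus ?thesis by (simp add: \<epsilon>_def sum_distrib_right)
  qed
  have bA: "bounded_linear A" using A(1) by (simp add: linear_conv_bounded_linear)
  obtain K where K: "K > 0" "\<And>v. norm (A v) \<le> norm v * K" using bounded_linear.pos_bounded[OF bA] by blast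
  \<comment> \<open>An a priori bound on \<open>z\<close>: once
    \<open>\<epsilon> y < 1 / (2 * K)\<close>, the error term is at most half of
    \<open>norm (z y)\<close> and is absorbed on the left, which doubles the constant.\<close>
  define C where "C = 2 * K * (norm (b x) + 1)"
  have cb: "isCont b x" by (rule differentiable_imp_continuous_within[OF db'])
  have evU: "eventually (\<lambda>y. y \<in> U) (at x)" using U by (simp add: eventually_at_topological) blast
  have ev\<epsilon>: "eventually (\<lambda>y. \<epsilon> y < 1 / (2 * K)) (at x)"
    using order_tendstoD(2)[OF c\<epsilon>[unfolded isCont_def], of "1 / (2 * K)"] K \<epsilon>0 by simp
  have evb: "eventually (\<lambda>y. norm (b y) < norm (b x) + 1) (at x)"
    using order_tendstoD(2)[OF tendsto_norm[OF cb[unfolded isCont_def]], of "norm (b x) + 1"] by simp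
  have evz: "eventually (\<lambda>y. norm (z y) \<le> C) (at x)"
    using evU ev\<epsilon> evb
  proof eventually_elim
    case (elim y)
    have "norm (z y) \<le> norm (b y - r y) * K" using K(2)[of "b y - r y"] z[OF elim(1)] by simp
    also have "\<dots> \<le> (norm (b y) + \<epsilon> y * norm (z y)) * K"
      using norm_triangle_ineq4[of "b y" "r y"] rb[of y] K(1) by (intro mult_right_mono) auto
    also have "\<dots> \<le> (norm (b x) + 1 + 1 / (2 * K) * norm (z y)) * K"
      using elim K(1) by (intro mult_right_mono add_mono mult_right_mono) auto
    also have "\<dots> = K * (norm (b x) + 1) + norm (z y) / 2" using K(1) by (simp add: field_simps)
    finally show ?case unfolding C_def by simp
  qed
  \<comment> \<open>Boundedness of \<open>z\<close> makes \<open>r\<close> tend to 0, and the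
    fixed-point equation then gives continuity of \<open>z\<close>; differentiability comes from
    running the same equation again.\<close>
  have "(r \<longlongrightarrow> 0) (at x)"
  proof (rule Lim_null_comparison[of _ "\<lambda>y. \<epsilon> y * C"])
    have \<epsilon>_nonneg: "\<epsilon> y \<ge> 0" for y unfolding \<epsilon>_def by (intro sum_nonneg) auto
    show "eventually (\<lambda>y. norm (r y) \<le> \<epsilon> y * C) (at x)"
      using evz
    proof eventually_elim
      case (elim y)
      show ?case using order_trans[OF rb[of y] mult_left_mono[OF elim \<epsilon>_nonneg]] .
    qed
    show "((\<lambda>y. \<epsilon> y * C) \<longlongrightarrow> 0) (at x)"
      using tendsto_mult_left_zero[of \<epsilon> "at x" C] c\<epsilon> \<epsilon>0 unfolding isCont_def by simp
  qed
  moreover have r0: "r x = 0" unfolding r_def by simp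
  ultimately have cr: "isCont r x" unfolding isCont_def by simp
  have "isCont (\<lambda>y. A (b y - r y)) x"
    by (intro bounded_linear.isCont[OF bA] continuous_intros cb cr)
  hence cz: "isCont z x"
    using z U unfolding isCont_def z[OF U(2)]
    by (rule_tac Lim_transform_within_open[OF _ U]) auto
  have dr: "r differentiable (at x)"
    unfolding r_def
    by (intro differentiable_sum finite_Basis ballI differentiable_mult_vanishing differentiable_diff dG differentiable_const
        continuous_intros cz) simp
  have "(\<lambda>y. A (b y - r y)) differentiable (at x)"
    using bounded_linear.has_derivative[OF bA diff_at_works[OF differentiable_diff[OF db' dr]]]
    by (rule differentiableI)
  thus ?thesis using differentiable_cong[OF U, of "\<lambda>y. A (b y - r y)" z] z by simp
qed

section \<open>The Levi-Civita connection of a coordinate domain\<close>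

locale metric_domain =
  fixes U :: "'e::euclidean_space set" and g :: "'e \<Rightarrow> 'e \<Rightarrow> 'e \<Rightarrow> real"
  assumes open_U: "open U"
    and smooth_g: "\<And>u v. smooth_on U (\<lambda>x. g x u v)"
    and inner_product_g: "\<And>x. x \<in> U \<Longrightarrow> inner_product (g x)"
begin

lemma g_bilinear: "x \<in> U \<Longrightarrow> bilinear (g x)"
  by (rule inner_product_bilinear[OF inner_product_g])

lemma g_sym: "x \<in> U \<Longrightarrow> g x u v = g x v u"
  by (rule inner_product_sym[OF inner_product_g])

lemmas g_simps = bilinear_ladd[OF g_bilinear] bilinear_radd[OF g_bilinear] bilinear_lsub[OF g_bilinear]
  bilinear_rsub[OF g_bilinear] bilinear_lneg[OF g_bilinear] bilinear_rneg[OF g_bilinear]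
  bilinear_lzero[OF g_bilinear] bilinear_rzero[OF g_bilinear]

lemma g_eqI: "x \<in> U \<Longrightarrow> (\<And>w. g x u w = g x v w) \<Longrightarrow> u = v"
  by (rule inner_product_eqI[OF inner_product_g])

lemma differentiable_g: "x \<in> U \<Longrightarrow> (\<lambda>y. g y u v) differentiable (at x)"
  by (rule smooth_on_differentiable[OF smooth_g])

lemma differentiable_diff_g: "x \<in> U \<Longrightarrow> (\<lambda>y. diff_at (\<lambda>z. g z u v) y w) differentiable (at x)"
  by (rule smooth_on_differentiable[OF smooth_on_diff_at[OF smooth_g]])

abbreviation dg :: "'e \<Rightarrow> 'e \<Rightarrow> 'e \<Rightarrow> 'e \<Rightarrow> real" where
  "dg x w u v \<equiv> diff_at (\<lambda>y. g y u v) x w"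

text \<open>Koszul's formula for constant fields, whose brackets vanish.\<close>

definition koszul :: "'e \<Rightarrow> 'e \<Rightarrow> 'e \<Rightarrow> 'e \<Rightarrow> real" where
  "koszul x u v w = (dg x u v w + dg x v u w - dg x w u v) / 2"

lemma dg_sym: "x \<in> U \<Longrightarrow> dg x w u v = dg x w v u"
  by (rule fun_cong[OF diff_at_cong[OF open_U]]) (auto intro: g_sym)

lemma dg_bilinear: "x \<in> U \<Longrightarrow> bilinear (dg x w)"
  by (rule bilinear_diff_at[OF open_U _ g_bilinear differentiable_g])

lemma dg_linear: "x \<in> U \<Longrightarrow> linear (\<lambda>w. dg x w u v)"
  using linear_frechet_derivative[OF differentiable_g] by simp

lemma
  assumes x: "x \<in> U"
  shows koszul_linear1: "linear (\<lambda>u. koszul x u v w)"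
    and koszul_linear2: "linear (\<lambda>v. koszul x u v w)"
    and koszul_linear3: "linear (\<lambda>w. koszul x u v w)"
proof -
  note D = bilinear_ladd[OF dg_bilinear[OF x]] bilinear_radd[OF dg_bilinear[OF x]]
    bilinear_lmul[OF dg_bilinear[OF x]] bilinear_rmul[OF dg_bilinear[OF x]]
    linear_add[OF dg_linear[OF x]] linear_scale[OF dg_linear[OF x]]
  show "linear (\<lambda>u. koszul x u v w)" "linear (\<lambda>v. koszul x u v w)" "linear (\<lambda>w. koszul x u v w)"
    by (rule linearI; simp add: koszul_def D field_simps)+
qed

lemma koszul_sym: "x \<in> U \<Longrightarrow> koszul x u v w = koszul x v u w"
  using dg_sym[of x u v w] by (simp add: koszul_def)

text \<open>Formulated for an arbitrary form \<open>S\<close> instead of a connection, so that it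
  also identifies the tangential part of the ambient derivative along an immersion.\<close>

lemma koszul_unique:
  assumes x: "x \<in> U" and sym: "\<And>u v w. S u v w = S v u w"
    and compat: "\<And>u v w. dg x w u v = S w u v + S w v u"
  shows "S u v w = koszul x u v w"
  unfolding koszul_def compat using sym[of u v w] sym[of u w v] sym[of v w u] by simp

text \<open>The properties of a definite description require existence and uniqueness. Koszul's
  formula prescribes the linear form \<open>g x (\<Gamma> u v)\<close>, and Riesz representation
  turns it into a vector.\<close>

lemma christoffel_props:
  assumes x: "x \<in> U"
  shows christoffel_bilinear: "bilinear (christoffel g x)"
    and christoffel_sym: "christoffel g x u v = christoffel g x v u"
    and christoffel_compat: "dg x w u v = g x (christoffel g x w u) v + g x u (christoffel g x w v)"
    and christoffel_koszul: "g x (christoffel g x u v) w = koszul x u v w"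
proof -
  let ?P = "\<lambda>\<Gamma>. bilinear \<Gamma> \<and> (\<forall>u v. \<Gamma> u v = \<Gamma> v u) \<and>
     (\<forall>w u v. dg x w u v = g x (\<Gamma> w u) v + g x u (\<Gamma> w v))"
  have uniq: "g x (\<Gamma> u v) w = koszul x u v w" if P: "?P \<Gamma>" for \<Gamma> u v w
  proof (rule koszul_unique[OF x])
    show "g x (\<Gamma> u v) w = g x (\<Gamma> v u) w" for u v w using P by simp
    show "dg x w u v = g x (\<Gamma> w u) v + g x (\<Gamma> w v) u" for u v w
      using P g_sym[OF x, of u "\<Gamma> w v"] by simp
  qed
  have "\<exists>z. \<forall>w. g x z w = koszul x u v w" for u v
    by (rule inner_product_riesz[OF inner_product_g[OF x] koszul_linear3[OF x]])
  then obtain \<Gamma> where \<Gamma>: "\<And>u v w. g x (\<Gamma> u v) w = koszul x u v w" by metis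
  have sym: "\<Gamma> u v = \<Gamma> v u" for u v by (rule g_eqI[OF x]) (simp add: \<Gamma> koszul_sym[OF x])
  have l1: "linear (\<lambda>u. \<Gamma> u v)" for v
    by (rule linearI; rule g_eqI[OF x])
      (simp_all add: \<Gamma> g_simps x bilinear_lmul[OF g_bilinear[OF x]] linear_add[OF koszul_linear1[OF x]] linear_scale[OF koszul_linear1[OF x]])
  have l2: "linear (\<lambda>v. \<Gamma> u v)" for u
    by (rule linearI; rule g_eqI[OF x])
      (simp_all add: \<Gamma> g_simps x bilinear_lmul[OF g_bilinear[OF x]] linear_add[OF koszul_linear2[OF x]] linear_scale[OF koszul_linear2[OF x]])
  have "bilinear \<Gamma>" unfolding bilinear_def using l1 l2 by simp
  moreover have "dg x w u v = g x (\<Gamma> w u) v + g x u (\<Gamma> w v)" for w u v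
    unfolding g_sym[OF x, of u] \<Gamma> koszul_def using dg_sym[OF x, of u v w] dg_sym[OF x, of w u v] dg_sym[OF x, of w v u] by (simp add: field_simps)
  ultimately have P: "?P \<Gamma>" using sym by blast
  have "christoffel g x = \<Gamma>" unfolding christoffel_def
  proof (rule the_equality[of ?P, OF P])
    fix \<Gamma>' assume "?P \<Gamma>'"
    from uniq[OF this] show "\<Gamma>' = \<Gamma>" by (intro ext g_eqI[OF x]) (simp add: \<Gamma>)
  qed
  thus "bilinear (christoffel g x)" "christoffel g x u v = christoffel g x v u"
    "dg x w u v = g x (christoffel g x w u) v + g x u (christoffel g x w v)"
    "g x (christoffel g x u v) w = koszul x u v w"
    using P \<Gamma> by blast+
qed

lemmas \<Gamma>_simps = bilinear_ladd[OF christoffel_bilinear] bilinear_radd[OF christoffel_bilinear]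
  bilinear_lmul[OF christoffel_bilinear] bilinear_rmul[OF christoffel_bilinear]
  bilinear_lzero[OF christoffel_bilinear] bilinear_rzero[OF christoffel_bilinear]

text \<open>The pairings with all \<open>w\<close> are given by \<open>koszul\<close>, hence
  differentiable; the vector solves a linear system whose matrix is the metric. One derivative is
  what the curvature tensor requires.\<close>

lemma differentiable_christoffel:
  assumes x: "x \<in> U"
  shows "(\<lambda>y. christoffel g y u v) differentiable (at x)"
proof (rule differentiable_inner_product_solution[OF open_U x inner_product_g differentiable_g[OF x]])
  fix w
  have "(\<lambda>y. koszul y u v w) differentiable (at x)"
    unfolding koszul_def divide_inverse
    by (intro differentiable_mult differentiable_add differentiable_diff differentiable_diff_g[OF x] differentiable_const)
  thus "(\<lambda>y. g y (christoffel g y u v) w) differentiable (at x)"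
    by (rule differentiable_cong[OF open_U x, rotated]) (simp add: christoffel_koszul)
qed

section \<open>Covariant differentiation along a map\<close>

lemma has_derivative_metric_along:
  assumes fx: "f x \<in> U" and f: "f differentiable (at x)" and V: "V differentiable (at x)" and W: "W differentiable (at x)"
  shows "((\<lambda>y. g (f y) (V y) (W y)) has_derivative
     (\<lambda>u. g (f x) (cov_deriv_along g f u V x) (W x) + g (f x) (V x) (cov_deriv_along g f u W x))) (at x)"
  by (rule has_derivative_eq_rhs[OF has_derivative_bilinear_family[OF open_U fx g_bilinear differentiable_g[OF fx]
       diff_at_works[OF f] diff_at_works[OF V] diff_at_works[OF W]]])
    (simp_all add: fun_eq_iff cov_deriv_along_def christoffel_compat[OF fx] g_simps fx)

lemma has_derivative_christoffel_along:
  assumes fx: "f x \<in> U" and f: "f differentiable (at x)" and V: "V differentiable (at x)" and W: "W differentiable (at x)"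
  shows "((\<lambda>y. christoffel g (f y) (V y) (W y)) has_derivative
     (\<lambda>u. diff_at (\<lambda>z. christoffel g z (V x) (W x)) (f x) (diff_at f x u)
       + christoffel g (f x) (diff_at V x u) (W x) + christoffel g (f x) (V x) (diff_at W x u))) (at x)"
  by (rule has_derivative_bilinear_family[OF open_U fx christoffel_bilinear differentiable_christoffel[OF fx]
       diff_at_works[OF f] diff_at_works[OF V] diff_at_works[OF W]])

section \<open>The curvature tensor and its symmetries\<close>

definition rm :: "'e \<Rightarrow> 'e \<Rightarrow> 'e \<Rightarrow> 'e \<Rightarrow> 'e" where
  "rm x u v w = riemann g (\<lambda>_. u) (\<lambda>_. v) (\<lambda>_. w) x"

text \<open>The iterated covariant derivative, first in direction \<open>v\<close> and then in
  direction \<open>u\<close>, of the constant field \<open>w\<close>. Curvature is its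
  antisymmetrisation in \<open>u\<close>, \<open>v\<close>; its symmetry in \<open>v\<close>,
  \<open>w\<close>, due to vanishing torsion, yields the first Bianchi identity.\<close>

definition cov2 :: "'e \<Rightarrow> 'e \<Rightarrow> 'e \<Rightarrow> 'e \<Rightarrow> 'e" where
  "cov2 x u v w = diff_at (\<lambda>y. christoffel g y v w) x u + christoffel g x u (christoffel g x v w)"

lemma rm_eq: "x \<in> U \<Longrightarrow> rm x u v w = cov2 x u v w - cov2 x v u w"
  by (simp add: rm_def cov2_def riemann_def cov_deriv_def lie_bracket_def \<Gamma>_simps)

lemma
  assumes x: "x \<in> U"
  shows cov2_linear1: "linear (\<lambda>u. cov2 x u v w)" and cov2_linear2: "linear (\<lambda>v. cov2 x u v w)"
    and cov2_linear3: "linear (\<lambda>w. cov2 x u v w)" and cov2_sym: "cov2 x u v w = cov2 x u w v"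
proof -
  note D = bilinear_diff_at[OF open_U x christoffel_bilinear differentiable_christoffel[OF x], of u]
  show "linear (\<lambda>u. cov2 x u v w)"
    unfolding cov2_def using linear_frechet_derivative[OF differentiable_christoffel[OF x]]
    by (intro linear_compose_add) (use christoffel_bilinear[OF x] in \<open>simp_all add: bilinear_def\<close>)
  show "linear (\<lambda>v. cov2 x u v w)" "linear (\<lambda>w. cov2 x u v w)"
    unfolding cov2_def
    by (rule linearI; simp add: bilinear_ladd[OF D] bilinear_radd[OF D] bilinear_lmul[OF D] bilinear_rmul[OF D] \<Gamma>_simps x algebra_simps)+
  have "diff_at (\<lambda>y. christoffel g y v w) x = diff_at (\<lambda>y. christoffel g y w v) x"
    by (rule diff_at_cong[OF open_U x]) (rule christoffel_sym)
  thus "cov2 x u v w = cov2 x u w v" unfolding cov2_def christoffel_sym[OF x, of v w] by simp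
qed

lemma rm_linear1: "x \<in> U \<Longrightarrow> linear (\<lambda>u. rm x u v w)"
  by (simp add: rm_eq linear_compose_sub cov2_linear1 cov2_linear2)

lemma rm_linear2: "x \<in> U \<Longrightarrow> linear (\<lambda>v. rm x u v w)"
  by (simp add: rm_eq linear_compose_sub cov2_linear1 cov2_linear2)

lemma rm_linear3: "x \<in> U \<Longrightarrow> linear (\<lambda>w. rm x u v w)"
  by (simp add: rm_eq linear_compose_sub cov2_linear3)

lemma rm_antisym: "x \<in> U \<Longrightarrow> rm x u v w = - rm x v u w"
  by (simp add: rm_eq)

lemma rm_bianchi: "x \<in> U \<Longrightarrow> rm x u v w + rm x v w u + rm x w u v = 0"
  by (simp add: rm_eq cov2_sym[of x u w v] cov2_sym[of x v w u] cov2_sym[of x w v u])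

text \<open>Metric compatibility, applied twice, expresses the second derivatives of
  \<open>g y w z\<close>. Their symmetry in \<open>u\<close>, \<open>v\<close> cancels the products
  of first derivatives and leaves the claim.\<close>

lemma rm_skew:
  assumes x: "x \<in> U"
  shows "g x (rm x u v w) z = - g x (rm x u v z) w"
proof -
  let ?\<Gamma> = "christoffel g"
  have h: "((\<lambda>y. g y (?\<Gamma> y v w) z) has_derivative
      (\<lambda>u. g x (cov2 x u v w) z + g x (?\<Gamma> x v w) (?\<Gamma> x u z))) (at x)" for v w z
    using has_derivative_metric_along[of "\<lambda>y. y" x "\<lambda>y. ?\<Gamma> y v w" "\<lambda>_. z"] x
    by (simp add: differentiable_christoffel cov_deriv_along_def cov2_def)
  have "diff_at (\<lambda>y. dg y v w z) x u = g x (cov2 x u v w) z + g x (?\<Gamma> x v w) (?\<Gamma> x u z)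
      + (g x (cov2 x u v z) w + g x (?\<Gamma> x v z) (?\<Gamma> x u w))" for u v w z
  proof -
    have "diff_at (\<lambda>y. dg y v w z) x = diff_at (\<lambda>y. g y (?\<Gamma> y v w) z + g y (?\<Gamma> y v z) w) x"
      by (rule diff_at_cong[OF open_U x]) (simp add: christoffel_compat g_sym)
    thus ?thesis using diff_at_eq[OF has_derivative_add[OF h[of v w z] h[of v z w]]] by simp
  qed
  moreover have "diff_at (\<lambda>y. dg y v w z) x u = diff_at (\<lambda>y. dg y u w z) x v"
    by (rule symmetric_second_derivative[OF open_U x smooth_g])
  ultimately show ?thesis
    using g_sym[OF x, of "?\<Gamma> x v w" "?\<Gamma> x u z"] g_sym[OF x, of "?\<Gamma> x v z" "?\<Gamma> x u w"]
    by (simp add: rm_eq x g_simps)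
qed

lemma differentiable_cov_deriv_along:
  assumes O: "open O'" "x \<in> O'" and fU: "f x \<in> U" and f: "smooth_on O' f" and V: "smooth_on O' V"
  shows "((\<lambda>y. cov_deriv_along g f v V y) has_derivative
     (\<lambda>u. diff_at (\<lambda>y. diff_at V y v) x u
       + (diff_at (\<lambda>z. christoffel g z (diff_at f x v) (V x)) (f x) (diff_at f x u)
       + christoffel g (f x) (diff_at (\<lambda>y. diff_at f y v) x u) (V x)
       + christoffel g (f x) (diff_at f x v) (diff_at V x u)))) (at x)"
  unfolding cov_deriv_along_def
  by (intro has_derivative_add has_derivative_christoffel_along[where f=f, OF fU] diff_at_works smooth_on_differentiable[OF _ O(2)]
      smooth_on_diff_at f V)

text \<open>The curvature of the pulled-back connection. As \<open>u\<close> and \<open>v\<close>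
  are constant on the domain of \<open>f\<close>, there is no bracket term, and fields along
  \<open>f\<close> need no extension off its image.\<close>

lemma curvature_along:
  assumes O: "open O'" "x \<in> O'" and fU: "f x \<in> U" and f: "smooth_on O' f" and V: "smooth_on O' V"
  shows "cov_deriv_along g f u (\<lambda>y. cov_deriv_along g f v V y) x - cov_deriv_along g f v (\<lambda>y. cov_deriv_along g f u V y) x
    = rm (f x) (diff_at f x u) (diff_at f x v) (V x)"
proof -
  note d = differentiable_cov_deriv_along[OF O fU f V]
  show ?thesis
    unfolding cov_deriv_along_def[of g f _ "\<lambda>y. cov_deriv_along g f _ V y"] diff_at_eq[OF d]
    unfolding cov_deriv_along_def rm_eq[OF fU] cov2_def \<Gamma>_simps[OF fU]
    using symmetric_second_derivative[OF O f, of u v] symmetric_second_derivative[OF O V, of u v]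
    by (simp add: algebra_simps)
qed

end

section \<open>Lagrangian immersions and the Gauss equation\<close>

locale holomorphic_curvature =
  fixes R :: "'v::real_vector \<Rightarrow> 'v \<Rightarrow> 'v \<Rightarrow> 'v \<Rightarrow> real" and b :: "'v \<Rightarrow> 'v \<Rightarrow> real" and J :: "'v \<Rightarrow> 'v" and \<kappa> :: real
  assumes R_linear: "\<And>v w z. linear (\<lambda>u. R u v w z)" "\<And>u w z. linear (\<lambda>v. R u v w z)"
      "\<And>u v z. linear (\<lambda>w. R u v w z)" "\<And>u v w. linear (\<lambda>z. R u v w z)"
    and R_antisym: "\<And>u v w z. R u v w z = - R v u w z"
    and R_skew: "\<And>u v w z. R u v w z = - R u v z w"
    and R_bianchi: "\<And>u v w z. R u v w z + R v w u z + R w u v z = 0"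
    and J_linear: "linear J" and J_J: "\<And>v. J (J v) = - v"
    and R_J: "\<And>u v w z. R u v (J w) (J z) = R u v w z"
    and b_bilinear: "bilinear b" and b_sym: "\<And>u v. b u v = b v u"
    and b_J: "\<And>u v. b (J u) (J v) = b u v"
    and R_holomorphic: "\<And>u. R u (J u) (J u) u = \<kappa> * (b u u)\<^sup>2"
begin

lemmas R_add = R_linear[THEN linear_add]
lemmas R_diff = R_linear[THEN linear_diff]
lemmas R_neg = R_linear[THEN linear_neg]

text \<open>The octahedron argument: four cyclic Bianchi identities, combined through the two
  antisymmetries, leave a multiple of the difference of both sides.\<close>

lemma R_pair_sym: "R u v w z = R w z u v"
  using R_bianchi[of u v w z] R_bianchi[of v w z u] R_bianchi[of w z u v] R_bianchi[of z u v w]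
    R_antisym[of u v w z] R_antisym[of v w u z] R_antisym[of w u v z]
    R_antisym[of v w z u] R_antisym[of w z v u] R_antisym[of z v w u]
    R_antisym[of w z u v] R_antisym[of z u w v] R_antisym[of u w z v]
    R_antisym[of z u v w] R_antisym[of u v z w] R_antisym[of v z u w]
    R_skew[of u v w z] R_skew[of v w u z] R_skew[of w u v z]
    R_skew[of w z u v] R_skew[of z u w v] R_skew[of z v w u]
  by linarith

lemma R_J': "R (J u) (J v) w z = R u v w z"
  using R_pair_sym R_J by metis

text \<open>Polarise \<open>R u (J u) (J u) u\<close> at \<open>x + y\<close> and \<open>x - y\<close>; replacing \<open>y\<close> by \<open>J y\<close> then gives a second linear equation.\<close>

lemma holomorphic_curvature_sum:
  assumes "b x x = 1" "b y y = 1" "b x y = 0" "b x (J y) = 0"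
  shows "R x y y x + 3 * R x (J y) (J y) x = \<kappa>"
proof -
  have "b (x + y) (x + y) = 2" "b (x - y) (x - y) = 2"
    using assms b_sym[of x y] by (simp_all add: bilinear_ladd[OF b_bilinear] bilinear_radd[OF b_bilinear]
        bilinear_lsub[OF b_bilinear] bilinear_rsub[OF b_bilinear])
  hence "R (x + y) (J (x + y)) (J (x + y)) (x + y) + R (x - y) (J (x - y)) (J (x - y)) (x - y) = 8 * \<kappa>"
    unfolding R_holomorphic by simp
  moreover have "R x (J x) (J x) x = \<kappa>" "R y (J y) (J y) y = \<kappa>"
    using assms by (simp_all add: R_holomorphic)
  ultimately have 1: "R x (J x) (J y) y + R y (J y) (J x) x + R x (J y) (J x) y + R y (J x) (J y) x
      + R x (J y) (J y) x + R y (J x) (J x) y = 2 * \<kappa>"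
    unfolding linear_add[OF J_linear] linear_diff[OF J_linear] R_add R_diff by simp
  have 2: "R y (J y) (J x) x = R x (J x) (J y) y"
    using R_pair_sym[of y "J y" "J x" x] R_antisym[of "J x" x y "J y"] R_skew[of x "J x" y "J y"] by simp
  have 3: "R y (J x) w z = R x (J y) w z" for w z
    using R_J'[of y "J x" w z] R_antisym[of "J y" x w z] by (simp add: J_J R_neg)
  have 4: "R w z (J x) y = R w z (J y) x" for w z
    using R_pair_sym[of w z "J x" y] R_pair_sym[of w z "J y" x] 3 R_antisym by (metis (no_types))
  have 5: "R (J x) (J y) x y = - R x y y x" using R_J'[of x y x y] R_skew[of x y x y] by simp
  have 6: "R (J y) x (J y) x = - R x (J y) (J y) x" by (rule R_antisym)
  \<comment> \<open>The substitutions turn 1 into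
    \<open>2 * R x (J x) (J y) y + 4 * R x (J y) (J y) x = 2 * \<kappa>\<close>, and the Bianchi
    identity splits \<open>R x (J x) (J y) y\<close> into
    \<open>R x y y x + R x (J y) (J y) x\<close>.\<close>
  show ?thesis
    using 1 R_bianchi[of x "J x" "J y" y] unfolding 2 3 4 5 6 by simp
qed

lemma curvature_totally_real_plane:
  assumes "b x x = 1" "b y y = 1" "b x y = 0" "b x (J y) = 0"
  shows "R x y y x = \<kappa> / 4"
proof -
  have "R x (J y) (J y) x + 3 * R x (J (J y)) (J (J y)) x = \<kappa>"
    using assms by (intro holomorphic_curvature_sum) (simp_all add: b_J J_J bilinear_rneg[OF b_bilinear])
  with holomorphic_curvature_sum[OF assms] show ?thesis by (simp add: J_J R_neg)
qed

end

section \<open>Kaehler metrics in holomorphic coordinates\<close>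

lemma diff_at_bounded_linear:
  assumes "bounded_linear J" "f differentiable (at x)"
  shows "diff_at (\<lambda>y. J (f y)) x u = J (diff_at f x u)"
  using diff_at_eq[OF bounded_linear.has_derivative[OF assms(1) diff_at_works[OF assms(2)]]] by metis

text \<open>In holomorphic coordinates the complex structure is a constant linear map, so for
  constant fields its parallelism says that the Christoffel map commutes with it.\<close>

locale kaehler_domain = metric_domain +
  fixes J :: "'a \<Rightarrow> 'a" and \<kappa> :: real
  assumes J_bounded: "bounded_linear J" and J_J: "\<And>v. J (J v) = - v"
    and hermitian: "\<And>x u v. x \<in> U \<Longrightarrow> g x (J u) (J v) = g x u v"
    and christoffel_J: "\<And>x u v. x \<in> U \<Longrightarrow> christoffel g x u (J v) = J (christoffel g x u v)"
    and holomorphic: "\<And>x u. x \<in> U \<Longrightarrow> u \<noteq> 0 \<Longrightarrow> sec_curv g x u (J u) = \<kappa>"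
begin

lemma J_linear: "linear J"
  using J_bounded by (simp add: linear_conv_bounded_linear)

lemma rm_J:
  assumes x: "x \<in> U"
  shows "rm x u v (J w) = J (rm x u v w)"
proof -
  have "cov2 x u v (J w) = J (cov2 x u v w)" for u v
  proof -
    have "diff_at (\<lambda>y. christoffel g y v (J w)) x = diff_at (\<lambda>y. J (christoffel g y v w)) x"
      by (rule diff_at_cong[OF open_U x]) (rule christoffel_J)
    thus ?thesis
      by (simp add: cov2_def christoffel_J x diff_at_bounded_linear[OF J_bounded differentiable_christoffel] linear_add[OF J_linear])
  qed
  thus ?thesis by (simp add: rm_eq x linear_diff[OF J_linear])
qed

lemma g_J_self: "x \<in> U \<Longrightarrow> g x u (J u) = 0"
  using hermitian[of x u "J u"] g_sym[of x "J u" u] by (simp add: J_J g_simps)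

lemma totally_real_curvature:
  assumes x: "x \<in> U" and "g x u u = 1" "g x v v = 1" "g x u v = 0" "g x u (J v) = 0"
  shows "g x (rm x u v v) u = \<kappa> / 4"
proof -
  interpret holomorphic_curvature "\<lambda>u v w. g x (rm x u v w)" "g x" J \<kappa>
  proof (rule holomorphic_curvature.intro)
    fix u v w z
    have gl: "linear (\<lambda>u. g x u z)" and gr: "linear (g x (rm x u v w))"
      using g_bilinear[OF x] by (simp_all add: bilinear_def)
    show "linear (\<lambda>u. g x (rm x u v w) z)" "linear (\<lambda>v. g x (rm x u v w) z)"
      "linear (\<lambda>w. g x (rm x u v w) z)" "linear (\<lambda>z. g x (rm x u v w) z)"
      using linear_compose[OF rm_linear1[OF x] gl] linear_compose[OF rm_linear2[OF x] gl]
        linear_compose[OF rm_linear3[OF x] gl] gr by (simp_all add: comp_def)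
    show "g x (rm x u v w) z = - g x (rm x v u w) z"
      using rm_antisym[OF x, of u v w] by (simp add: g_simps x)
    show "g x (rm x u v w) z = - g x (rm x u v z) w" by (rule rm_skew[OF x])
    show "g x (rm x u v w) z + g x (rm x v w u) z + g x (rm x w u v) z = 0"
      using arg_cong[OF rm_bianchi[OF x, of u v w], of "\<lambda>s. g x s z"] by (simp add: g_simps x)
    show "linear J" by (rule J_linear)
    show "J (J v) = - v" by (rule J_J)
    show "g x (rm x u v (J w)) (J z) = g x (rm x u v w) z" by (simp add: rm_J x hermitian)
    show "bilinear (g x)" by (rule g_bilinear[OF x])
    show "g x u v = g x v u" by (rule g_sym[OF x])
    show "g x (J u) (J v) = g x u v" by (rule hermitian[OF x])
    show "g x (rm x u (J u) (J u)) u = \<kappa> * (g x u u)\<^sup>2"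
    proof (cases "u = 0")
      case True thus ?thesis by (simp add: g_simps x)
    next
      case False
      hence "g x u u \<noteq> 0" using inner_product_pos[OF inner_product_g[OF x] False] by simp
      thus ?thesis using holomorphic[OF x False]
        by (simp add: sec_curv_def rm_def[symmetric] hermitian x g_J_self power2_eq_square field_simps)
    qed
  qed
  show ?thesis using assms by (intro curvature_totally_real_plane)
qed

end

section \<open>Isometric immersions\<close>

locale immersed_domain = dom: metric_domain U g + amb: metric_domain V g'
  for U :: "'e::euclidean_space set" and g and V :: "'f::euclidean_space set" and g' +
  fixes f :: "'e \<Rightarrow> 'f"
  assumes smooth_f: "smooth_on U f" and f_in: "\<And>x. x \<in> U \<Longrightarrow> f x \<in> V"
    and isometric: "\<And>x u v. x \<in> U \<Longrightarrow> g x u v = g' (f x) (diff_at f x u) (diff_at f x v)"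
begin

abbreviation "df \<equiv> \<lambda>x u. diff_at f x u"
abbreviation "\<Gamma> \<equiv> christoffel g"
abbreviation "sff \<equiv> second_fund_form g g' f"
abbreviation "D\<^sub>f \<equiv> cov_deriv_along g' f"

lemmas g'_simps = amb.g_simps[OF f_in]

lemma differentiable_f: "x \<in> U \<Longrightarrow> f differentiable (at x)"
  by (rule smooth_on_differentiable[OF smooth_f])

lemma smooth_df: "smooth_on U (\<lambda>y. df y u)"
  by (rule smooth_on_diff_at[OF smooth_f])

lemma differentiable_df: "x \<in> U \<Longrightarrow> (\<lambda>y. df y u) differentiable (at x)"
  by (rule smooth_on_differentiable[OF smooth_df])

lemma df_linear: "x \<in> U \<Longrightarrow> linear (df x)"
  by (rule linear_frechet_derivative[OF differentiable_f])

lemma sff_eq: "sff x u v = D\<^sub>f u (\<lambda>y. df y v) x - df x (\<Gamma> x u v)"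
  by (simp add: second_fund_form_def cov_deriv_def)

lemma cov_deriv_df_sym:
  assumes x: "x \<in> U"
  shows "D\<^sub>f u (\<lambda>y. df y v) x = D\<^sub>f v (\<lambda>y. df y u) x"
  using symmetric_second_derivative[OF dom.open_U x smooth_f, of v u]
    amb.christoffel_sym[OF f_in[OF x], of "df x u" "df x v"]
  by (simp add: cov_deriv_along_def)

lemma sff_sym: "x \<in> U \<Longrightarrow> sff x u v = sff x v u"
  using cov_deriv_df_sym[of x u v] dom.christoffel_sym[of x u v] by (simp add: sff_eq)

text \<open>The tangential part of the ambient derivative is symmetric, since second derivatives
  commute, and compatible with the induced metric; by uniqueness it is the intrinsic connection.
  Hence \<open>second_fund_form\<close>, defined as a difference, takes normal values.\<close>

lemma cov_deriv_df_tangent: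
  assumes x: "x \<in> U"
  shows "g' (f x) (D\<^sub>f u (\<lambda>y. df y v) x) (df x w) = g x (\<Gamma> x u v) w"
  unfolding dom.christoffel_koszul[OF x]
proof (rule dom.koszul_unique[OF x])
  show "g' (f x) (D\<^sub>f u (\<lambda>y. df y v) x) (df x w) = g' (f x) (D\<^sub>f v (\<lambda>y. df y u) x) (df x w)" for u v w
    by (simp add: cov_deriv_df_sym[OF x, of u v])
  show "dom.dg x w u v = g' (f x) (D\<^sub>f w (\<lambda>y. df y u) x) (df x v) + g' (f x) (D\<^sub>f w (\<lambda>y. df y v) x) (df x u)" for u v w
  proof -
    have "dom.dg x w u v = diff_at (\<lambda>y. g' (f y) (df y u) (df y v)) x w"
      by (rule fun_cong[OF diff_at_cong[OF dom.open_U x]]) (rule isometric)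
    also have "\<dots> = g' (f x) (D\<^sub>f w (\<lambda>y. df y u) x) (df x v) + g' (f x) (df x u) (D\<^sub>f w (\<lambda>y. df y v) x)"
      using diff_at_eq[OF amb.has_derivative_metric_along[where f=f and V="\<lambda>y. df y u" and W="\<lambda>y. df y v", OF f_in[OF x] differentiable_f[OF x] differentiable_df[OF x] differentiable_df[OF x]]]
      by metis
    finally show ?thesis by (simp add: amb.g_sym[OF f_in[OF x], of "df x u"])
  qed
qed

lemma sff_normal: "x \<in> U \<Longrightarrow> g' (f x) (sff x u v) (df x w) = 0"
  by (simp add: sff_eq g'_simps cov_deriv_df_tangent isometric)

lemma has_derivative_push_forward:
  assumes x: "x \<in> U" and X: "X differentiable (at x)"
  shows "((\<lambda>y. df y (X y)) has_derivative (\<lambda>u. diff_at (\<lambda>y. df y (X x)) x u + df x (diff_at X x u))) (at x)"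
proof -
  \<comment> \<open>The dummy factor \<open>a\<close> turns the linear family \<open>df\<close> into a bilinear one.\<close>
  let ?B = "\<lambda>y v (a::real). a *\<^sub>R df y v"
  have "bilinear (?B y)" if "y \<in> U" for y
    using df_linear[OF that] unfolding bilinear_def linear_iff by (simp add: algebra_simps)
  from has_derivative_bilinear_family[where B="?B" and f="\<lambda>y. y" and x=x and W="\<lambda>_. 1" and V=X, OF dom.open_U x this _ has_derivative_ident
      diff_at_works[OF X] has_derivative_const]
  show ?thesis by (simp add: differentiable_df[OF x] differentiable_scaleR)
qed

lemma cov_deriv_push_forward:
  assumes x: "x \<in> U" and X: "X differentiable (at x)"
  shows "D\<^sub>f u (\<lambda>y. df y (X y)) x = D\<^sub>f u (\<lambda>y. df y (X x)) x + df x (diff_at X x u)"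
  using diff_at_eq[OF has_derivative_push_forward[OF x X]] by (simp add: cov_deriv_along_def)

lemma differentiable_push_forward:
  assumes x: "x \<in> U" and X: "X differentiable (at x)"
  shows "(\<lambda>y. df y (X y)) differentiable (at x)"
  by (rule differentiableI[OF has_derivative_push_forward[OF x X]])

lemma differentiable_sff: "x \<in> U \<Longrightarrow> (\<lambda>y. sff y u v) differentiable (at x)"
  unfolding sff_eq
  by (intro differentiable_diff differentiable_push_forward dom.differentiable_christoffel
      differentiableI[OF amb.differentiable_cov_deriv_along[OF dom.open_U]] f_in smooth_f smooth_df)

text \<open>Weingarten's relation, from differentiating the orthogonality of
  \<open>sff y v w\<close> and \<open>df y z\<close>. The tangential part of the derivative of
  \<open>df y z\<close> is invisible to the normal vector \<open>sff x v w\<close>.\<close>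

lemma cov_deriv_sff:
  assumes x: "x \<in> U"
  shows "g' (f x) (D\<^sub>f u (\<lambda>y. sff y v w) x) (df x z) = - g' (f x) (sff x v w) (sff x u z)"
proof -
  have "diff_at (\<lambda>y. g' (f y) (sff y v w) (df y z)) x u = diff_at (\<lambda>_. 0 :: real) x u"
    by (rule fun_cong[OF diff_at_cong[OF dom.open_U x]]) (rule sff_normal)
  moreover have "diff_at (\<lambda>y. g' (f y) (sff y v w) (df y z)) x u =
      g' (f x) (D\<^sub>f u (\<lambda>y. sff y v w) x) (df x z) + g' (f x) (sff x v w) (D\<^sub>f u (\<lambda>y. df y z) x)"
    using diff_at_eq[OF amb.has_derivative_metric_along[where f=f and V="\<lambda>y. sff y v w" and W="\<lambda>y. df y z", OF f_in[OF x] differentiable_f[OF x]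
       differentiable_sff[OF x] differentiable_df[OF x]]] by metis
  moreover have "D\<^sub>f u (\<lambda>y. df y z) x = sff x u z + df x (\<Gamma> x u z)" by (simp add: sff_eq)
  ultimately show ?thesis by (simp add: g'_simps x sff_normal)
qed

text \<open>The inner derivative is split into tangential and normal parts before the outer one is
  taken. Antisymmetrisation in \<open>u\<close>, \<open>v\<close> gives the Gauss equation.\<close>

lemma second_cov_deriv_tangent:
  assumes x: "x \<in> U"
  shows "g' (f x) (D\<^sub>f u (\<lambda>y. D\<^sub>f v (\<lambda>y. df y w) y) x) (df x z)
    = g x (dom.cov2 x u v w) z - g' (f x) (sff x v w) (sff x u z)"
proof -
  have e: "D\<^sub>f v (\<lambda>y. df y w) y = df y (\<Gamma> y v w) + sff y v w" for y by (simp add: sff_eq)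
  have d: "(\<lambda>y. df y (\<Gamma> y v w)) differentiable (at x)"
    by (intro differentiable_push_forward dom.differentiable_christoffel x)
  have "D\<^sub>f u (\<lambda>y. D\<^sub>f v (\<lambda>y. df y w) y) x = D\<^sub>f u (\<lambda>y. df y (\<Gamma> y v w)) x + D\<^sub>f u (\<lambda>y. sff y v w) x"
    unfolding e unfolding cov_deriv_along_def
    by (simp add: diff_at_add[OF d differentiable_sff[OF x]] amb.\<Gamma>_simps f_in x)
  also have "D\<^sub>f u (\<lambda>y. df y (\<Gamma> y v w)) x = D\<^sub>f u (\<lambda>y. df y (\<Gamma> x v w)) x + df x (diff_at (\<lambda>y. \<Gamma> y v w) x u)"
    by (rule cov_deriv_push_forward[OF x dom.differentiable_christoffel[OF x]])
  finally show ?thesis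
    by (simp add: g'_simps x cov_deriv_df_tangent cov_deriv_sff dom.cov2_def dom.g_simps isometric[symmetric])
qed

theorem gauss_equation:
  assumes x: "x \<in> U"
  shows "g x (dom.rm x u v w) z = g' (f x) (amb.rm (f x) (df x u) (df x v) (df x w)) (df x z)
    + g' (f x) (sff x v w) (sff x u z) - g' (f x) (sff x u w) (sff x v z)"
  unfolding amb.curvature_along[OF dom.open_U x f_in[OF x] smooth_f smooth_df, symmetric]
  by (simp add: g'_simps x second_cov_deriv_tangent dom.rm_eq dom.g_simps)

end

section \<open>The cubic form of a Lagrangian immersion\<close>

locale lagrangian_domain = immersed_domain U g V g' f + amb: kaehler_domain V g' J \<kappa>
  for U :: "'e::euclidean_space set" and g and V :: "'f::euclidean_space set" and g' f J \<kappa> +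
  assumes lagrangian_tangent: "\<And>x u v. x \<in> U \<Longrightarrow> g' (f x) (J (diff_at f x u)) (diff_at f x v) = 0"
    and lagrangian_normal: "\<And>x \<xi>. x \<in> U \<Longrightarrow> (\<And>v. g' (f x) \<xi> (diff_at f x v) = 0) \<Longrightarrow> J \<xi> \<in> range (diff_at f x)"
begin

definition cubic :: "'e \<Rightarrow> 'e \<Rightarrow> 'e \<Rightarrow> 'e \<Rightarrow> real" where
  "cubic x u v w = g' (f x) (sff x u v) (J (df x w))"

lemma cubic_sym12: "x \<in> U \<Longrightarrow> cubic x u v w = cubic x v u w"
  by (simp add: cubic_def sff_sym[of x u v])

lemma J_adjoint: "x \<in> V \<Longrightarrow> g' x (J u) v = - g' x u (J v)"
  using amb.hermitian[of x u "J v"] by (simp add: amb.J_J amb.g_simps)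

text \<open>Comes from differentiating the Lagrangian condition: \<open>J\<close> is parallel, and
  the tangential parts of the derivatives vanish by the Lagrangian condition itself. With
  \<open>cubic_sym12\<close> the form is totally symmetric.\<close>

lemma cubic_sym23:
  assumes x: "x \<in> U"
  shows "cubic x u v w = cubic x u w v"
proof -
  have d: "(\<lambda>y. J (df y w)) differentiable (at x)"
    by (rule differentiableI[OF bounded_linear.has_derivative[OF amb.J_bounded diff_at_works[OF differentiable_df[OF x]]]])
  have "D\<^sub>f u (\<lambda>y. J (df y w)) x = J (D\<^sub>f u (\<lambda>y. df y w) x)"
    by (simp add: cov_deriv_along_def diff_at_bounded_linear[OF amb.J_bounded differentiable_df[OF x]]
        amb.christoffel_J f_in x linear_add[OF amb.J_linear])
  moreover have "diff_at (\<lambda>y. g' (f y) (J (df y w)) (df y v)) x u = diff_at (\<lambda>_. 0 :: real) x u"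
    by (rule fun_cong[OF diff_at_cong[OF dom.open_U x]]) (rule lagrangian_tangent)
  moreover have "diff_at (\<lambda>y. g' (f y) (J (df y w)) (df y v)) x u =
      g' (f x) (D\<^sub>f u (\<lambda>y. J (df y w)) x) (df x v) + g' (f x) (J (df x w)) (D\<^sub>f u (\<lambda>y. df y v) x)"
    using diff_at_eq[OF amb.has_derivative_metric_along[where f=f and V="\<lambda>y. J (df y w)" and W="\<lambda>y. df y v", OF f_in[OF x] differentiable_f[OF x]
       d differentiable_df[OF x]]] by metis
  moreover have "D\<^sub>f u (\<lambda>y. df y z) x = sff x u z + df x (\<Gamma> x u z)" for z by (simp add: sff_eq)
  ultimately have "g' (f x) (J (sff x u w)) (df x v) + g' (f x) (J (df x w)) (sff x u v) = 0"
    by (simp add: g'_simps x lagrangian_tangent linear_add[OF amb.J_linear])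
  thus ?thesis
    by (simp add: cubic_def J_adjoint f_in x amb.g_sym[OF f_in[OF x], of "sff x u v"])
qed

lemma lagrangian_gauss:
  assumes x: "x \<in> U" and "g x u u = 1" "g x v v = 1" "g x u v = 0"
  shows "g x (dom.rm x u v v) u = \<kappa> / 4 + g' (f x) (sff x u u) (sff x v v) - g' (f x) (sff x u v) (sff x u v)"
proof -
  have "g' (f x) (amb.rm (f x) (df x u) (df x v) (df x v)) (df x u) = \<kappa> / 4"
    using assms lagrangian_tangent[OF x, of v u] amb.g_sym[OF f_in[OF x], of "df x u" "J (df x v)"]
    by (intro amb.totally_real_curvature f_in) (simp_all add: isometric)
  thus ?thesis using gauss_equation[OF x, of u v v u] sff_sym[OF x, of u v]
      amb.g_sym[OF f_in[OF x], of "sff x u u" "sff x v v"] by simp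
qed

end

section \<open>Orthonormal bases\<close>

text \<open>The arbitrary index set lets a block of an adapted basis serve as a basis of its
  subspace without renumbering from 1.\<close>

definition orthonormal_on :: "('e \<Rightarrow> 'e \<Rightarrow> real) \<Rightarrow> 'i set \<Rightarrow> ('i \<Rightarrow> 'e) \<Rightarrow> bool" where
  "orthonormal_on b I e \<longleftrightarrow> (\<forall>i\<in>I. \<forall>j\<in>I. b (e i) (e j) = (if i = j then 1 else 0))"

lemma orthonormal_onD: "orthonormal_on b I e \<Longrightarrow> i \<in> I \<Longrightarrow> j \<in> I \<Longrightarrow> b (e i) (e j) = (if i = j then 1 else 0)"
  by (simp add: orthonormal_on_def)

lemma orthonormal_on_subset: "orthonormal_on b I e \<Longrightarrow> J \<subseteq> I \<Longrightarrow> orthonormal_on b J e"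
  unfolding orthonormal_on_def by blast

lemma orthonormal_basis_iff:
  "orthonormal_basis b L e \<longleftrightarrow> orthonormal_on b {1..dim L} e \<and> span (e ` {1..dim L}) = L"
  by (auto simp: orthonormal_basis_def orthonormal_on_def)

context
  fixes b :: "'e::euclidean_space \<Rightarrow> 'e \<Rightarrow> real"
  assumes b: "inner_product b"
begin

lemma inner_product_orthogonal_subspace: "subspace {v. b u v = 0}"
  unfolding subspace_def by (simp add: bilinear_radd[OF inner_product_bilinear[OF b]] bilinear_rmul[OF inner_product_bilinear[OF b]] bilinear_rzero[OF inner_product_bilinear[OF b]])

lemma orthogonal_span: "v \<in> span X \<Longrightarrow> (\<And>w. w \<in> X \<Longrightarrow> b u w = 0) \<Longrightarrow> b u v = 0"
  using span_minimal[OF _ inner_product_orthogonal_subspace, of X u] by blast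

lemma
  assumes e: "orthonormal_on b I e"
  shows orthonormal_inj: "inj_on e I" and orthonormal_independent: "independent (e ` I)"
proof -
  show "inj_on e I"
    by (rule inj_onI) (metis e orthonormal_onD zero_neq_one)
  have "b (e i) v = 0" if "i \<in> I" "v \<in> span (e ` I - {e i})" for i v
    by (rule orthogonal_span[OF that(2)]) (use that(1) orthonormal_onD[OF e] in \<open>metis Diff_iff imageE singletonI\<close>)
  thus "independent (e ` I)"
    unfolding dependent_def using orthonormal_onD[OF e] by (metis (no_types, lifting) imageE zero_neq_one)
qed

lemma orthonormal_dim_span: "orthonormal_on b I e \<Longrightarrow> dim (span (e ` I)) = card I"
  using dim_span_eq_card_independent[OF orthonormal_independent] card_image[OF orthonormal_inj] by metis

lemma orthonormal_span_eq:
  assumes e: "orthonormal_on b I e" and L: "subspace L" "e ` I \<subseteq> L" "card I = dim L"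
  shows "span (e ` I) = L"
  by (rule subspace_dim_equal) (use span_minimal[OF L(2,1)] orthonormal_dim_span[OF e] L in auto)

lemma orthonormal_coeff:
  assumes e: "orthonormal_on b I e" and I: "finite I" and j: "j \<in> I"
  shows "b (\<Sum>i\<in>I. c i *\<^sub>R e i) (e j) = c j"
proof -
  have l: "linear (\<lambda>u. b u (e j))" using inner_product_bilinear[OF b] by (simp add: bilinear_def)
  have "b (\<Sum>i\<in>I. c i *\<^sub>R e i) (e j) = (\<Sum>i\<in>I. c i * b (e i) (e j))"
    using linear_sum[OF l, of "\<lambda>i. c i *\<^sub>R e i" I] linear_scale[OF l] by simp
  also have "\<dots> = (\<Sum>i\<in>I. if i = j then c i else 0)"
    by (rule sum.cong) (use j orthonormal_onD[OF e] in auto)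
  finally show ?thesis using j I by simp
qed

lemma orthonormal_expand:
  assumes e: "orthonormal_on b I e" and I: "finite I" and v: "v \<in> span (e ` I)"
  shows "v = (\<Sum>i\<in>I. b v (e i) *\<^sub>R e i)"
proof -
  define w where "w = v - (\<Sum>i\<in>I. b v (e i) *\<^sub>R e i)"
  have "b w (e j) = 0" if "j \<in> I" for j
    using orthonormal_coeff[OF e I that] by (simp add: w_def bilinear_lsub[OF inner_product_bilinear[OF b]])
  moreover have "w \<in> span (e ` I)"
    unfolding w_def by (intro span_diff v span_sum span_scale span_base) simp
  ultimately have "b w w = 0" by (intro orthogonal_span[of w "e ` I"]) auto
  hence "w = 0" using inner_product_pos[OF b, of w] by fastforce
  thus ?thesis by (simp add: w_def)
qed

lemma orthonormal_parseval:
  assumes e: "orthonormal_on b I e" and I: "finite I" and v: "v \<in> span (e ` I)"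
  shows "b v w = (\<Sum>i\<in>I. b v (e i) * b w (e i))"
proof -
  have l: "linear (\<lambda>u. b u w)" using inner_product_bilinear[OF b] by (simp add: bilinear_def)
  have "b (\<Sum>i\<in>I. b v (e i) *\<^sub>R e i) w = (\<Sum>i\<in>I. b v (e i) * b (e i) w)"
    using linear_sum[OF l, of "\<lambda>i. b v (e i) *\<^sub>R e i" I] linear_scale[OF l] by simp
  thus ?thesis using orthonormal_expand[OF e I v] by (simp add: inner_product_sym[OF b, of w])
qed

text \<open>Expanding one argument in the other basis, exchanging the sums and collapsing the
  expansion in the second argument relates the two traces. Vector values are allowed because the
  mean curvature is such a trace.\<close>

lemma trace_independent:
  fixes \<beta> :: "'e \<Rightarrow> 'e \<Rightarrow> 'z::real_vector"
  assumes e: "orthonormal_on b I e" "finite I" and e': "orthonormal_on b I' e'" "finite I'"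
    and span: "span (e ` I) = span (e' ` I')" and \<beta>: "bilinear \<beta>"
  shows "(\<Sum>i\<in>I. \<beta> (e i) (e i)) = (\<Sum>i\<in>I'. \<beta> (e' i) (e' i))"
proof -
  have l: "linear (\<lambda>u. \<beta> u v)" "linear (\<beta> u)" for u v using \<beta> by (simp_all add: bilinear_def)
  have "\<beta> (e i) (e i) = (\<Sum>a\<in>I'. b (e i) (e' a) *\<^sub>R \<beta> (e' a) (e i))" if "i \<in> I" for i
  proof -
    have "e i \<in> span (e' ` I')" using that span by (metis image_eqI span_base)
    hence "\<beta> (e i) (e i) = \<beta> (\<Sum>a\<in>I'. b (e i) (e' a) *\<^sub>R e' a) (e i)" using orthonormal_expand[OF e'] by metis
    thus ?thesis using linear_sum[OF l(1)[of "e i"], of "\<lambda>a. b (e i) (e' a) *\<^sub>R e' a" I'] linear_scale[OF l(1)] by simp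
  qed
  hence "(\<Sum>i\<in>I. \<beta> (e i) (e i)) = (\<Sum>i\<in>I. \<Sum>a\<in>I'. b (e i) (e' a) *\<^sub>R \<beta> (e' a) (e i))" by simp
  also have "\<dots> = (\<Sum>a\<in>I'. \<Sum>i\<in>I. b (e' a) (e i) *\<^sub>R \<beta> (e' a) (e i))"
    by (subst sum.swap) (simp add: inner_product_sym[OF b])
  also have "\<dots> = (\<Sum>a\<in>I'. \<beta> (e' a) (e' a))"
  proof (rule sum.cong[OF refl])
    fix a assume "a \<in> I'"
    hence "e' a \<in> span (e ` I)" using span by (metis image_eqI span_base)
    hence "\<beta> (e' a) (e' a) = \<beta> (e' a) (\<Sum>i\<in>I. b (e' a) (e i) *\<^sub>R e i)" using orthonormal_expand[OF e] by metis
    thus "(\<Sum>i\<in>I. b (e' a) (e i) *\<^sub>R \<beta> (e' a) (e i)) = \<beta> (e' a) (e' a)"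
      using linear_sum[OF l(2)[of "e' a"], of "\<lambda>i. b (e' a) (e i) *\<^sub>R e i" I] linear_scale[OF l(2)] by simp
  qed
  finally show ?thesis .
qed

lemma exists_orthogonal_unit:
  assumes e: "orthonormal_on b I e" and I: "finite I" and L: "subspace L" "e ` I \<subseteq> L" "card I < dim L"
  shows "\<exists>u\<in>L. b u u = 1 \<and> (\<forall>i\<in>I. b u (e i) = 0)"
proof -
  have "span (e ` I) \<noteq> L" using orthonormal_dim_span[OF e] L by auto
  then obtain v where v: "v \<in> L" "v \<notin> span (e ` I)" using span_minimal[OF L(2,1)] by blast
  define p where "p = (\<Sum>i\<in>I. b v (e i) *\<^sub>R e i)"
  have p: "p \<in> span (e ` I)" unfolding p_def by (intro span_sum span_scale span_base) simp
  have bp: "b (v - p) (e j) = 0" if "j \<in> I" for j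
    using orthonormal_coeff[OF e I that] by (simp add: p_def bilinear_lsub[OF inner_product_bilinear[OF b]])
  have "v - p \<noteq> 0" using v p by auto
  hence pos: "b (v - p) (v - p) > 0" by (rule inner_product_pos[OF b])
  define u where "u = (1 / sqrt (b (v - p) (v - p))) *\<^sub>R (v - p)"
  have "p \<in> L" using p span_minimal[OF L(2,1)] by blast
  hence "u \<in> L" unfolding u_def by (intro subspace_scale subspace_diff L v)
  moreover have "b u u = 1"
    unfolding u_def using pos by (simp add: bilinear_lmul[OF inner_product_bilinear[OF b]] bilinear_rmul[OF inner_product_bilinear[OF b]])
  moreover have "b u (e i) = 0" if "i \<in> I" for i
    unfolding u_def using bp[OF that] by (simp add: bilinear_lmul[OF inner_product_bilinear[OF b]])
  ultimately show ?thesis by blast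
qed

text \<open>Gram-Schmidt, by induction on the missing dimension. The case \<open>m = 0\<close> gives
  existence of bases; the general case completes an adapted family.\<close>

lemma orthonormal_extend:
  assumes L: "subspace L"
  shows "orthonormal_on b {1..m} e \<Longrightarrow> e ` {1..m} \<subseteq> L \<Longrightarrow> m \<le> dim L \<Longrightarrow>
    \<exists>e'. orthonormal_basis b L e' \<and> (\<forall>i\<in>{1..m}. e' i = e i)"
proof (induction "dim L - m" arbitrary: m e)
  case 0
  hence "m = dim L" by simp
  moreover have "span (e ` {1..m}) = L"
    by (rule orthonormal_span_eq) (use 0 L \<open>m = dim L\<close> in auto)
  ultimately show ?case using 0 unfolding orthonormal_basis_iff by blast
next
  case (Suc d)
  have "card {1..m} < dim L" using Suc.hyps(2) by simp
  then obtain u where u: "u \<in> L" "b u u = 1" "\<forall>i\<in>{1..m}. b u (e i) = 0"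
    using exists_orthogonal_unit[OF Suc.prems(1) _ L Suc.prems(2)] by blast
  define e1 where "e1 = e(Suc m := u)"
  have "orthonormal_on b {1..Suc m} e1"
  proof -
    have "b (e i) u = 0" if "i \<in> {1..m}" for i using u(3) inner_product_sym[OF b, of "e i" u] that by simp
    moreover have "{1..Suc m} = insert (Suc m) {1..m}" by auto
    ultimately show ?thesis
      using Suc.prems(1) u unfolding orthonormal_on_def e1_def by auto
  qed
  moreover have "e1 ` {1..Suc m} \<subseteq> L" using Suc.prems(2) u by (auto simp: e1_def le_Suc_eq)
  moreover have "d = dim L - Suc m" "Suc m \<le> dim L" using Suc.hyps(2) by simp_all
  ultimately obtain e' where "orthonormal_basis b L e'" "\<forall>i\<in>{1..Suc m}. e' i = e1 i"
    using Suc.hyps(1) by blast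
  moreover have "\<forall>i\<in>{1..m}. e1 i = e i" by (auto simp: e1_def)
  ultimately show ?case by (intro exI[of _ e']) auto
qed

lemma orthonormal_basis_exists: "subspace L \<Longrightarrow> \<exists>e. orthonormal_basis b L e"
  using orthonormal_extend[of L 0] by (auto simp: orthonormal_on_def)

text \<open>Orthonormal bases of the subspaces are concatenated. The middle conjunct is the
  invariant from which orthogonality to the next subspace follows.\<close>

lemma adapted_family_exists:
  assumes L: "L \<in> orthogonal_tuples b k ns"
  shows "K \<le> k \<Longrightarrow> \<exists>e. orthonormal_on b {1..\<Sum>j\<in>{1..K}. ns j} e \<and>
    (\<forall>A\<in>{1..\<Sum>j\<in>{1..K}. ns j}. \<exists>i\<in>{1..K}. e A \<in> L i) \<and>
    (\<forall>i\<in>{1..K}. \<forall>A\<in>{(\<Sum>j\<in>{1..<i}. ns j) + 1..\<Sum>j\<in>{1..i}. ns j}. e A \<in> L i)"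
proof (induction K)
  case 0 show ?case by (simp add: orthonormal_on_def)
next
  case (Suc K)
  let ?s = "\<Sum>j\<in>{1..K}. ns j"
  obtain e where e: "orthonormal_on b {1..?s} e" "\<forall>A\<in>{1..?s}. \<exists>i\<in>{1..K}. e A \<in> L i"
    "\<forall>i\<in>{1..K}. \<forall>A\<in>{(\<Sum>j\<in>{1..<i}. ns j) + 1..\<Sum>j\<in>{1..i}. ns j}. e A \<in> L i"
    using Suc by auto
  have LK: "subspace (L (Suc K))" "dim (L (Suc K)) = ns (Suc K)"
    using L Suc.prems unfolding orthogonal_tuples_def by auto
  have orth: "b u v = 0" if "i \<in> {1..K}" "u \<in> L i" "v \<in> L (Suc K)" for i u v
  proof -
    have "i \<in> {1..k}" "Suc K \<in> {1..k}" "i \<noteq> Suc K" using that Suc.prems by auto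
    thus ?thesis using L that unfolding orthogonal_tuples_def by blast
  qed
  obtain c where c: "orthonormal_on b {1..ns (Suc K)} c" "span (c ` {1..ns (Suc K)}) = L (Suc K)"
    using orthonormal_basis_exists[OF LK(1)] unfolding orthonormal_basis_iff LK(2) by blast
  have cL: "c a \<in> L (Suc K)" if "a \<in> {1..ns (Suc K)}" for a
    unfolding c(2)[symmetric] by (rule span_base) (rule imageI[OF that])
  define e' where "e' = (\<lambda>A. if A \<le> ?s then e A else c (A - ?s))"
  have S: "(\<Sum>j\<in>{1..Suc K}. ns j) = ?s + ns (Suc K)" by simp
  have new: "e' A \<in> L (Suc K)" if "A \<in> {?s + 1..?s + ns (Suc K)}" for A
  proof -
    have "A - ?s \<in> {1..ns (Suc K)}" "\<not> A \<le> ?s" using that by auto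
    thus ?thesis using cL by (simp add: e'_def)
  qed
  have on: "orthonormal_on b {1..?s + ns (Suc K)} e'"
    unfolding orthonormal_on_def
  proof (intro ballI)
    fix A B assume AB: "A \<in> {1..?s + ns (Suc K)}" "B \<in> {1..?s + ns (Suc K)}"
    have 1: "b (e' A) (e' B) = 0" if "A \<le> ?s" "\<not> B \<le> ?s" "A \<in> {1..?s + ns (Suc K)}" "B \<in> {1..?s + ns (Suc K)}" for A B
    proof -
      obtain i where "i \<in> {1..K}" "e A \<in> L i" using e(2) \<open>A \<le> ?s\<close> \<open>A \<in> _\<close> by (meson atLeastAtMost_iff)
      thus ?thesis using orth[of i "e A" "e' B"] new[of B] that by (simp add: e'_def)
    qed
    consider "A \<le> ?s" "B \<le> ?s" | "A \<le> ?s" "\<not> B \<le> ?s" | "\<not> A \<le> ?s" "B \<le> ?s" | "\<not> A \<le> ?s" "\<not> B \<le> ?s" by blast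
    thus "b (e' A) (e' B) = (if A = B then 1 else 0)"
    proof cases
      case 1 thus ?thesis using orthonormal_onD[OF e(1), of A B] AB by (simp add: e'_def)
    next
      case 2 thus ?thesis using 1[of A B] AB by auto
    next
      case 3 thus ?thesis using 1[of B A] AB inner_product_sym[OF b, of "e' A" "e' B"] by auto
    next
      case 4
      hence "A - ?s \<in> {1..ns (Suc K)}" "B - ?s \<in> {1..ns (Suc K)}" using AB by auto
      from orthonormal_onD[OF c(1) this] show ?thesis using 4 by (auto simp: e'_def)
    qed
  qed
  have mem: "\<exists>i\<in>{1..Suc K}. e' A \<in> L i" if "A \<in> {1..?s + ns (Suc K)}" for A
  proof (cases "A \<le> ?s")
    case True
    then obtain i where "i \<in> {1..K}" "e A \<in> L i" using e(2) \<open>A \<in> _\<close> by (meson atLeastAtMost_iff)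
    thus ?thesis using True by (intro bexI[of _ i]) (auto simp: e'_def)
  next
    case False thus ?thesis using new[of A] that by (intro bexI[of _ "Suc K"]) auto
  qed
  have blk: "e' A \<in> L i" if "i \<in> {1..Suc K}" "A \<in> {(\<Sum>j\<in>{1..<i}. ns j) + 1..\<Sum>j\<in>{1..i}. ns j}" for i A
  proof (cases "i = Suc K")
    case True
    have "{1..<Suc K} = {1..K}" by auto
    thus ?thesis using that new[of A] True by simp
  next
    case False
    hence i: "i \<in> {1..K}" using that by auto
    have "(\<Sum>j\<in>{1..i}. ns j) \<le> ?s" by (rule sum_mono2) (use i in auto)
    thus ?thesis using e(3) i that by (simp add: e'_def)
  qed
  show ?case unfolding S by (intro exI[of _ e'] conjI ballI on mem blk)
qed

lemma adapted_basis_exists: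
  assumes L: "L \<in> orthogonal_tuples b k ns" and s: "(\<Sum>j\<in>{1..k}. ns j) \<le> DIM('e)"
  shows "\<exists>e. orthonormal_basis b UNIV e \<and> (\<forall>i\<in>{1..k}. \<forall>A\<in>block DIM('e) k ns i. e A \<in> L i)"
proof -
  obtain e where e: "orthonormal_on b {1..\<Sum>j\<in>{1..k}. ns j} e"
    "\<forall>i\<in>{1..k}. \<forall>A\<in>{(\<Sum>j\<in>{1..<i}. ns j) + 1..\<Sum>j\<in>{1..i}. ns j}. e A \<in> L i"
    using adapted_family_exists[OF L order_refl] by blast
  obtain e' where e': "orthonormal_basis b UNIV e'" "\<forall>i\<in>{1..\<Sum>j\<in>{1..k}. ns j}. e' i = e i"
    using orthonormal_extend[OF subspace_UNIV e(1)] s by auto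
  have "e' A \<in> L i" if i: "i \<in> {1..k}" and A: "A \<in> block DIM('e) k ns i" for i A
  proof -
    have "(\<Sum>j\<in>{1..i}. ns j) \<le> (\<Sum>j\<in>{1..k}. ns j)" by (rule sum_mono2) (use i in auto)
    thus ?thesis using e(2) e'(2) i A by (auto simp: block_def)
  qed
  thus ?thesis using e' by blast
qed

end

section \<open>Scalar curvature of a subspace as a double sum\<close>

lemma sum_pairs:
  fixes F :: "nat \<Rightarrow> nat \<Rightarrow> real"
  assumes "\<And>i j. i \<in> {1..m} \<Longrightarrow> j \<in> {1..m} \<Longrightarrow> F i j = F j i" "\<And>i. i \<in> {1..m} \<Longrightarrow> F i i = 0"
  shows "(\<Sum>j\<in>{1..m}. \<Sum>i\<in>{1..<j}. F i j) = (\<Sum>i\<in>{1..m}. \<Sum>j\<in>{1..m}. F i j) / 2"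
  using assms
proof (induction m)
  case (Suc m)
  have "(\<Sum>i\<in>{1..m}. F i (Suc m)) = (\<Sum>j\<in>{1..m}. F (Suc m) j)"
    by (rule sum.cong) (use Suc.prems(1) in auto)
  moreover have "{1..<Suc m} = {1..m}" by auto
  moreover have "(\<Sum>j\<in>{1..m}. \<Sum>i\<in>{1..<j}. F i j) = (\<Sum>i\<in>{1..m}. \<Sum>j\<in>{1..m}. F i j) / 2"
    by (rule Suc.IH) (use Suc.prems in auto)
  ultimately show ?case using Suc.prems(2)[of "Suc m"] by (simp add: sum.distrib)
qed simp

context metric_domain
begin

lemma sec_curv_orthonormal:
  assumes "g x u u = 1" "g x v v = 1" "g x u v = 0"
  shows "sec_curv g x u v = g x (rm x u v v) u"
  using assms by (simp add: sec_curv_def rm_def)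

lemma rm_pair_sym: "x \<in> U \<Longrightarrow> g x (rm x u v v) u = g x (rm x v u u) v"
  using rm_skew[of x u v v u] rm_antisym[of x u v u] by (simp add: g_simps)

lemma rm_self: "x \<in> U \<Longrightarrow> rm x u u w = 0"
  by (simp add: rm_eq)

text \<open>With one vector fixed, the summand is the diagonal of a bilinear form in the other, so
  the chosen basis can be exchanged one slot at a time.\<close>

lemma tau_orthonormal:
  assumes x: "x \<in> U" and e: "orthonormal_on (g x) I e" "finite I" and L: "span (e ` I) = L"
  shows "tau g x L = (\<Sum>i\<in>I. \<Sum>j\<in>I. g x (rm x (e i) (e j) (e j)) (e i)) / 2"
proof -
  note ip = inner_product_g[OF x]
  have "subspace L" using L subspace_span by blast
  define c where "c = (SOME e. orthonormal_basis (g x) L e)"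
  have "orthonormal_basis (g x) L c"
    unfolding c_def using someI_ex[OF orthonormal_basis_exists[OF ip \<open>subspace L\<close>]] .
  hence c: "orthonormal_on (g x) {1..dim L} c" "span (c ` {1..dim L}) = L"
    by (simp_all add: orthonormal_basis_iff)
  let ?F = "\<lambda>u v. g x (rm x u v v) u"
  have tr1: "bilinear (\<lambda>u u'. g x (rm x u v v) u')" for v
  proof -
    have "linear (\<lambda>u. g x (rm x u v v) u')" for u'
    proof -
      have "linear (\<lambda>w. g x w u')" using g_bilinear[OF x] by (simp add: bilinear_def)
      from linear_compose[OF rm_linear1[OF x, of v v] this] show ?thesis by (simp add: comp_def)
    qed
    moreover have "linear (\<lambda>u'. g x (rm x u v v) u')" for u using g_bilinear[OF x] by (simp add: bilinear_def)
    ultimately show ?thesis unfolding bilinear_def by blast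
  qed
  have tr: "(\<Sum>i\<in>I. ?F (e i) v) = (\<Sum>a\<in>{1..dim L}. ?F (c a) v)" for v
    using trace_independent[OF ip e c(1) _ _ tr1[of v]] L c(2) by simp
  have tr': "(\<Sum>i\<in>I. ?F v (e i)) = (\<Sum>a\<in>{1..dim L}. ?F v (c a))" for v
  proof -
    have "(\<Sum>i\<in>I. ?F v (e i)) = (\<Sum>i\<in>I. ?F (e i) v)"
      "(\<Sum>a\<in>{1..dim L}. ?F v (c a)) = (\<Sum>a\<in>{1..dim L}. ?F (c a) v)"
      by (rule sum.cong[OF refl rm_pair_sym[OF x]])+
    thus ?thesis using tr[of v] by simp
  qed
  have "tau g x L = (\<Sum>j\<in>{1..dim L}. \<Sum>i\<in>{1..<j}. sec_curv g x (c i) (c j))"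
    by (simp add: tau_def c_def Let_def)
  also have "\<dots> = (\<Sum>j\<in>{1..dim L}. \<Sum>i\<in>{1..<j}. ?F (c i) (c j))"
    by (intro sum.cong refl sec_curv_orthonormal) (use orthonormal_onD[OF c(1)] in auto)
  also have "\<dots> = (\<Sum>i\<in>{1..dim L}. \<Sum>j\<in>{1..dim L}. ?F (c i) (c j)) / 2"
    by (rule sum_pairs[OF rm_pair_sym[OF x]]) (simp add: rm_self x g_simps)
  also have "(\<Sum>i\<in>{1..dim L}. \<Sum>j\<in>{1..dim L}. ?F (c i) (c j)) = (\<Sum>i\<in>{1..dim L}. \<Sum>j\<in>I. ?F (c i) (e j))"
    unfolding tr' ..
  also have "\<dots> = (\<Sum>j\<in>I. \<Sum>i\<in>{1..dim L}. ?F (c i) (e j))" by (rule sum.swap)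
  also have "\<dots> = (\<Sum>j\<in>I. \<Sum>i\<in>I. ?F (e i) (e j))" unfolding tr ..
  also have "\<dots> = (\<Sum>i\<in>I. \<Sum>j\<in>I. ?F (e i) (e j))" by (rule sum.swap)
  finally show ?thesis .
qed

end

section \<open>The algebraic inequality\<close>

locale index_partition =
  fixes I :: "'i set" and K :: "'k set" and D :: "'k \<Rightarrow> 'i set"
  assumes finite_I: "finite I" and finite_K: "finite K"
    and D_sub: "\<And>i. i \<in> K \<Longrightarrow> D i \<subseteq> I"
    and D_disjoint: "\<And>i j. i \<in> K \<Longrightarrow> j \<in> K \<Longrightarrow> i \<noteq> j \<Longrightarrow> D i \<inter> D j = {}"
begin

definition E :: "'i set" where "E = I - (\<Union>i\<in>K. D i)"
definition N :: "'k \<Rightarrow> real" where "N i = real (card (D i))"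
text \<open>An index of \<open>E\<close> is separated even from itself. These diagonal pairs produce
  the squares over \<open>E\<close> in \<open>bracket\<close>.\<close>

definition separated :: "'i \<Rightarrow> 'i \<Rightarrow> bool" where "separated A B \<longleftrightarrow> \<not> (\<exists>i\<in>K. A \<in> D i \<and> B \<in> D i)"
text \<open>
  The Cauchy-Schwarz constant of the problem, equal to \<open>(a + 2) / 3\<close>. A block contributes the
  supremum of \<open>(sum x (D i))\<^sup>2 / block_form i x\<close>, an index of \<open>E\<close> contributes \<open>1 / 3\<close>, and
  the distinguished index \<open>r\<close> of \<open>bracket_rest\<close> contributes \<open>1 = 1 / 3 + 2 / 3\<close>.
\<close>

definition weight :: real where "weight = (\<Sum>i\<in>K. N i / (N i + 2)) + 2 / 3 + real (card E) / 3"

definition block_form :: "'k \<Rightarrow> ('i \<Rightarrow> real) \<Rightarrow> real" where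
  "block_form i x = (sum x (D i))\<^sup>2 + 2 * (\<Sum>A\<in>D i. (x A)\<^sup>2)"

text \<open>
  With \<open>x\<^sub>A = T A A C\<close>, the terms of twice the curvature sum that involve only the numbers
  \<open>x\<^sub>A\<close> are \<open>(\<Sum>x\<^sub>A)\<^sup>2 - bracket C x\<close>.
\<close>

definition bracket :: "'i \<Rightarrow> ('i \<Rightarrow> real) \<Rightarrow> real" where
  "bracket C x = (\<Sum>i\<in>K. (sum x (D i))\<^sup>2) + (\<Sum>A\<in>E. (x A)\<^sup>2) + 2 * (\<Sum>A\<in>I. if A \<noteq> C \<and> separated A C then (x A)\<^sup>2 else 0)"

lemma finite_D: "i \<in> K \<Longrightarrow> finite (D i)"
  using D_sub finite_I finite_subset by blast

lemma finite_E: "finite E"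
  by (simp add: E_def finite_I)

lemma N_nonneg: "N i \<ge> 0"
  by (simp add: N_def)

lemma sum_partition:
  fixes h :: "'i \<Rightarrow> 'z::comm_monoid_add"
  shows "sum h I = (\<Sum>i\<in>K. sum h (D i)) + sum h E"
proof -
  have "sum h I = sum h (\<Union>i\<in>K. D i) + sum h E"
    unfolding E_def using D_sub by (subst sum.subset_diff[of "\<Union>i\<in>K. D i" I]) (auto simp: finite_I add.commute)
  also have "sum h (\<Union>i\<in>K. D i) = (\<Sum>i\<in>K. sum h (D i))"
    by (rule sum.UNION_disjoint) (use finite_K finite_D D_disjoint in auto)
  finally show ?thesis .
qed

lemma weight_pos: "weight > 0"
proof -
  have "(\<Sum>i\<in>K. N i / (N i + 2)) \<ge> 0" by (intro sum_nonneg) (use N_nonneg in simp)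
  thus ?thesis by (simp add: weight_def)
qed

lemma block_form_nonneg: "block_form i x \<ge> 0"
  unfolding block_form_def by (intro add_nonneg_nonneg mult_nonneg_nonneg sum_nonneg) auto

lemma block_form_zero:
  assumes "i \<in> K" "block_form i x = 0" "A \<in> D i" shows "x A = 0"
proof -
  have "(\<Sum>A\<in>D i. (x A)\<^sup>2) \<ge> 0" by (intro sum_nonneg) simp
  hence "(\<Sum>A\<in>D i. (x A)\<^sup>2) = 0"
    using assms(2) zero_le_power2[of "sum x (D i)"] unfolding block_form_def by linarith
  thus ?thesis using assms sum_nonneg_eq_0_iff[OF finite_D[OF assms(1)], of "\<lambda>A. (x A)\<^sup>2"] by auto
qed

text \<open>The minimum of \<open>block_form i x - 2 * l * sum x (D i)\<close> is attained at the
  constant vector \<open>l / (N i + 2)\<close>. This is the origin of the block summands of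
  \<open>weight\<close> and of the factor \<open>ns i + 2\<close> in the theorem.\<close>

lemma block_form_shift:
  fixes x :: "'i \<Rightarrow> real"
  shows "block_form i x - 2 * l * sum x (D i) + l\<^sup>2 * (N i / (N i + 2)) = block_form i (\<lambda>A. x A - l / (N i + 2))"
proof -
  define q where "q = l / (N i + 2)"
  have l: "l = q * (N i + 2)" using N_nonneg[of i] by (simp add: q_def)
  have l2: "l\<^sup>2 * (N i / (N i + 2)) = q\<^sup>2 * N i * (N i + 2)"
    unfolding l using N_nonneg[of i] by (simp add: power2_eq_square)
  have 1: "sum (\<lambda>A. x A - q) (D i) = sum x (D i) - N i * q" by (simp add: sum_subtractf N_def)
  have "(\<Sum>A\<in>D i. (x A - q)\<^sup>2) = (\<Sum>A\<in>D i. (x A)\<^sup>2 - 2 * q * x A + q\<^sup>2)"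
    by (simp add: power2_diff algebra_simps)
  also have "\<dots> = (\<Sum>A\<in>D i. (x A)\<^sup>2) - 2 * q * sum x (D i) + N i * q\<^sup>2"
    by (simp add: sum.distrib sum_subtractf sum_distrib_left N_def)
  finally have 2: "(\<Sum>A\<in>D i. (x A - q)\<^sup>2) = (\<Sum>A\<in>D i. (x A)\<^sup>2) - 2 * q * sum x (D i) + N i * q\<^sup>2" .
  show ?thesis unfolding block_form_def q_def[symmetric] 1 2 l2 unfolding l
    by (simp add: power2_eq_square algebra_simps)
qed

text \<open>The analogue for indices outside the blocks; the minimiser \<open>l / 3\<close> accounts
  for the ratio 3 in the equality case.\<close>

lemma square_shift_sum:
  fixes x :: "'i \<Rightarrow> real"
  shows "3 * (\<Sum>A\<in>X. (x A)\<^sup>2) - 2 * l * sum x X + l\<^sup>2 * (real (card X) / 3) = 3 * (\<Sum>A\<in>X. (x A - l / 3)\<^sup>2)"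
proof -
  have "(\<Sum>A\<in>X. (x A - l / 3)\<^sup>2) = (\<Sum>A\<in>X. (x A)\<^sup>2 - 2 * l / 3 * x A + l\<^sup>2 / 9)"
    by (simp add: power2_eq_square algebra_simps)
  also have "\<dots> = (\<Sum>A\<in>X. (x A)\<^sup>2) - 2 * l / 3 * sum x X + real (card X) * l\<^sup>2 / 9"
    by (simp add: sum.distrib sum_subtractf sum_distrib_left)
  finally show ?thesis by simp
qed

text \<open>Every index is separated from \<open>r\<close>, so each \<open>x A\<close> except
  \<open>x r\<close> receives two further squares: they complete \<open>block_form\<close> on the
  blocks and give the coefficient 3 on the rest of \<open>E\<close>.\<close>

lemma bracket_rest:
  assumes r: "r \<in> E"
  shows "bracket r x = (\<Sum>i\<in>K. block_form i x) + (x r)\<^sup>2 + 3 * (\<Sum>A\<in>E - {r}. (x A)\<^sup>2)"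
proof -
  have s: "separated A r" for A using r by (auto simp: separated_def E_def)
  have nD: "r \<notin> D i" if "i \<in> K" for i using r that by (auto simp: E_def)
  let ?h = "\<lambda>A. if A \<noteq> r \<and> separated A r then (x A)\<^sup>2 else 0"
  have "sum ?h (D i) = (\<Sum>A\<in>D i. (x A)\<^sup>2)" if "i \<in> K" for i
    by (rule sum.cong) (use s nD[OF that] in auto)
  moreover have "sum ?h E = (\<Sum>A\<in>E - {r}. (x A)\<^sup>2)"
    using s by (simp add: sum.remove[OF finite_E r])
  moreover have "(\<Sum>A\<in>E. (x A)\<^sup>2) = (x r)\<^sup>2 + (\<Sum>A\<in>E - {r}. (x A)\<^sup>2)"
    by (rule sum.remove[OF finite_E r])
  ultimately show ?thesis
    unfolding bracket_def sum_partition[of ?h] block_form_def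
    by (simp add: sum.distrib flip: sum_distrib_left)
qed

text \<open>No index in the block of \<open>C\<close> is separated from \<open>C\<close>, so this
  block keeps only the square of its sum.\<close>

lemma bracket_block:
  assumes i: "i \<in> K" and C: "C \<in> D i"
  shows "bracket C x = (sum x (D i))\<^sup>2 + (\<Sum>j\<in>K - {i}. block_form j x) + 3 * (\<Sum>A\<in>E. (x A)\<^sup>2)"
proof -
  let ?h = "\<lambda>A. if A \<noteq> C \<and> separated A C then (x A)\<^sup>2 else 0"
  have "sum ?h (D i) = 0" by (rule sum.neutral) (use i C in \<open>auto simp: separated_def\<close>)
  moreover have "sum ?h (D j) = (\<Sum>A\<in>D j. (x A)\<^sup>2)" if "j \<in> K - {i}" for j
  proof (rule sum.cong[OF refl])
    fix A assume A: "A \<in> D j"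
    have "A \<notin> D i" using D_disjoint[of i j] A that i by auto
    moreover have "C \<notin> D l" if "l \<in> K" "l \<noteq> i" for l using D_disjoint[of i l] C that i by auto
    ultimately show "?h A = (x A)\<^sup>2" using C by (auto simp: separated_def)
  qed
  moreover have "sum ?h E = (\<Sum>A\<in>E. (x A)\<^sup>2)"
    by (rule sum.cong[OF refl]) (use C i in \<open>auto simp: separated_def E_def\<close>)
  ultimately show ?thesis
    unfolding bracket_def sum_partition[of ?h] block_form_def sum.remove[OF finite_K i]
    by (simp add: sum.distrib flip: sum_distrib_left)
qed

text \<open>
  With \<open>l = (\<Sum>x\<^sub>A) / weight\<close>, completing squares in \<open>bracket C x - 2 l \<Sum>x\<^sub>A + l\<^sup>2 weight\<close>
  yields both the Cauchy-Schwarz inequality and its equality case.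
\<close>

lemma bracket_rest_ge:
  assumes r: "r \<in> E"
  shows "(sum x I)\<^sup>2 / weight \<le> bracket r x"
    and "bracket r x = (sum x I)\<^sup>2 / weight \<Longrightarrow> s \<in> E \<Longrightarrow> s \<noteq> r \<Longrightarrow> x r = 3 * x s"
    and "bracket r x = (sum x I)\<^sup>2 / weight \<Longrightarrow> i \<in> K \<Longrightarrow> A \<in> D i \<Longrightarrow> x r = (N i + 2) * x A"
proof -
  define l where "l = sum x I / weight"
  have lS: "l * sum x I = (sum x I)\<^sup>2 / weight" "l\<^sup>2 * weight = (sum x I)\<^sup>2 / weight"
    using weight_pos by (simp_all add: l_def power2_eq_square)
  let ?d = "\<lambda>i A. x A - l / (N i + 2)"
  have S: "sum x I = (\<Sum>i\<in>K. sum x (D i)) + (x r + sum x (E - {r}))"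
    unfolding sum_partition[of x] sum.remove[OF finite_E r, of x] by simp
  \<comment> \<open>As \<open>r\<close> belongs to \<open>E\<close>, its 1/3 can be merged with the
    2/3 in \<open>weight\<close> into the constant 1 of the term
    \<open>(x r)\<^sup>2\<close>.\<close>
  have "card E > 0" using r finite_E card_gt_0_iff by blast
  hence w: "weight = (\<Sum>i\<in>K. N i / (N i + 2)) + 1 + real (card (E - {r})) / 3"
    using r finite_E by (simp add: weight_def card_Diff_singleton of_nat_diff field_simps)
  have e: "bracket r x - 2 * (l * sum x I) + l\<^sup>2 * weight =
    (\<Sum>i\<in>K. block_form i (?d i)) + (x r - l)\<^sup>2 + 3 * (\<Sum>A\<in>E - {r}. (x A - l / 3)\<^sup>2)"
    unfolding block_form_shift[symmetric] square_shift_sum[symmetric] bracket_rest[OF r] S w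
    by (simp add: sum.distrib sum_subtractf sum_distrib_left sum_distrib_right power2_diff algebra_simps)
  have n: "(\<Sum>i\<in>K. block_form i (?d i)) \<ge> 0" "(\<Sum>A\<in>E - {r}. (x A - l / 3)\<^sup>2) \<ge> 0"
    by (intro sum_nonneg block_form_nonneg; simp)+
  show "(sum x I)\<^sup>2 / weight \<le> bracket r x"
    using e n zero_le_power2[of "x r - l"] unfolding lS by linarith
  assume eq: "bracket r x = (sum x I)\<^sup>2 / weight"
  have z: "(\<Sum>i\<in>K. block_form i (?d i)) = 0" "(x r - l)\<^sup>2 = 0" "(\<Sum>A\<in>E - {r}. (x A - l / 3)\<^sup>2) = 0"
    using e n zero_le_power2[of "x r - l"] unfolding lS eq by linarith+
  have xr: "x r = l" using z(2) by simp
  show "x r = 3 * x s" if "s \<in> E" "s \<noteq> r"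
  proof -
    have "\<forall>A\<in>E - {r}. (x A - l / 3)\<^sup>2 = 0"
      using z(3) sum_nonneg_eq_0_iff[of "E - {r}" "\<lambda>A. (x A - l / 3)\<^sup>2"] finite_E by simp
    hence "(x s - l / 3)\<^sup>2 = 0" using that by blast
    thus ?thesis using xr by simp
  qed
  show "x r = (N i + 2) * x A" if "i \<in> K" "A \<in> D i"
  proof -
    have "block_form i (?d i) = 0"
      using z(1) sum_nonneg_eq_0_iff[OF finite_K, of "\<lambda>i. block_form i (?d i)"] block_form_nonneg that by auto
    from block_form_zero[OF that(1) this that(2)] have "x A = l / (N i + 2)" by simp
    thus ?thesis using xr N_nonneg[of i] by simp
  qed
qed

lemma bracket_block_ge:
  assumes i: "i \<in> K" and C: "C \<in> D i" and c2: "card (D i) \<ge> 2"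
  shows "(sum x I)\<^sup>2 / weight \<le> bracket C x"
    and "bracket C x = (sum x I)\<^sup>2 / weight \<Longrightarrow> s \<in> E \<Longrightarrow> x s = 0"
    and "bracket C x = (sum x I)\<^sup>2 / weight \<Longrightarrow> j \<in> K \<Longrightarrow> j \<noteq> i \<Longrightarrow> A \<in> D j \<Longrightarrow> x A = 0"
    and "bracket C x = (sum x I)\<^sup>2 / weight \<Longrightarrow> sum x (D i) = 0"
proof -
  define l where "l = sum x I / weight"
  have lS: "l * sum x I = (sum x I)\<^sup>2 / weight" "l\<^sup>2 * weight = (sum x I)\<^sup>2 / weight"
    using weight_pos by (simp_all add: l_def power2_eq_square)
  let ?d = "\<lambda>i A. x A - l / (N i + 2)"
  have S: "sum x I = sum x (D i) + (\<Sum>j\<in>K - {i}. sum x (D j)) + sum x E"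
    unfolding sum_partition[of x] sum.remove[OF finite_K i] by simp
  \<comment> \<open>A block of size at least 2 makes the constant strictly too large, which forces \<open>l = 0\<close> in the equality case.\<close>
  define gap where "gap = N i / (N i + 2) - 1 / 3"
  have gap: "gap > 0" unfolding gap_def N_def using c2 by (simp add: field_simps)
  \<comment> \<open>Here the optimal constant is the right side without \<open>gap\<close>, the
    block \<open>i\<close> contributing 1; the excess of \<open>weight\<close> is
    \<open>N i / (N i + 2) + 2 / 3 - 1\<close>.\<close>
  have w: "weight = (\<Sum>j\<in>K - {i}. N j / (N j + 2)) + 1 + real (card E) / 3 + gap"
    unfolding weight_def gap_def sum.remove[OF finite_K i] by simp
  have e: "bracket C x - 2 * (l * sum x I) + l\<^sup>2 * weight =
    (\<Sum>j\<in>K - {i}. block_form j (?d j)) + (sum x (D i) - l)\<^sup>2 + 3 * (\<Sum>A\<in>E. (x A - l / 3)\<^sup>2) + l\<^sup>2 * gap"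
    unfolding block_form_shift[symmetric] square_shift_sum[symmetric] bracket_block[OF i C] S w
    by (simp add: sum.distrib sum_subtractf sum_distrib_left sum_distrib_right power2_diff algebra_simps)
  have n: "(\<Sum>j\<in>K - {i}. block_form j (?d j)) \<ge> 0" "(\<Sum>A\<in>E. (x A - l / 3)\<^sup>2) \<ge> 0" "l\<^sup>2 * gap \<ge> 0"
    using gap by (auto intro: sum_nonneg block_form_nonneg)
  show "(sum x I)\<^sup>2 / weight \<le> bracket C x"
    using e n zero_le_power2[of "sum x (D i) - l"] unfolding lS by linarith
  assume eq: "bracket C x = (sum x I)\<^sup>2 / weight"
  have z: "(\<Sum>j\<in>K - {i}. block_form j (?d j)) = 0" "(sum x (D i) - l)\<^sup>2 = 0"
    "(\<Sum>A\<in>E. (x A - l / 3)\<^sup>2) = 0" "l\<^sup>2 * gap = 0"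
    using e n zero_le_power2[of "sum x (D i) - l"] unfolding lS eq by linarith+
  have l0: "l = 0" using z(4) gap by simp
  show "sum x (D i) = 0" using z(2) l0 by simp
  show "x s = 0" if "s \<in> E"
    using z(3) sum_nonneg_eq_0_iff[of E "\<lambda>A. (x A - l / 3)\<^sup>2"] finite_E that l0 by simp
  show "x A = 0" if "j \<in> K" "j \<noteq> i" "A \<in> D j"
  proof -
    have "block_form j (?d j) = 0"
      using z(1) sum_nonneg_eq_0_iff[of "K - {i}" "\<lambda>j. block_form j (?d j)"] finite_K block_form_nonneg that by auto
    from block_form_zero[OF that(1) this that(3)] show ?thesis using l0 by simp
  qed
qed

lemma sum_separated:
  fixes G :: "'i \<Rightarrow> 'i \<Rightarrow> real"
  shows "(\<Sum>A\<in>I. \<Sum>B\<in>I. G A B) - (\<Sum>i\<in>K. \<Sum>A\<in>D i. \<Sum>B\<in>D i. G A B)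
    = (\<Sum>A\<in>I. \<Sum>B\<in>I. if separated A B then G A B else 0)"
proof -
  have "(\<Sum>A\<in>I. \<Sum>B\<in>I. if separated A B then 0 else G A B) = (\<Sum>i\<in>K. \<Sum>A\<in>D i. \<Sum>B\<in>D i. G A B)"
  proof -
    have "(\<Sum>B\<in>I. if separated A B then 0 else G A B) = (\<Sum>B\<in>D i. G A B)" if "i \<in> K" "A \<in> D i" for i A
    proof -
      have "separated A B \<longleftrightarrow> B \<notin> D i" for B
        using that D_disjoint[OF that(1)] unfolding separated_def by (metis disjoint_iff)
      hence "(\<Sum>B\<in>I. if separated A B then 0 else G A B) = (\<Sum>B\<in>I. if B \<in> D i then G A B else 0)"
        by (intro sum.cong) auto
      also have "\<dots> = (\<Sum>B\<in>I \<inter> D i. G A B)" by (simp add: sum.inter_restrict[OF finite_I])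
      also have "I \<inter> D i = D i" using D_sub[OF that(1)] by blast
      finally show ?thesis .
    qed
    moreover have "(\<Sum>B\<in>I. if separated A B then 0 else G A B) = 0" if "A \<in> E" for A
      by (rule sum.neutral) (use that in \<open>auto simp: separated_def E_def\<close>)
    ultimately show ?thesis unfolding sum_partition[of "\<lambda>A. \<Sum>B\<in>I. if separated A B then 0 else G A B"] by simp
  qed
  moreover have "(\<Sum>A\<in>I. \<Sum>B\<in>I. G A B) = (\<Sum>A\<in>I. \<Sum>B\<in>I. if separated A B then G A B else 0)
      + (\<Sum>A\<in>I. \<Sum>B\<in>I. if separated A B then 0 else G A B)"
    unfolding sum.distrib[symmetric] by (intro sum.cong) auto
  ultimately show ?thesis by simp
qed

lemma separated_sym: "separated A B \<longleftrightarrow> separated B A"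
  by (auto simp: separated_def)

end

section \<open>Decomposition of the curvature sum\<close>

locale cubic_form_partition = index_partition I K D for I :: "'i set" and K :: "'k set" and D +
  fixes T :: "'i \<Rightarrow> 'i \<Rightarrow> 'i \<Rightarrow> real"
  assumes T_sym12: "\<And>A B C. A \<in> I \<Longrightarrow> B \<in> I \<Longrightarrow> C \<in> I \<Longrightarrow> T A B C = T B A C"
    and T_sym23: "\<And>A B C. A \<in> I \<Longrightarrow> B \<in> I \<Longrightarrow> C \<in> I \<Longrightarrow> T A B C = T A C B"
    and card_D: "\<And>i. i \<in> K \<Longrightarrow> card (D i) \<ge> 2"
begin

definition curv :: "'i \<Rightarrow> 'i \<Rightarrow> real" where
  "curv A B = (\<Sum>C\<in>I. T A A C * T B B C - (T A B C)\<^sup>2)"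

definition mixed :: real where
  "mixed = (\<Sum>A\<in>I. \<Sum>B\<in>I. \<Sum>C\<in>I. if A \<noteq> B \<and> B \<noteq> C \<and> A \<noteq> C \<and> separated A B then (T A B C)\<^sup>2 else 0)"

abbreviation diag :: "'i \<Rightarrow> 'i \<Rightarrow> real" where "diag C A \<equiv> T A A C"

text \<open>The terms are sorted by coincidences of indices: \<open>A = B\<close>, \<open>C\<close>
  equal to exactly one of \<open>A\<close>, \<open>B\<close>, or all different. In the second case
  symmetry gives \<open>T A B A = T A A B\<close> and \<open>T A B B = T B B A\<close>, whence the
  factor 2.\<close>

lemma sum_separated_squares:
  "(\<Sum>A\<in>I. \<Sum>B\<in>I. if separated A B then \<Sum>C\<in>I. (T A B C)\<^sup>2 else 0)
    = (\<Sum>C\<in>I. (\<Sum>A\<in>E. (T A A C)\<^sup>2) + 2 * (\<Sum>A\<in>I. if A \<noteq> C \<and> separated A C then (T A A C)\<^sup>2 else 0)) + mixed"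
proof -
  let ?d = "\<lambda>A B. if A = B \<and> separated A A then \<Sum>C\<in>I. (T A A C)\<^sup>2 else 0"
  let ?a = "\<lambda>A B. if A \<noteq> B \<and> separated A B then (T A A B)\<^sup>2 else 0"
  let ?m = "\<lambda>A B. \<Sum>C\<in>I. if A \<noteq> B \<and> B \<noteq> C \<and> A \<noteq> C \<and> separated A B then (T A B C)\<^sup>2 else 0"
  have p: "(if separated A B then \<Sum>C\<in>I. (T A B C)\<^sup>2 else 0) = ?d A B + (?a A B + ?a B A) + ?m A B"
    if A: "A \<in> I" and B: "B \<in> I" for A B
  proof (cases "A = B \<or> \<not> separated A B")
    case True thus ?thesis using separated_sym[of A B] by auto
  next
    case False
    have "(\<Sum>C\<in>I. (T A B C)\<^sup>2) = (\<Sum>C\<in>I. (if C = A then (T A B A)\<^sup>2 else 0) + (if C = B then (T A B B)\<^sup>2 else 0)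
        + (if B \<noteq> C \<and> A \<noteq> C then (T A B C)\<^sup>2 else 0))"
      by (rule sum.cong) (use False in auto)
    also have "\<dots> = (T A B A)\<^sup>2 + (T A B B)\<^sup>2 + (\<Sum>C\<in>I. if B \<noteq> C \<and> A \<noteq> C then (T A B C)\<^sup>2 else 0)"
      using A B finite_I by (simp add: sum.distrib)
    also have "T A B A = T A A B" using T_sym23 A B by simp
    also have "T A B B = T B B A" using T_sym12 T_sym23 A B by metis
    finally show ?thesis using False separated_sym[of A B] by auto
  qed
  have "(\<Sum>A\<in>I. \<Sum>B\<in>I. if separated A B then \<Sum>C\<in>I. (T A B C)\<^sup>2 else 0)
      = (\<Sum>A\<in>I. \<Sum>B\<in>I. ?d A B) + ((\<Sum>A\<in>I. \<Sum>B\<in>I. ?a A B) + (\<Sum>A\<in>I. \<Sum>B\<in>I. ?a B A)) + mixed"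
    unfolding mixed_def sum.distrib[symmetric] by (intro sum.cong refl p)
  also have "(\<Sum>A\<in>I. \<Sum>B\<in>I. ?a B A) = (\<Sum>A\<in>I. \<Sum>B\<in>I. ?a A B)" by (rule sum.swap)
  also have "(\<Sum>A\<in>I. \<Sum>B\<in>I. ?a A B) = (\<Sum>C\<in>I. \<Sum>A\<in>I. if A \<noteq> C \<and> separated A C then (T A A C)\<^sup>2 else 0)"
    by (rule sum.swap)
  also have "(\<Sum>A\<in>I. \<Sum>B\<in>I. ?d A B) = (\<Sum>A\<in>E. \<Sum>C\<in>I. (T A A C)\<^sup>2)"
  proof -
    have "(\<Sum>B\<in>I. ?d A B) = (if A \<in> E then \<Sum>C\<in>I. (T A A C)\<^sup>2 else 0)" if "A \<in> I" for A
    proof -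
      have "separated A A \<longleftrightarrow> A \<in> E" using that by (auto simp: separated_def E_def)
      hence "(\<Sum>B\<in>I. ?d A B) = (\<Sum>B\<in>I. if B = A then (if A \<in> E then \<Sum>C\<in>I. (T A A C)\<^sup>2 else 0) else 0)"
        by (intro sum.cong) auto
      thus ?thesis using that finite_I by simp
    qed
    hence "(\<Sum>A\<in>I. \<Sum>B\<in>I. ?d A B) = (\<Sum>A\<in>I. if A \<in> E then \<Sum>C\<in>I. (T A A C)\<^sup>2 else 0)" by simp
    also have "\<dots> = (\<Sum>A\<in>I \<inter> E. \<Sum>C\<in>I. (T A A C)\<^sup>2)" by (simp add: sum.inter_restrict[OF finite_I])
    also have "I \<inter> E = E" by (auto simp: E_def)
    finally show ?thesis .
  qed
  also have "(\<Sum>A\<in>E. \<Sum>C\<in>I. (T A A C)\<^sup>2) = (\<Sum>C\<in>I. \<Sum>A\<in>E. (T A A C)\<^sup>2)" by (rule sum.swap)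
  finally show ?thesis by (simp add: sum.distrib sum_distrib_left)
qed

lemma curv_decomposition:
  "(\<Sum>A\<in>I. \<Sum>B\<in>I. curv A B) - (\<Sum>i\<in>K. \<Sum>A\<in>D i. \<Sum>B\<in>D i. curv A B)
    = (\<Sum>C\<in>I. (sum (diag C) I)\<^sup>2 - bracket C (diag C)) - mixed"
proof -
  have prod: "(\<Sum>A\<in>X. \<Sum>B\<in>X. \<Sum>C\<in>I. T A A C * T B B C) = (\<Sum>C\<in>I. (sum (diag C) X)\<^sup>2)" for X
  proof -
    have "(\<Sum>A\<in>X. \<Sum>B\<in>X. \<Sum>C\<in>I. T A A C * T B B C) = (\<Sum>A\<in>X. \<Sum>C\<in>I. \<Sum>B\<in>X. T A A C * T B B C)"
      by (intro sum.cong refl sum.swap)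
    also have "\<dots> = (\<Sum>C\<in>I. \<Sum>A\<in>X. \<Sum>B\<in>X. T A A C * T B B C)" by (rule sum.swap)
    finally show ?thesis by (simp add: power2_eq_square sum_product)
  qed
  have c: "(\<Sum>A\<in>X. \<Sum>B\<in>X. curv A B) = (\<Sum>C\<in>I. (sum (diag C) X)\<^sup>2) - (\<Sum>A\<in>X. \<Sum>B\<in>X. \<Sum>C\<in>I. (T A B C)\<^sup>2)" for X
    unfolding curv_def sum_subtractf prod[symmetric] ..
  have "(\<Sum>i\<in>K. \<Sum>C\<in>I. (sum (diag C) (D i))\<^sup>2) = (\<Sum>C\<in>I. \<Sum>i\<in>K. (sum (diag C) (D i))\<^sup>2)" by (rule sum.swap)
  thus ?thesis
    using sum_separated[of "\<lambda>A B. \<Sum>C\<in>I. (T A B C)\<^sup>2"] sum_separated_squares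
    unfolding c bracket_def by (simp add: sum_subtractf sum.distrib)
qed

lemma I_cases: "C \<in> I \<Longrightarrow> C \<in> E \<or> (\<exists>i\<in>K. C \<in> D i)"
  by (auto simp: E_def)

lemma bracket_ge: "C \<in> I \<Longrightarrow> (sum x I)\<^sup>2 / weight \<le> bracket C x"
  using I_cases bracket_rest_ge(1) bracket_block_ge(1) card_D by metis

lemma mixed_nonneg: "mixed \<ge> 0"
  unfolding mixed_def by (intro sum_nonneg) simp

text \<open>An exact identity with two nonnegative remainders: it yields the inequality, and in the
  equality case both remainders vanish.\<close>

lemma curv_gap:
  "(1 - 1 / weight) * (\<Sum>C\<in>I. (sum (diag C) I)\<^sup>2)
    - ((\<Sum>A\<in>I. \<Sum>B\<in>I. curv A B) - (\<Sum>i\<in>K. \<Sum>A\<in>D i. \<Sum>B\<in>D i. curv A B))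
   = (\<Sum>C\<in>I. bracket C (diag C) - (sum (diag C) I)\<^sup>2 / weight) + mixed"
  unfolding curv_decomposition by (simp add: sum_subtractf sum_divide_distrib algebra_simps)

lemma brackets_nonneg: "(\<Sum>C\<in>I. bracket C (diag C) - (sum (diag C) I)\<^sup>2 / weight) \<ge> 0"
  by (intro sum_nonneg) (use bracket_ge in simp)

theorem curv_le:
  "(\<Sum>A\<in>I. \<Sum>B\<in>I. curv A B) - (\<Sum>i\<in>K. \<Sum>A\<in>D i. \<Sum>B\<in>D i. curv A B)
    \<le> (1 - 1 / weight) * (\<Sum>C\<in>I. (sum (diag C) I)\<^sup>2)"
  using curv_gap brackets_nonneg mixed_nonneg by linarith

theorem curv_eq:
  assumes "(\<Sum>A\<in>I. \<Sum>B\<in>I. curv A B) - (\<Sum>i\<in>K. \<Sum>A\<in>D i. \<Sum>B\<in>D i. curv A B)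
    = (1 - 1 / weight) * (\<Sum>C\<in>I. (sum (diag C) I)\<^sup>2)"
  shows curv_eq_mixed: "A \<in> I \<Longrightarrow> B \<in> I \<Longrightarrow> C \<in> I \<Longrightarrow> A \<noteq> B \<Longrightarrow> B \<noteq> C \<Longrightarrow> A \<noteq> C \<Longrightarrow>
      \<not> (\<exists>i\<in>K. {A, B, C} \<subseteq> D i) \<Longrightarrow> T A B C = 0"
    and curv_eq_bracket: "C \<in> I \<Longrightarrow> bracket C (diag C) = (sum (diag C) I)\<^sup>2 / weight"
proof -
  have z: "(\<Sum>C\<in>I. bracket C (diag C) - (sum (diag C) I)\<^sup>2 / weight) = 0" "mixed = 0"
    using curv_gap brackets_nonneg mixed_nonneg assms by linarith+
  show "bracket C (diag C) = (sum (diag C) I)\<^sup>2 / weight" if "C \<in> I"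
    using z(1) that sum_nonneg_eq_0_iff[OF finite_I, of "\<lambda>C. bracket C (diag C) - (sum (diag C) I)\<^sup>2 / weight"]
      bracket_ge by simp
  let ?m = "\<lambda>A B C. if A \<noteq> B \<and> B \<noteq> C \<and> A \<noteq> C \<and> separated A B then (T A B C)\<^sup>2 else 0"
  have sep: "T A B C = 0" if "A \<in> I" "B \<in> I" "C \<in> I" "A \<noteq> B" "B \<noteq> C" "A \<noteq> C" "separated A B" for A B C
  proof -
    have "(\<Sum>B\<in>I. \<Sum>C\<in>I. ?m A B C) = 0"
      using z(2) sum_nonneg_eq_0_iff[OF finite_I, of "\<lambda>A. \<Sum>B\<in>I. \<Sum>C\<in>I. ?m A B C"] that(1)
      unfolding mixed_def by (simp add: sum_nonneg)
    hence "(\<Sum>C\<in>I. ?m A B C) = 0"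
      using sum_nonneg_eq_0_iff[OF finite_I, of "\<lambda>B. \<Sum>C\<in>I. ?m A B C"] that(2) by (simp add: sum_nonneg)
    hence "?m A B C = 0" using sum_nonneg_eq_0_iff[OF finite_I, of "\<lambda>C. ?m A B C"] that(3) by simp
    thus ?thesis using that by simp
  qed
  assume *: "A \<in> I" "B \<in> I" "C \<in> I" "A \<noteq> B" "B \<noteq> C" "A \<noteq> C" "\<not> (\<exists>i\<in>K. {A, B, C} \<subseteq> D i)"
  show "T A B C = 0"
  proof (cases "separated A B")
    case True thus ?thesis using sep * by simp
  next
    case False
    then obtain i where i: "i \<in> K" "A \<in> D i" "B \<in> D i" by (auto simp: separated_def)
    \<comment> \<open>\<open>mixed\<close> sees only triples whose first two indices are separated.
      If \<open>A\<close> and \<open>B\<close> share a block, then \<open>C\<close> lies outside it,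
      and the symmetry of \<open>T\<close> moves \<open>C\<close> into second position.\<close>
    hence "separated A C" using * D_disjoint[OF i(1)] unfolding separated_def by blast
    thus ?thesis using sep[of A C B] T_sym23 * by simp
  qed
qed

end

section \<open>The inequality at a point\<close>

lemma sum_upto_mono:
  fixes ns :: "nat \<Rightarrow> nat"
  shows "i \<le> k \<Longrightarrow> (\<Sum>j\<in>{1..i}. ns j) \<le> (\<Sum>j\<in>{1..k}. ns j)"
  by (rule sum_mono2) auto

lemma sum_block_end:
  fixes ns :: "nat \<Rightarrow> nat"
  shows "1 \<le> i \<Longrightarrow> (\<Sum>j\<in>{1..i}. ns j) = (\<Sum>j\<in>{1..<i}. ns j) + ns i"
  by (cases i) (simp_all add: atLeastLessThanSuc_atLeastAtMost)

lemma sum_upto_less_mono: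
  fixes ns :: "nat \<Rightarrow> nat"
  shows "i < k \<Longrightarrow> (\<Sum>j\<in>{1..i}. ns j) \<le> (\<Sum>j\<in>{1..<k}. ns j)"
  by (rule sum_mono2) auto

lemma card_block: "i \<in> {1..k} \<Longrightarrow> card (block n k ns i) = ns i"
  using sum_block_end[of i ns] by (simp add: block_def)

lemma block_subset: "(\<Sum>j\<in>{1..k}. ns j) \<le> n \<Longrightarrow> i \<in> {1..k} \<Longrightarrow> block n k ns i \<subseteq> {1..n}"
  using sum_upto_mono[of i k ns] by (auto simp: block_def)

lemma block_disjoint_less: "j \<le> k \<Longrightarrow> 1 \<le> i \<Longrightarrow> i < j \<Longrightarrow> block n k ns i \<inter> block n k ns j = {}"
  using sum_upto_less_mono[of i j ns] by (auto simp: block_def)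

lemma block_disjoint: "i \<in> {1..k} \<Longrightarrow> j \<in> {1..k} \<Longrightarrow> i \<noteq> j \<Longrightarrow> block n k ns i \<inter> block n k ns j = {}"
  using block_disjoint_less[of i k j n ns] block_disjoint_less[of j k i n ns] by (cases i j rule: linorder_cases) auto

lemma in_some_block:
  fixes ns :: "nat \<Rightarrow> nat"
  shows "A \<in> {1..\<Sum>j\<in>{1..k}. ns j} \<Longrightarrow> \<exists>i\<in>{1..k}. A \<in> {(\<Sum>j\<in>{1..<i}. ns j) + 1..\<Sum>j\<in>{1..i}. ns j}"
proof (induction k)
  case (Suc k)
  show ?case
  proof (cases "A \<le> (\<Sum>j\<in>{1..k}. ns j)")
    case True
    then obtain i where "i \<in> {1..k}" "A \<in> {(\<Sum>j\<in>{1..<i}. ns j) + 1..\<Sum>j\<in>{1..i}. ns j}" using Suc by auto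
    thus ?thesis by (intro bexI[of _ i]) auto
  next
    case False
    thus ?thesis using Suc.prems by (intro bexI[of _ "Suc k"]) (auto simp: atLeastLessThanSuc_atLeastAtMost)
  qed
qed simp

lemma block_rest:
  assumes "(\<Sum>j\<in>{1..k}. ns j) \<le> n"
  shows "{1..n} - (\<Union>i\<in>{1..k}. block n k ns i) = block n k ns (k + 1)"
proof -
  have r: "block n k ns (k + 1) = {(\<Sum>j\<in>{1..k}. ns j) + 1..n}"
    by (simp add: block_def atLeastLessThanSuc_atLeastAtMost)
  have "A \<notin> block n k ns i" if "A > (\<Sum>j\<in>{1..k}. ns j)" "i \<in> {1..k}" for A i
    using sum_upto_mono[of i k ns] that by (auto simp: block_def)
  moreover have "\<exists>i\<in>{1..k}. A \<in> block n k ns i" if "A \<in> {1..n}" "A \<le> (\<Sum>j\<in>{1..k}. ns j)" for A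
  proof -
    have "A \<in> {1..\<Sum>j\<in>{1..k}. ns j}" using that by simp
    then obtain i where "i \<in> {1..k}" "A \<in> {(\<Sum>j\<in>{1..<i}. ns j) + 1..\<Sum>j\<in>{1..i}. ns j}"
      using in_some_block[of A ns k] by blast
    thus ?thesis by (intro bexI[of _ i]) (auto simp: block_def)
  qed
  ultimately show ?thesis unfolding r by (auto simp: not_le) (metis atLeastAtMost_iff not_less_eq_eq One_nat_def)+
qed

text \<open>A lower bound passes to the real infimum only over a nonempty set; the spans of the
  blocks of any orthonormal basis form a tuple.\<close>

lemma orthogonal_tuples_nonempty:
  fixes b :: "'e::euclidean_space \<Rightarrow> 'e \<Rightarrow> real"
  assumes b: "inner_product b" and s: "(\<Sum>j\<in>{1..k}. ns j) \<le> DIM('e)"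
  shows "orthogonal_tuples b k ns \<noteq> {}"
proof -
  let ?D = "block DIM('e) k ns"
  obtain e where "orthonormal_basis b UNIV e" using orthonormal_basis_exists[OF b subspace_UNIV] by blast
  hence e: "orthonormal_on b {1..DIM('e)} e" by (simp add: orthonormal_basis_iff)
  define L where "L = (\<lambda>i. span (e ` ?D i))"
  have "dim (L i) = ns i" if "i \<in> {1..k}" for i
    unfolding L_def using orthonormal_dim_span[OF b orthonormal_on_subset[OF e block_subset[OF s that]]] card_block[OF that] by simp
  moreover have "b u v = 0" if ij: "i \<in> {1..k}" "j \<in> {1..k}" "i \<noteq> j" and uv: "u \<in> L i" "v \<in> L j" for i j u v
  proof -
    have 1: "b (e A) (e B) = 0" if "A \<in> ?D i" "B \<in> ?D j" for A B
    proof -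
      have "A \<in> {1..DIM('e)}" "B \<in> {1..DIM('e)}" "A \<noteq> B"
        using that block_subset[OF s ij(1)] block_subset[OF s ij(2)] block_disjoint[OF ij] by blast+
      thus ?thesis using orthonormal_onD[OF e] by simp
    qed
    have "b w (e A) = 0" if "w \<in> L j" "A \<in> ?D i" for w A
      using orthogonal_span[OF b that(1)[unfolded L_def], of "e A"] 1[OF that(2)] inner_product_sym[OF b, of w "e A"] by auto
    hence "b v u = 0" using orthogonal_span[OF b uv(1)[unfolded L_def], of v] uv(2) by auto
    thus ?thesis using inner_product_sym[OF b] by simp
  qed
  moreover have "subspace (L i)" for i by (simp add: L_def)
  ultimately have "L \<in> orthogonal_tuples b k ns" unfolding orthogonal_tuples_def by blast
  thus ?thesis by blast
qed

section \<open>Curvature and mean curvature in an orthonormal frame\<close>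

context immersed_domain
begin

lemma sff_bilinear:
  assumes x: "x \<in> U"
  shows "bilinear (sff x)"
proof -
  have "linear (\<lambda>u. sff x u v)" for v
  proof -
    note D = linear_frechet_derivative[OF differentiable_df[OF x, of v]]
    show ?thesis
      unfolding sff_eq cov_deriv_along_def
      by (rule linearI) (simp_all add: linear_add[OF D] linear_scale[OF D] linear_add[OF df_linear[OF x]] linear_scale[OF df_linear[OF x]]
        amb.\<Gamma>_simps[OF f_in[OF x]] dom.\<Gamma>_simps[OF x] algebra_simps)
  qed
  moreover have "sff x u = (\<lambda>v. sff x v u)" for u using sff_sym[OF x] by blast
  ultimately show ?thesis unfolding bilinear_def by metis
qed

lemma mean_curvature_orthonormal:
  assumes x: "x \<in> U" and e: "orthonormal_on (g x) I e" "finite I" and span: "span (e ` I) = UNIV"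
  shows "mean_curvature g g' f x = (1 / real DIM('e)) *\<^sub>R (\<Sum>A\<in>I. sff x (e A) (e A))"
proof -
  note ip = dom.inner_product_g[OF x]
  define c where "c = (SOME e. orthonormal_basis (g x) UNIV e)"
  have "orthonormal_basis (g x) UNIV c"
    unfolding c_def using someI_ex[OF orthonormal_basis_exists[OF ip subspace_UNIV]] .
  hence c: "orthonormal_on (g x) {1..DIM('e)} c" "span (c ` {1..DIM('e)}) = UNIV"
    by (simp_all add: orthonormal_basis_iff)
  have "(\<Sum>A\<in>{1..DIM('e)}. sff x (c A) (c A)) = (\<Sum>A\<in>I. sff x (e A) (e A))"
    by (rule trace_independent[OF ip c(1) _ e _ sff_bilinear[OF x]]) (simp, simp only: c(2) span)
  thus ?thesis by (simp add: mean_curvature_def Let_def c_def)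
qed

end

context lagrangian_domain
begin

text \<open>\<open>J\<close> carries normal vectors isometrically to tangent ones, so Parseval's
  identity transfers from the tangent space; the signs from moving \<open>J\<close> across cancel in
  the products.\<close>

lemma normal_parseval:
  assumes x: "x \<in> U" and e: "orthonormal_on (g x) I e" "finite I" and span: "span (e ` I) = UNIV"
    and \<xi>: "\<And>v. g' (f x) \<xi> (df x v) = 0" and \<eta>: "\<And>v. g' (f x) \<eta> (df x v) = 0"
  shows "g' (f x) \<xi> \<eta> = (\<Sum>C\<in>I. g' (f x) \<xi> (J (df x (e C))) * g' (f x) \<eta> (J (df x (e C))))"
proof -
  obtain u v where u: "J \<xi> = df x u" and v: "J \<eta> = df x v"
    using lagrangian_normal[OF x \<xi>] lagrangian_normal[OF x \<eta>] by blast
  have c: "g x w (e C) = - g' (f x) \<zeta> (J (df x (e C)))" if "J \<zeta> = df x w" for w \<zeta> C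
    unfolding isometric[OF x] that[symmetric] by (rule J_adjoint[OF f_in[OF x]])
  have "g' (f x) \<xi> \<eta> = g x u v"
    unfolding isometric[OF x] u[symmetric] v[symmetric] by (rule amb.hermitian[OF f_in[OF x], symmetric])
  also have "\<dots> = (\<Sum>C\<in>I. g x u (e C) * g x v (e C))"
    by (rule orthonormal_parseval[OF dom.inner_product_g[OF x] e]) (simp add: span)
  finally show ?thesis unfolding c[OF u] c[OF v] by simp
qed

text \<open>Includes the case \<open>A = B\<close>, where both sides are 0, so that sums may run
  over all ordered pairs.\<close>

lemma curvature_cubic:
  assumes x: "x \<in> U" and e: "orthonormal_on (g x) I e" "finite I" and span: "span (e ` I) = UNIV"
    and AB: "A \<in> I" "B \<in> I"
  shows "g x (dom.rm x (e A) (e B) (e B)) (e A) = (if A = B then 0 else \<kappa> / 4)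
    + (\<Sum>C\<in>I. cubic x (e A) (e A) (e C) * cubic x (e B) (e B) (e C) - (cubic x (e A) (e B) (e C))\<^sup>2)"
proof (cases "A = B")
  case True thus ?thesis by (simp add: dom.rm_self x dom.g_simps power2_eq_square)
next
  case False
  have o: "g x (e A) (e A) = 1" "g x (e B) (e B) = 1" "g x (e A) (e B) = 0"
    using orthonormal_onD[OF e(1)] AB False by simp_all
  show ?thesis
    unfolding lagrangian_gauss[OF x o] normal_parseval[OF x e span sff_normal[OF x] sff_normal[OF x]] cubic_def[symmetric]
    using False by (simp add: sum_subtractf power2_eq_square)
qed

lemma norm_mean_curvature:
  assumes x: "x \<in> U" and e: "orthonormal_on (g x) I e" "finite I" and span: "span (e ` I) = UNIV"
    and H: "H = mean_curvature g g' f x"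
  shows "(real DIM('e))\<^sup>2 * g' (f x) H H = (\<Sum>C\<in>I. (\<Sum>A\<in>I. cubic x (e A) (e A) (e C))\<^sup>2)"
proof -
  let ?n = "real DIM('e)" and ?S = "\<Sum>A\<in>I. sff x (e A) (e A)"
  have l: "linear (\<lambda>\<xi>. g' (f x) \<xi> v)" for v using amb.g_bilinear[OF f_in[OF x]] by (simp add: bilinear_def)
  have "g' (f x) ?S (df x v) = 0" for v
    using linear_sum[OF l, of "\<lambda>A. sff x (e A) (e A)" I] by (simp add: sff_normal x)
  hence "g' (f x) ?S ?S = (\<Sum>C\<in>I. (g' (f x) ?S (J (df x (e C))))\<^sup>2)"
    using normal_parseval[OF x e span, of ?S ?S] by (simp add: power2_eq_square)
  also have "\<dots> = (\<Sum>C\<in>I. (\<Sum>A\<in>I. cubic x (e A) (e A) (e C))\<^sup>2)"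
    using linear_sum[OF l, of "\<lambda>A. sff x (e A) (e A)" I] by (simp add: cubic_def)
  moreover have "?n\<^sup>2 * g' (f x) H H = g' (f x) ?S ?S"
    unfolding H mean_curvature_orthonormal[OF x e span]
    by (simp add: bilinear_lmul[OF amb.g_bilinear] bilinear_rmul[OF amb.g_bilinear] f_in x power2_eq_square)
  ultimately show ?thesis by simp
qed

end

lemma sum_off_diagonal:
  "finite X \<Longrightarrow> (\<Sum>A\<in>X. \<Sum>B\<in>X. if A = B then 0 else c) = real (card X) * (real (card X) - 1) * (c::real)"
proof -
  assume X: "finite X"
  have "(\<Sum>B\<in>X. if A = B then 0 else c) = (real (card X) - 1) * c" if "A \<in> X" for A
  proof -
    have "(\<Sum>B\<in>X. if A = B then 0 else c) = (\<Sum>B\<in>X. c - (if A = B then c else 0))" by (rule sum.cong) auto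
    thus ?thesis using X that by (simp add: sum_subtractf algebra_simps)
  qed
  thus ?thesis by simp
qed

section \<open>The inequality and its equality case at a point\<close>

locale chen_data = lagrangian_domain U g V g' f J \<kappa>
  for U :: "'e::euclidean_space set" and g and V :: "'f::euclidean_space set" and g' f J \<kappa> +
  fixes x :: 'e and n k :: nat and ns :: "nat \<Rightarrow> nat" and H :: 'f and a bound :: real
  assumes x: "x \<in> U" and n: "n = DIM('e)"
    and ns_ge: "\<And>i. i \<in> {1..k} \<Longrightarrow> 2 \<le> ns i"
    and ns_sum: "(\<Sum>i\<in>{1..k}. ns i) \<le> n"
    and H: "H = mean_curvature g g' f x"
    and a: "a = real n - (\<Sum>i\<in>{1..k}. real (ns i)) + 3 * real k - 6 * (\<Sum>i\<in>{1..k}. 1 / (2 + real (ns i)))"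
    and bound: "bound = (real n)\<^sup>2 * (a - 1) / (2 * (a + 2)) * g' (f x) H H
       + 1 / 2 * (real n * (real n - 1) - (\<Sum>i\<in>{1..k}. real (ns i) * (real (ns i) - 1))) * (\<kappa> / 4)"
begin

abbreviation "blk \<equiv> block n k ns"

definition adapted :: "(nat \<Rightarrow> 'e set) \<Rightarrow> (nat \<Rightarrow> 'e) \<Rightarrow> bool" where
  "adapted L e \<longleftrightarrow> L \<in> orthogonal_tuples (g x) k ns \<and> orthonormal_basis (g x) UNIV e \<and> (\<forall>i\<in>{1..k}. \<forall>A\<in>blk i. e A \<in> L i)"

lemma cubic_form_partition_adapted:
  assumes "adapted L e"
  shows "cubic_form_partition {1..n} {1..k} blk (\<lambda>A B C. cubic x (e A) (e B) (e C))"
  by unfold_locales (use ns_ge block_subset[OF ns_sum] block_disjoint card_block cubic_sym12[OF x] cubic_sym23[OF x] in auto)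

text \<open>Uses \<open>N / (N + 2) = 1 - 2 / (N + 2)\<close> and counts \<open>E\<close> as
  \<open>n\<close> minus the sizes of the blocks; this produces the \<open>3 * k\<close> and the sum
  with factor 6 in \<open>a\<close>.\<close>

lemma weight_eq:
  assumes "adapted L e"
  shows "index_partition.weight {1..n} {1..k} blk = (a + 2) / 3"
proof -
  interpret cubic_form_partition "{1..n}" "{1..k}" blk "\<lambda>A B C. cubic x (e A) (e B) (e C)"
    by (rule cubic_form_partition_adapted[OF assms])
  have N: "N i = real (ns i)" if "i \<in> {1..k}" for i using card_block[OF that] by (simp add: N_def)
  have "real n = (\<Sum>i\<in>{1..k}. N i) + real (card E)"
    using sum_partition[of "\<lambda>_. 1 :: real"] by (simp add: N_def)
  moreover have "(\<Sum>i\<in>{1..k}. N i / (N i + 2)) = real k - 2 * (\<Sum>i\<in>{1..k}. 1 / (2 + real (ns i)))"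
  proof -
    have "(\<Sum>i\<in>{1..k}. N i / (N i + 2)) = (\<Sum>i\<in>{1..k}. 1 - 2 * (1 / (2 + real (ns i))))"
      by (rule sum.cong) (auto simp: N field_simps)
    thus ?thesis unfolding sum_subtractf sum_distrib_left by simp
  qed
  moreover have "(\<Sum>i\<in>{1..k}. N i) = (\<Sum>i\<in>{1..k}. real (ns i))" using N by simp
  ultimately show ?thesis unfolding weight_def a by simp
qed

lemma tau_gap:
  assumes ad: "adapted L e"
  defines "c \<equiv> cubic_form_partition.curv {1..n} (\<lambda>A B C. cubic x (e A) (e B) (e C))"
  shows "tau g x UNIV - (\<Sum>i\<in>{1..k}. tau g x (L i)) =
     ((\<Sum>A\<in>{1..n}. \<Sum>B\<in>{1..n}. c A B) - (\<Sum>i\<in>{1..k}. \<Sum>A\<in>blk i. \<Sum>B\<in>blk i. c A B)) / 2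
     + 1 / 2 * (real n * (real n - 1) - (\<Sum>i\<in>{1..k}. real (ns i) * (real (ns i) - 1))) * (\<kappa> / 4)"
proof -
  interpret cubic_form_partition "{1..n}" "{1..k}" blk "\<lambda>A B C. cubic x (e A) (e B) (e C)"
    by (rule cubic_form_partition_adapted[OF ad])
  have e: "orthonormal_on (g x) {1..n} e" "span (e ` {1..n}) = UNIV"
    using ad unfolding adapted_def orthonormal_basis_iff dim_UNIV n[symmetric] by blast+
  have K: "g x (dom.rm x (e A) (e B) (e B)) (e A) = (if A = B then 0 else \<kappa> / 4) + c A B"
    if "A \<in> {1..n}" "B \<in> {1..n}" for A B
    unfolding c_def curv_def by (rule curvature_cubic[OF x e(1) _ e(2) that]) simp
  have tau: "tau g x S = (real (card X) * (real (card X) - 1) * (\<kappa> / 4) + (\<Sum>A\<in>X. \<Sum>B\<in>X. c A B)) / 2"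
    if X: "X \<subseteq> {1..n}" and S: "span (e ` X) = S" for X S
  proof -
    have fin: "finite X" using X finite_subset by blast
    have "tau g x S = (\<Sum>A\<in>X. \<Sum>B\<in>X. g x (dom.rm x (e A) (e B) (e B)) (e A)) / 2"
      by (rule dom.tau_orthonormal[OF x orthonormal_on_subset[OF e(1) X] fin S])
    also have "(\<Sum>A\<in>X. \<Sum>B\<in>X. g x (dom.rm x (e A) (e B) (e B)) (e A)) = (\<Sum>A\<in>X. \<Sum>B\<in>X. (if A = B then 0 else \<kappa> / 4) + c A B)"
      by (intro sum.cong refl K) (use X in auto)
    also have "\<dots> = real (card X) * (real (card X) - 1) * (\<kappa> / 4) + (\<Sum>A\<in>X. \<Sum>B\<in>X. c A B)"
      unfolding sum.distrib sum_off_diagonal[OF fin] ..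
    finally show ?thesis .
  qed
  have "tau g x (L i) = (real (ns i) * (real (ns i) - 1) * (\<kappa> / 4) + (\<Sum>A\<in>blk i. \<Sum>B\<in>blk i. c A B)) / 2"
    if i: "i \<in> {1..k}" for i
  proof -
    have "span (e ` blk i) = L i"
      by (rule orthonormal_span_eq[OF dom.inner_product_g[OF x] orthonormal_on_subset[OF e(1) D_sub[OF i]]])
        (use ad i card_block[OF i] in \<open>auto simp: adapted_def orthogonal_tuples_def\<close>)
    from tau[OF D_sub[OF i] this] show ?thesis unfolding card_block[OF i] .
  qed
  hence "(\<Sum>i\<in>{1..k}. tau g x (L i)) = ((\<Sum>i\<in>{1..k}. real (ns i) * (real (ns i) - 1)) * (\<kappa> / 4)
      + (\<Sum>i\<in>{1..k}. \<Sum>A\<in>blk i. \<Sum>B\<in>blk i. c A B)) / 2"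
    by (simp add: sum.distrib sum_distrib_right flip: sum_divide_distrib)
  moreover have "tau g x UNIV = (real n * (real n - 1) * (\<kappa> / 4) + (\<Sum>A\<in>{1..n}. \<Sum>B\<in>{1..n}. c A B)) / 2"
    using tau[OF order_refl e(2)] by simp
  ultimately show ?thesis by (simp add: field_simps)
qed

lemma bound_eq:
  assumes ad: "adapted L e"
  shows "bound = (1 - 1 / index_partition.weight {1..n} {1..k} blk) * (\<Sum>C\<in>{1..n}. (\<Sum>A\<in>{1..n}. cubic x (e A) (e A) (e C))\<^sup>2) / 2
     + 1 / 2 * (real n * (real n - 1) - (\<Sum>i\<in>{1..k}. real (ns i) * (real (ns i) - 1))) * (\<kappa> / 4)"
proof -
  interpret cubic_form_partition "{1..n}" "{1..k}" blk "\<lambda>A B C. cubic x (e A) (e B) (e C)"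
    by (rule cubic_form_partition_adapted[OF ad])
  have e: "orthonormal_on (g x) {1..n} e" "span (e ` {1..n}) = UNIV"
    using ad unfolding adapted_def orthonormal_basis_iff dim_UNIV n[symmetric] by blast+
  have "a + 2 > 0" using weight_pos weight_eq[OF ad] by simp
  hence w: "1 - 1 / weight = (a - 1) / (a + 2)" unfolding weight_eq[OF ad] by (simp add: field_simps)
  show ?thesis
    unfolding bound w norm_mean_curvature[OF x e(1) finite_atLeastAtMost e(2) H, folded n, symmetric] by (simp add: algebra_simps)
qed

lemma tau_gap_le:
  assumes L: "L \<in> orthogonal_tuples (g x) k ns"
  shows "tau g x UNIV - (\<Sum>i\<in>{1..k}. tau g x (L i)) \<le> bound"
proof -
  obtain e where "adapted L e"
    using adapted_basis_exists[OF dom.inner_product_g[OF x] L ns_sum[unfolded n]] L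
    unfolding adapted_def n[symmetric] by blast
  note ad = this
  interpret cubic_form_partition "{1..n}" "{1..k}" blk "\<lambda>A B C. cubic x (e A) (e B) (e C)"
    by (rule cubic_form_partition_adapted[OF ad])
  show ?thesis unfolding tau_gap[OF ad] bound_eq[OF ad]
    by (intro add_right_mono divide_right_mono curv_le) simp
qed

text \<open>Every tuple has an adapted basis, so the algebraic estimate holds for every competitor
  and passes to the infimum.\<close>

theorem delta_le: "delta_invariant g x k ns \<le> bound"
proof -
  have "tau g x UNIV - bound \<le> (INF L\<in>orthogonal_tuples (g x) k ns. \<Sum>i=1..k. tau g x (L i))"
    by (rule cINF_greatest[OF orthogonal_tuples_nonempty[OF dom.inner_product_g[OF x] ns_sum[unfolded n]]])
      (use tau_gap_le in force)
  thus ?thesis unfolding delta_invariant_def by simp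
qed

theorem delta_eq:
  assumes eq: "delta_invariant g x k ns = bound"
    and min: "\<forall>L'\<in>orthogonal_tuples (g x) k ns. (\<Sum>i=1..k. tau g x (L i)) \<le> (\<Sum>i=1..k. tau g x (L' i))"
    and ad: "adapted L e"
    and h: "\<And>A B C. h C A B = cubic x (e A) (e B) (e C)"
  shows "\<And>A B C. A \<in> {1..n} \<Longrightarrow> B \<in> {1..n} \<Longrightarrow> C \<in> {1..n} \<Longrightarrow> A \<noteq> B \<Longrightarrow> B \<noteq> C \<Longrightarrow> A \<noteq> C \<Longrightarrow>
      \<not> (\<exists>i\<in>{1..k}. {A, B, C} \<subseteq> blk i) \<Longrightarrow> h A B C = 0"
    and "\<And>i j \<alpha> \<beta>. i \<in> {1..k} \<Longrightarrow> j \<in> {1..k} \<Longrightarrow> j \<noteq> i \<Longrightarrow> \<alpha> \<in> blk i \<Longrightarrow> \<beta> \<in> blk j \<Longrightarrow> h \<alpha> \<beta> \<beta> = 0"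
    and "\<And>i \<alpha> r. i \<in> {1..k} \<Longrightarrow> \<alpha> \<in> blk i \<Longrightarrow> r \<in> blk (k + 1) \<Longrightarrow> h \<alpha> r r = 0"
    and "\<And>i \<alpha>. i \<in> {1..k} \<Longrightarrow> \<alpha> \<in> blk i \<Longrightarrow> (\<Sum>\<beta>\<in>blk i. h \<alpha> \<beta> \<beta>) = 0"
    and "\<And>r s. r \<in> blk (k + 1) \<Longrightarrow> s \<in> blk (k + 1) \<Longrightarrow> s \<noteq> r \<Longrightarrow> h r r r = 3 * h r s s"
    and "\<And>r i \<alpha>. r \<in> blk (k + 1) \<Longrightarrow> i \<in> {1..k} \<Longrightarrow> \<alpha> \<in> blk i \<Longrightarrow> h r r r = (real (ns i) + 2) * h r \<alpha> \<alpha>"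
proof -
  interpret cubic_form_partition "{1..n}" "{1..k}" blk "\<lambda>A B C. cubic x (e A) (e B) (e C)"
    by (rule cubic_form_partition_adapted[OF ad])
  have E: "blk (k + 1) = E" unfolding E_def by (rule block_rest[OF ns_sum, symmetric])
  \<comment> \<open>The given tuple attains the infimum, so equality for the invariant is equality
    of the algebraic estimate in this very basis.\<close>
  have "(INF L\<in>orthogonal_tuples (g x) k ns. \<Sum>i=1..k. tau g x (L i)) = (\<Sum>i=1..k. tau g x (L i))"
    by (rule cInf_eq_minimum) (use ad min in \<open>auto simp: adapted_def\<close>)
  hence gap: "tau g x UNIV - (\<Sum>i\<in>{1..k}. tau g x (L i)) = bound" using eq by (simp add: delta_invariant_def)
  have half: "p / 2 + q = r / 2 + q \<Longrightarrow> p = r" for p q r :: real by simp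
  have eq': "(\<Sum>A\<in>{1..n}. \<Sum>B\<in>{1..n}. curv A B) - (\<Sum>i\<in>{1..k}. \<Sum>A\<in>blk i. \<Sum>B\<in>blk i. curv A B)
    = (1 - 1 / weight) * (\<Sum>C\<in>{1..n}. (sum (diag C) {1..n})\<^sup>2)"
    using gap unfolding tau_gap[OF ad] bound_eq[OF ad] by (rule half)
  have c2: "card (blk i) \<ge> 2" if "i \<in> {1..k}" for i by (rule card_D[OF that])
  \<comment> \<open>\<open>h C A A\<close> is \<open>diag C A\<close>: the first index of
    \<open>h\<close> decides which form \<open>bracket C\<close> supplies the conclusion.\<close>
  note br = curv_eq_bracket[OF eq']
  have E_in: "r \<in> {1..n}" if "r \<in> blk (k + 1)" for r using that unfolding E E_def by blast
  show "h A B C = 0" if "A \<in> {1..n}" "B \<in> {1..n}" "C \<in> {1..n}" "A \<noteq> B" "B \<noteq> C" "A \<noteq> C"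
    "\<not> (\<exists>i\<in>{1..k}. {A, B, C} \<subseteq> blk i)" for A B C
    unfolding h by (rule curv_eq_mixed[OF eq']) (use that in auto)
  show "h \<alpha> \<beta> \<beta> = 0" if "i \<in> {1..k}" "j \<in> {1..k}" "j \<noteq> i" "\<alpha> \<in> blk i" "\<beta> \<in> blk j" for i j \<alpha> \<beta>
    unfolding h using bracket_block_ge(3)[OF that(1,4) c2[OF that(1)] br that(2,3,5)] D_sub[OF that(1)] that(4) by blast
  show "h \<alpha> r r = 0" if "i \<in> {1..k}" "\<alpha> \<in> blk i" "r \<in> blk (k + 1)" for i \<alpha> r
    unfolding h using bracket_block_ge(2)[OF that(1,2) c2[OF that(1)] br that(3)[unfolded E]] D_sub[OF that(1)] that(2) by blast
  show "(\<Sum>\<beta>\<in>blk i. h \<alpha> \<beta> \<beta>) = 0" if "i \<in> {1..k}" "\<alpha> \<in> blk i" for i \<alpha>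
    unfolding h using bracket_block_ge(4)[OF that(1,2) c2[OF that(1)] br] D_sub[OF that(1)] that(2) by blast
  show "h r r r = 3 * h r s s" if "r \<in> blk (k + 1)" "s \<in> blk (k + 1)" "s \<noteq> r" for r s
    unfolding h using bracket_rest_ge(2)[OF that(1)[unfolded E] br[OF E_in[OF that(1)]] that(2)[unfolded E] that(3)] .
  show "h r r r = (real (ns i) + 2) * h r \<alpha> \<alpha>" if "r \<in> blk (k + 1)" "i \<in> {1..k}" "\<alpha> \<in> blk i" for r i \<alpha>
    unfolding h using bracket_rest_ge(3)[OF that(1)[unfolded E] br[OF E_in[OF that(1)]] that(2,3)]
    unfolding N_def card_block[OF that(2)] .
qed

end

section \<open>Charts\<close>

lemma cstruct_bounded_linear: "bounded_linear (cstruct :: complex ^ 'n \<Rightarrow> complex ^ 'n)"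
proof -
  have "linear (cstruct :: complex ^ 'n \<Rightarrow> complex ^ 'n)"
    by (rule linearI) (simp_all add: cstruct_def vec_eq_iff distrib_left)
  thus ?thesis by (simp add: linear_conv_bounded_linear)
qed

lemma cstruct_cstruct: "cstruct (cstruct v) = - v"
  by (simp add: cstruct_def vec_eq_iff flip: mult.assoc)

lemma is_chart_inj: "is_chart X \<phi> \<Longrightarrow> inj_on (snd \<phi>) (fst \<phi>)"
  using homeomorphic_imp_injective_map[of "subtopology X (fst \<phi>)" _ "snd \<phi>"] openin_subset[of X "fst \<phi>"]
  by (auto simp: is_chart_def topspace_subtopology Int_absorb1)

text \<open>The coordinate expression of \<open>F\<close> makes sense only on part of the chart.
  Continuity of \<open>F\<close> makes this part open, so it can serve as the domain of the
  geometric locales.\<close>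

lemma open_local_dom:
  assumes \<phi>: "is_chart X \<phi>" and F: "continuous_map X Y F" and \<psi>: "openin Y (fst \<psi>)"
  shows "open (local_dom \<phi> \<psi> F)"
proof -
  have "openin X {q \<in> topspace X. F q \<in> fst \<psi>}" by (rule openin_continuous_map_preimage[OF F \<psi>])
  moreover have "fst \<phi> \<inter> F -` fst \<psi> = fst \<phi> \<inter> {q \<in> topspace X. F q \<in> fst \<psi>}"
    using \<phi> openin_subset unfolding is_chart_def by blast
  ultimately have "openin (subtopology X (fst \<phi>)) (fst \<phi> \<inter> F -` fst \<psi>)"
    by (metis openin_subtopology_Int2)
  hence "openin (top_of_set (snd \<phi> ` fst \<phi>)) (local_dom \<phi> \<psi> F)"
    using \<phi> homeomorphic_imp_open_map unfolding is_chart_def open_map_def local_dom_def by blast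
  thus ?thesis using \<phi> openin_open_trans unfolding is_chart_def by blast
qed

lemma local_expr_in:
  assumes \<phi>: "is_chart X \<phi>" and y: "y \<in> local_dom \<phi> \<psi> F"
  shows "local_expr \<phi> \<psi> F y \<in> snd \<psi> ` fst \<psi>"
proof -
  obtain q where q: "y = snd \<phi> q" "q \<in> fst \<phi>" "F q \<in> fst \<psi>" using y by (auto simp: local_dom_def)
  have "inv_into (fst \<phi>) (snd \<phi>) y = q" unfolding q(1) by (rule inv_into_f_f[OF is_chart_inj[OF \<phi>] q(2)])
  thus ?thesis using q by (simp add: local_expr_def)
qed

lemma riemannian_chart: "riemannian_manifold M \<Longrightarrow> \<phi> \<in> atlas M \<Longrightarrow> is_chart (mtop M) \<phi>"
  unfolding riemannian_manifold_def smooth_manifold_def by meson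

lemma metric_domain_chart:
  assumes M: "riemannian_manifold M" and \<phi>: "\<phi> \<in> atlas M" and U: "open U" "U \<subseteq> snd \<phi> ` fst \<phi>"
  shows "metric_domain U (metric M \<phi>)"
proof
  note R = M[unfolded riemannian_manifold_def, THEN conjunct2, THEN conjunct1, THEN bspec, OF \<phi>]
  show "smooth_on U (\<lambda>x. metric M \<phi> x u v)" for u v
    by (rule smooth_on_subset[OF _ U(2)]) (use R in blast)
  show "inner_product (metric M \<phi> x)" if "x \<in> U" for x
    using R that U(2) by blast
qed (rule U(1))

lemma kaehler_domain_chart:
  fixes N :: "('b, complex ^ 'n) riem_manifold"
  assumes N: "complex_space_form N \<kappa>" and \<psi>: "\<psi> \<in> atlas N"
  shows "kaehler_domain (snd \<psi> ` fst \<psi>) (metric N \<psi>) cstruct \<kappa>"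
proof -
  have K: "kaehler_manifold N" and R: "riemannian_manifold N"
    using N unfolding complex_space_form_def kaehler_manifold_def by blast+
  have "open (snd \<psi> ` fst \<psi>)"
    using riemannian_chart[OF R \<psi>] by (simp add: is_chart_def)
  then interpret metric_domain "snd \<psi> ` fst \<psi>" "metric N \<psi>" by (rule metric_domain_chart[OF R \<psi> _ order_refl])
  show ?thesis
  proof (rule kaehler_domain.intro[OF metric_domain_axioms], rule kaehler_domain_axioms.intro)
    fix y u v :: "complex ^ 'n" assume y: "y \<in> snd \<psi> ` fst \<psi>"
    note K' = K[unfolded kaehler_manifold_def, THEN conjunct2, THEN conjunct2, THEN bspec, OF \<psi>, THEN bspec, OF y]
    show "metric N \<psi> y (cstruct u) (cstruct v) = metric N \<psi> y u v"
      using K' by blast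
    \<comment> \<open>For constant fields the derivative terms vanish, and parallelism of
      \<open>J\<close> reduces to a statement about the Christoffel map.\<close>
    have "cov_deriv (metric N \<psi>) (\<lambda>_. u) (\<lambda>_. cstruct v) y = cstruct (cov_deriv (metric N \<psi>) (\<lambda>_. u) (\<lambda>_. v) y)"
      by (rule K'[THEN conjunct2, rule_format]) simp
    thus "christoffel (metric N \<psi>) y u (cstruct v) = cstruct (christoffel (metric N \<psi>) y u v)"
      by (simp add: cov_deriv_def)
    show "sec_curv (metric N \<psi>) y u (cstruct u) = \<kappa>" if "u \<noteq> 0"
      using N[unfolded complex_space_form_def, THEN conjunct2, THEN bspec, OF \<psi>, THEN bspec, OF y] that by blast
  qed (rule cstruct_bounded_linear cstruct_cstruct)+
qed

lemma lagrangian_domain_chart: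
  fixes M :: "('a, real ^ 'n) riem_manifold" and N :: "('b, complex ^ 'n) riem_manifold"
  assumes M: "riemannian_manifold M" and N: "complex_space_form N \<kappa>" and F: "lagrangian_immersion M N F"
    and \<phi>: "\<phi> \<in> atlas M" and \<psi>: "\<psi> \<in> atlas N"
  shows "lagrangian_domain (local_dom \<phi> \<psi> F) (metric M \<phi>) (snd \<psi> ` fst \<psi>) (metric N \<psi>) (local_expr \<phi> \<psi> F) cstruct \<kappa>"
proof -
  let ?U = "local_dom \<phi> \<psi> F" and ?f = "local_expr \<phi> \<psi> F"
  interpret amb: kaehler_domain "snd \<psi> ` fst \<psi>" "metric N \<psi>" cstruct \<kappa> by (rule kaehler_domain_chart[OF N \<psi>])
  have iso: "isometric_immersion M N F" using F unfolding lagrangian_immersion_def by (rule conjunct1)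
  note iso' = iso[unfolded isometric_immersion_def, THEN conjunct2, THEN bspec, OF \<phi>, THEN bspec, OF \<psi>]
  have c\<phi>: "is_chart (mtop M) \<phi>" by (rule riemannian_chart[OF M \<phi>])
  have c\<psi>: "is_chart (mtop N) \<psi>"
    using N unfolding complex_space_form_def kaehler_manifold_def by (intro riemannian_chart[OF _ \<psi>]) blast
  have "open ?U"
    by (rule open_local_dom[OF c\<phi>]) (use iso c\<psi> in \<open>auto simp: isometric_immersion_def is_chart_def\<close>)
  moreover have "?U \<subseteq> snd \<phi> ` fst \<phi>" by (auto simp: local_dom_def)
  ultimately interpret dom: metric_domain ?U "metric M \<phi>" by (rule metric_domain_chart[OF M \<phi>])
  have lag: "(\<forall>\<xi>\<in>range (diff_at ?f y). \<forall>\<eta>\<in>range (diff_at ?f y). metric N \<psi> (?f y) (cstruct \<xi>) \<eta> = 0) \<and>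
      (\<forall>\<xi>. (\<forall>\<eta>\<in>range (diff_at ?f y). metric N \<psi> (?f y) \<xi> \<eta> = 0) \<longrightarrow> cstruct \<xi> \<in> range (diff_at ?f y))" if "y \<in> ?U" for y
    by (rule F[unfolded lagrangian_immersion_def Let_def, THEN conjunct2, THEN bspec, OF \<phi>, THEN bspec, OF \<psi>, THEN bspec, OF that])
  show ?thesis
  proof
    show "smooth_on ?U ?f" using iso' by (rule conjunct1)
    show "?f y \<in> snd \<psi> ` fst \<psi>" if "y \<in> ?U" for y by (rule local_expr_in[OF c\<phi> that])
    show "metric M \<phi> y u v = metric N \<psi> (?f y) (diff_at ?f y u) (diff_at ?f y v)" if "y \<in> ?U" for y u v
      using iso'[THEN conjunct2, THEN bspec, OF that] by blast
    show "metric N \<psi> (?f y) (cstruct (diff_at ?f y u)) (diff_at ?f y v) = 0" if "y \<in> ?U" for y u v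
      using lag[OF that] by blast
    show "cstruct \<xi> \<in> range (diff_at ?f y)" if "y \<in> ?U" "\<And>v. metric N \<psi> (?f y) \<xi> (diff_at ?f y v) = 0" for y \<xi>
      using lag[OF that(1)] that(2) by blast
  qed
qed

theorem theorem3p1:
  fixes M :: "('a, real ^ 'n) riem_manifold"
    and N :: "('b, complex ^ 'n) riem_manifold"
    and F :: "'a \<Rightarrow> 'b"
    and c :: real
    and n k :: nat
    and ns :: "nat \<Rightarrow> nat"
    and p :: 'a
    and \<phi> :: "('a, real ^ 'n) chart"
    and \<psi> :: "('b, complex ^ 'n) chart"
    and x :: "real ^ 'n"
    and f :: "real ^ 'n \<Rightarrow> complex ^ 'n"
    and g :: "real ^ 'n \<Rightarrow> real ^ 'n \<Rightarrow> real ^ 'n \<Rightarrow> real"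
    and g' :: "complex ^ 'n \<Rightarrow> complex ^ 'n \<Rightarrow> complex ^ 'n \<Rightarrow> real"
    and H :: "complex ^ 'n"
    and a bound :: real
  assumes n: "n = CARD('n)"
    and M: "riemannian_manifold M"
    and N: "complex_space_form N (4 * c)"
    and F: "lagrangian_immersion M N F"
    and k: "1 \<le> k"
    and ns_range: "\<forall>i\<in>{1..k}. 2 \<le> ns i \<and> ns i \<le> n - 1"
    and ns_mono: "\<forall>i\<in>{1..k}. \<forall>j\<in>{1..k}. i \<le> j \<longrightarrow> ns i \<le> ns j"
    and ns_sum: "(\<Sum>i=1..k. ns i) < n"
    and p: "p \<in> topspace (mtop M)"
    and \<phi>: "\<phi> \<in> atlas M" "p \<in> fst \<phi>"
    and \<psi>: "\<psi> \<in> atlas N" "F p \<in> fst \<psi>"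
    and x: "x = snd \<phi> p"
    and f: "f = local_expr \<phi> \<psi> F"
    and g: "g = metric M \<phi>"
    and g': "g' = metric N \<psi>"
    and H: "H = mean_curvature g g' f x"
    and a: "a = real n - (\<Sum>i=1..k. real (ns i)) + 3 * real k - 6 * (\<Sum>i=1..k. 1 / (2 + real (ns i)))"
    and bound: "bound = (real n)\<^sup>2 * (a - 1) / (2 * (a + 2)) * g' (f x) H H
       + 1 / 2 * (real n * (real n - 1) - (\<Sum>i=1..k. real (ns i) * (real (ns i) - 1))) * c"
  shows "delta_invariant g x k ns \<le> bound
    \<and> (delta_invariant g x k ns = bound \<longrightarrow>
        (\<forall>L e h.
           L \<in> orthogonal_tuples (g x) k ns
           \<and> (\<forall>L'\<in>orthogonal_tuples (g x) k ns. (\<Sum>i=1..k. tau g x (L i)) \<le> (\<Sum>i=1..k. tau g x (L' i)))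
           \<and> orthonormal_basis (g x) UNIV e
           \<and> (\<forall>i\<in>{1..k}. \<forall>A\<in>block n k ns i. e A \<in> L i)
           \<and> (\<forall>A B C. h C A B =
                g' (f x) (second_fund_form g g' f x (e A) (e B)) (cstruct (diff_at f x (e C))))
           \<longrightarrow>
           (\<forall>A\<in>{1..n}. \<forall>B\<in>{1..n}. \<forall>C\<in>{1..n}.
              A \<noteq> B \<and> B \<noteq> C \<and> A \<noteq> C \<and> \<not> (\<exists>i\<in>{1..k}. {A, B, C} \<subseteq> block n k ns i)
              \<longrightarrow> h A B C = 0)
           \<and> (\<forall>i\<in>{1..k}. \<forall>\<alpha>\<in>block n k ns i.
                (\<forall>j\<in>{1..k}. j \<noteq> i \<longrightarrow> (\<forall>\<beta>\<in>block n k ns j. h \<alpha> \<beta> \<beta> = 0))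
                \<and> (\<forall>r\<in>block n k ns (k + 1). h \<alpha> r r = 0)
                \<and> (\<Sum>\<beta>\<in>block n k ns i. h \<alpha> \<beta> \<beta>) = 0)
           \<and> (\<forall>r\<in>block n k ns (k + 1).
                (\<forall>s\<in>block n k ns (k + 1). s \<noteq> r \<longrightarrow> h r r r = 3 * h r s s)
                \<and> (\<forall>i\<in>{1..k}. \<forall>\<alpha>\<in>block n k ns i. h r r r = (real (ns i) + 2) * h r \<alpha> \<alpha>))))"
proof -
  \<comment> \<open>The parameter is the holomorphic curvature \<open>4 * c\<close>; its quarter is
    the curvature of totally real planes.\<close>
  interpret chen_data "local_dom \<phi> \<psi> F" g "snd \<psi> ` fst \<psi>" g' f cstruct "4 * c" x n k ns H a bound
  proof (rule chen_data.intro)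
    show "lagrangian_domain (local_dom \<phi> \<psi> F) g (snd \<psi> ` fst \<psi>) g' f cstruct (4 * c)"
      unfolding f g g' by (rule lagrangian_domain_chart[OF M N F \<phi>(1) \<psi>(1)])
    show "chen_data_axioms (local_dom \<phi> \<psi> F) g g' f (4 * c) x n k ns H a bound"
    proof
      show "x \<in> local_dom \<phi> \<psi> F" using x \<phi> \<psi> by (auto simp: local_dom_def)
      show "n = DIM(real ^ 'n)" using n by simp
      show "2 \<le> ns i" if "i \<in> {1..k}" for i using ns_range that by blast
      show "(\<Sum>i\<in>{1..k}. ns i) \<le> n" using ns_sum by simp
      show "H = mean_curvature g g' f x" by (rule H)
      show "a = real n - (\<Sum>i\<in>{1..k}. real (ns i)) + 3 * real k - 6 * (\<Sum>i\<in>{1..k}. 1 / (2 + real (ns i)))" by (rule a)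
      show "bound = (real n)\<^sup>2 * (a - 1) / (2 * (a + 2)) * g' (f x) H H
         + 1 / 2 * (real n * (real n - 1) - (\<Sum>i\<in>{1..k}. real (ns i) * (real (ns i) - 1))) * (4 * c / 4)"
        unfolding bound by simp
    qed
  qed
  show ?thesis
  proof (intro conjI impI allI delta_le)
    fix L e h
    assume eq: "delta_invariant g x k ns = bound"
      and A: "L \<in> orthogonal_tuples (g x) k ns
           \<and> (\<forall>L'\<in>orthogonal_tuples (g x) k ns. (\<Sum>i=1..k. tau g x (L i)) \<le> (\<Sum>i=1..k. tau g x (L' i)))
           \<and> orthonormal_basis (g x) UNIV e
           \<and> (\<forall>i\<in>{1..k}. \<forall>A\<in>block n k ns i. e A \<in> L i)
           \<and> (\<forall>A B C. h C A B =
                g' (f x) (second_fund_form g g' f x (e A) (e B)) (cstruct (diff_at f x (e C))))"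
    have min: "\<forall>L'\<in>orthogonal_tuples (g x) k ns. (\<Sum>i=1..k. tau g x (L i)) \<le> (\<Sum>i=1..k. tau g x (L' i))"
      using A by blast
    have ad: "adapted L e" using A unfolding adapted_def by blast
    have h: "h C A B = cubic x (e A) (e B) (e C)" for A B C using A unfolding cubic_def by blast
    note E = delta_eq[OF eq min ad h]
    show "\<forall>A\<in>{1..n}. \<forall>B\<in>{1..n}. \<forall>C\<in>{1..n}.
              A \<noteq> B \<and> B \<noteq> C \<and> A \<noteq> C \<and> \<not> (\<exists>i\<in>{1..k}. {A, B, C} \<subseteq> block n k ns i) \<longrightarrow> h A B C = 0"
      by (intro ballI impI) (rule E(1); blast)
    show "\<forall>i\<in>{1..k}. \<forall>\<alpha>\<in>block n k ns i.
                (\<forall>j\<in>{1..k}. j \<noteq> i \<longrightarrow> (\<forall>\<beta>\<in>block n k ns j. h \<alpha> \<beta> \<beta> = 0))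
                \<and> (\<forall>r\<in>block n k ns (k + 1). h \<alpha> r r = 0)
                \<and> (\<Sum>\<beta>\<in>block n k ns i. h \<alpha> \<beta> \<beta>) = 0"
      by (intro ballI conjI impI) (rule E(2) E(3) E(4); assumption)+
    show "\<forall>r\<in>block n k ns (k + 1).
                (\<forall>s\<in>block n k ns (k + 1). s \<noteq> r \<longrightarrow> h r r r = 3 * h r s s)
                \<and> (\<forall>i\<in>{1..k}. \<forall>\<alpha>\<in>block n k ns i. h r r r = (real (ns i) + 2) * h r \<alpha> \<alpha>)"
      by (intro ballI conjI impI) (rule E(5) E(6); assumption)+
  qed
qed

end
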